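(* Assume the system $\textsf{P}+\Pi^1_1\text{-}\textsf{TRANS}$ is consistent. Then $\textsf{P}+\Pi^1_1\text{-}\textsf{TRANS}$ does not prove $\textsf{STP}$.
   Context: Types: $0$ is the type of natural numbers, $1=0\to0$, $2=1\to0$, and $\tau^*$ is the type of finite sequences of objects of type $\tau$. $\textsf{E-PA}^{\omega*}$ is classical Peano arithmetic in all finite types with the axiom of extensionality, definitionally extended with the types $\tau^*$. The language of $\textsf{P}$ adds a predicate $\text{st}$ ("is standard") for every type. $(\forall^{\text{st}}x)A$ abbreviates $(\forall x)(\text{st}(x)\to A)$ and $(\exists^{\text{st}}x)A$ abbreviates $(\exists x)(\text{st}(x)\wedge A)$; a formula is internal if it does not involve $\text{st}$. The system $\textsf{P}$ consists of $\textsf{E-PA}^{\omega*}$ (axioms for internal formulas) plus: (1) $\text{st}(x)\wedge x=y\to\text{st}(y)$; $\text{st}(t)$ for every closed term $t$ of $\textsf{E-PA}^{\omega*}$; $\text{st}(f)\wedge\text{st}(x)\to\text{st}(f(x))$; (2) external induction: $\Phi(0)\wedge(\forall^{\text{st}}n^0)(\Phi(n)\to\Phi(n+1))\to(\forall^{\text{st}}n^0)\Phi(n)$ for every (possibly external) $\Phi$; (3) Idealisation $\textsf{I}$: $(\forall^{\text{st}}x^{\sigma^*})(\exists y^\tau)(\forall z^\sigma\in x)\varphi(z,y)\to(\exists y^\tau)(\forall^{\text{st}}x^\sigma)\varphi(x,y)$ for internal $\varphi$; (4) $\textsf{HAC}_{\textsf{int}}$: $(\forall^{\text{st}}x^\rho)(\exists^{\text{st}}y^\tau)\varphi(x,y)\to(\exists^{\text{st}}F^{\rho\to\tau^*})(\forall^{\text{st}}x^\rho)(\exists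 y^\tau\in F(x))\varphi(x,y)$ for internal $\varphi$. $\Pi^1_1\text{-}\textsf{TRANS}$: $(\forall^{\text{st}}f^1)\big[(\exists g^1)(\forall n^0)(f(\overline{g}n)=0)\to(\exists^{\text{st}}g^1)(\forall n^0)(f(\overline{g}n)=0)\big]$, where $\overline{g}n$ is (the code of) the initial segment $\langle g(0),\dots,g(n-1)\rangle$. $\textsf{STP}$: $(\forall\alpha^1\leq_11)(\exists^{\text{st}}\beta^1\leq_11)(\alpha\approx_1\beta)$, where $\alpha\leq_11$ means $\alpha(n)\le1$ for all $n$, and $\alpha\approx_1\beta$ means $(\forall^{\text{st}}n^0)(\alpha(n)=\beta(n))$. *)

theory Defs
  imports Main
begin

section \<open>Terms of E-PA\<open>\<omega>*\<close>\<close>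

datatype ty = Base | Fun ty ty (infixr "\<rightarrow>" 70) | SeqT ty

text \<open>A variable carries its type, so variables of different types are different variables.\<close>

type_synonym var = "nat \<times> ty"

text \<open>
  \<open>Rec \<sigma>\<close> is primitive recursion with values of type \<open>\<sigma>\<close>, \<open>Prep \<sigma>\<close> prepends an object
  of type \<open>\<sigma>\<close> to a sequence, and \<open>SRec \<sigma> \<rho>\<close> is recursion over sequences of objects of
  type \<open>\<sigma>\<close> with values of type \<open>\<rho>\<close>.
\<close>

datatype tm =
    Var var
  | App tm tm (infixl "\<cdot>" 90)
  | Zero
  | Succ
  | CombK ty ty
  | CombS ty ty ty
  | Rec ty
  | Empty ty
  | Prep ty
  | SRec ty ty

text \<open>
  \<open>ty_of\<close> is total; its value is meaningful only on terms satisfying \<open>wt\<close>.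
\<close>

primrec ty_of :: "tm \<Rightarrow> ty" where
  "ty_of (Var x) = snd x"
| "ty_of (s \<cdot> t) = (case ty_of s of \<sigma> \<rightarrow> \<tau> \<Rightarrow> \<tau> | _ \<Rightarrow> Base)"
| "ty_of Zero = Base"
| "ty_of Succ = Base \<rightarrow> Base"
| "ty_of (CombK \<sigma> \<tau>) = \<sigma> \<rightarrow> \<tau> \<rightarrow> \<sigma>"
| "ty_of (CombS \<rho> \<sigma> \<tau>) = (\<rho> \<rightarrow> \<sigma> \<rightarrow> \<tau>) \<rightarrow> (\<rho> \<rightarrow> \<sigma>) \<rightarrow> \<rho> \<rightarrow> \<tau>"
| "ty_of (Rec \<sigma>) = \<sigma> \<rightarrow> (Base \<rightarrow> \<sigma> \<rightarrow> \<sigma>) \<rightarrow> Base \<rightarrow> \<sigma>"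
| "ty_of (Empty \<sigma>) = SeqT \<sigma>"
| "ty_of (Prep \<sigma>) = \<sigma> \<rightarrow> SeqT \<sigma> \<rightarrow> SeqT \<sigma>"
| "ty_of (SRec \<sigma> \<rho>) = \<rho> \<rightarrow> (\<sigma> \<rightarrow> SeqT \<sigma> \<rightarrow> \<rho> \<rightarrow> \<rho>) \<rightarrow> SeqT \<sigma> \<rightarrow> \<rho>"

primrec wt :: "tm \<Rightarrow> bool" where
  "wt (Var x) = True"
| "wt (s \<cdot> t) = (wt s \<and> wt t \<and> (\<exists>\<tau>. ty_of s = ty_of t \<rightarrow> \<tau>))"
| "wt Zero = True"
| "wt Succ = True"
| "wt (CombK \<sigma> \<tau>) = True"
| "wt (CombS \<rho> \<sigma> \<tau>) = True"
| "wt (Rec \<sigma>) = True"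
| "wt (Empty \<sigma>) = True"
| "wt (Prep \<sigma>) = True"
| "wt (SRec \<sigma> \<rho>) = True"

primrec fvt :: "tm \<Rightarrow> var set" where
  "fvt (Var x) = {x}"
| "fvt (s \<cdot> t) = fvt s \<union> fvt t"
| "fvt Zero = {}"
| "fvt Succ = {}"
| "fvt (CombK \<sigma> \<tau>) = {}"
| "fvt (CombS \<rho> \<sigma> \<tau>) = {}"
| "fvt (Rec \<sigma>) = {}"
| "fvt (Empty \<sigma>) = {}"
| "fvt (Prep \<sigma>) = {}"
| "fvt (SRec \<sigma> \<rho>) = {}"

primrec subt :: "tm \<Rightarrow> var \<Rightarrow> tm \<Rightarrow> tm" where
  "subt (Var y) x u = (if y = x then u else Var y)"
| "subt (s \<cdot> t) x u = subt s x u \<cdot> subt t x u"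
| "subt Zero x u = Zero"
| "subt Succ x u = Succ"
| "subt (CombK \<sigma> \<tau>) x u = CombK \<sigma> \<tau>"
| "subt (CombS \<rho> \<sigma> \<tau>) x u = CombS \<rho> \<sigma> \<tau>"
| "subt (Rec \<sigma>) x u = Rec \<sigma>"
| "subt (Empty \<sigma>) x u = Empty \<sigma>"
| "subt (Prep \<sigma>) x u = Prep \<sigma>"
| "subt (SRec \<sigma> \<rho>) x u = SRec \<sigma> \<rho>"


section \<open>Formulas\<close>

text \<open>
  Equality is available at every type.  The logic is classical, so the remaining connectives
  are defined from falsity, implication and universal quantification.
\<close>

datatype fm =
    Falsum
  | Eq tm tm (infix "\<^bold>=" 65)
  | St tm
  | Imp fm fm (infixr "\<^bold>\<longrightarrow>" 55)
  | All var fm ("(\<^bold>\<forall>_./ _)" [100, 54] 54)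

definition Neg :: "fm \<Rightarrow> fm" where
  "Neg A = (A \<^bold>\<longrightarrow> Falsum)"

definition And :: "fm \<Rightarrow> fm \<Rightarrow> fm" (infixr "\<^bold>\<and>" 60) where
  "A \<^bold>\<and> B = Neg (A \<^bold>\<longrightarrow> Neg B)"

definition Or :: "fm \<Rightarrow> fm \<Rightarrow> fm" (infixr "\<^bold>\<or>" 57) where
  "A \<^bold>\<or> B = (Neg A \<^bold>\<longrightarrow> B)"

definition Ex :: "var \<Rightarrow> fm \<Rightarrow> fm" ("(\<^bold>\<exists>_./ _)" [100, 54] 54) where
  "(\<^bold>\<exists>x. A) = Neg (\<^bold>\<forall>x. Neg A)"

definition AllSt :: "var \<Rightarrow> fm \<Rightarrow> fm" ("(\<^bold>\<forall>\<^sup>s\<^sup>t_./ _)" [100, 54] 54) where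
  "(\<^bold>\<forall>\<^sup>s\<^sup>t x. A) = (\<^bold>\<forall>x. St (Var x) \<^bold>\<longrightarrow> A)"

definition ExSt :: "var \<Rightarrow> fm \<Rightarrow> fm" ("(\<^bold>\<exists>\<^sup>s\<^sup>t_./ _)" [100, 54] 54) where
  "(\<^bold>\<exists>\<^sup>s\<^sup>t x. A) = (\<^bold>\<exists>x. St (Var x) \<^bold>\<and> A)"

primrec wff :: "fm \<Rightarrow> bool" where
  "wff Falsum = True"
| "wff (s \<^bold>= t) = (wt s \<and> wt t \<and> ty_of s = ty_of t)"
| "wff (St t) = wt t"
| "wff (A \<^bold>\<longrightarrow> B) = (wff A \<and> wff B)"
| "wff (\<^bold>\<forall>x. A) = wff A"

primrec internal :: "fm \<Rightarrow> bool" where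
  "internal Falsum = True"
| "internal (s \<^bold>= t) = True"
| "internal (St t) = False"
| "internal (A \<^bold>\<longrightarrow> B) = (internal A \<and> internal B)"
| "internal (\<^bold>\<forall>x. A) = internal A"

primrec fvf :: "fm \<Rightarrow> var set" where
  "fvf Falsum = {}"
| "fvf (s \<^bold>= t) = fvt s \<union> fvt t"
| "fvf (St t) = fvt t"
| "fvf (A \<^bold>\<longrightarrow> B) = fvf A \<union> fvf B"
| "fvf (\<^bold>\<forall>x. A) = fvf A - {x}"

text \<open>Substitution does not rename bound variables; \<open>free_for\<close> says that nothing is captured.\<close>

primrec subf :: "fm \<Rightarrow> var \<Rightarrow> tm \<Rightarrow> fm" where
  "subf Falsum x u = Falsum"
| "subf (s \<^bold>= t) x u = (subt s x u \<^bold>= subt t x u)"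
| "subf (St t) x u = St (subt t x u)"
| "subf (A \<^bold>\<longrightarrow> B) x u = (subf A x u \<^bold>\<longrightarrow> subf B x u)"
| "subf (\<^bold>\<forall>y. A) x u = (if y = x then (\<^bold>\<forall>y. A) else (\<^bold>\<forall>y. subf A x u))"

primrec free_for :: "tm \<Rightarrow> var \<Rightarrow> fm \<Rightarrow> bool" where
  "free_for u x Falsum = True"
| "free_for u x (s \<^bold>= t) = True"
| "free_for u x (St t) = True"
| "free_for u x (A \<^bold>\<longrightarrow> B) = (free_for u x A \<and> free_for u x B)"
| "free_for u x (\<^bold>\<forall>y. A) = (x \<notin> fvf A - {y} \<or> y \<notin> fvt u \<and> free_for u x A)"


section \<open>Derivability\<close>

text \<open>
  A Hilbert calculus for classical many-sorted predicate logic.  Non-logical axioms may have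
  free variables; by the generalisation rule they stand for their universal closures.
\<close>

inductive derives :: "fm set \<Rightarrow> fm \<Rightarrow> bool" (infix "\<^bold>\<turnstile>" 51) for T :: "fm set" where
  Ax: "A \<in> T \<Longrightarrow> wff A \<Longrightarrow> T \<^bold>\<turnstile> A"
| P1: "wff A \<Longrightarrow> wff B \<Longrightarrow> T \<^bold>\<turnstile> A \<^bold>\<longrightarrow> B \<^bold>\<longrightarrow> A"
| P2: "wff A \<Longrightarrow> wff B \<Longrightarrow> wff C \<Longrightarrow>
    T \<^bold>\<turnstile> (A \<^bold>\<longrightarrow> B \<^bold>\<longrightarrow> C) \<^bold>\<longrightarrow> (A \<^bold>\<longrightarrow> B) \<^bold>\<longrightarrow> A \<^bold>\<longrightarrow> C"
| P3: "wff A \<Longrightarrow> T \<^bold>\<turnstile> Neg (Neg A) \<^bold>\<longrightarrow> A"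
| Inst: "wff A \<Longrightarrow> wt t \<Longrightarrow> ty_of t = snd x \<Longrightarrow> free_for t x A \<Longrightarrow>
    T \<^bold>\<turnstile> (\<^bold>\<forall>x. A) \<^bold>\<longrightarrow> subf A x t"
| Distr: "wff A \<Longrightarrow> wff B \<Longrightarrow> x \<notin> fvf A \<Longrightarrow>
    T \<^bold>\<turnstile> (\<^bold>\<forall>x. A \<^bold>\<longrightarrow> B) \<^bold>\<longrightarrow> A \<^bold>\<longrightarrow> (\<^bold>\<forall>x. B)"
| MP: "T \<^bold>\<turnstile> A \<^bold>\<longrightarrow> B \<Longrightarrow> T \<^bold>\<turnstile> A \<Longrightarrow> T \<^bold>\<turnstile> B"
| Gen: "T \<^bold>\<turnstile> A \<Longrightarrow> T \<^bold>\<turnstile> (\<^bold>\<forall>x. A)"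

definition consistent :: "fm set \<Rightarrow> bool" where
  "consistent T \<longleftrightarrow> \<not> (T \<^bold>\<turnstile> Falsum)"


section \<open>Some defined terms\<close>

text \<open>Bracket abstraction for the combinators.\<close>

primrec lam :: "var \<Rightarrow> tm \<Rightarrow> tm" ("(\<^bold>\<lambda>_./ _)" [100, 80] 80) where
  "(\<^bold>\<lambda>x. Var y) =
     (if x = y then CombS (snd x) (snd x \<rightarrow> snd x) (snd x)
                      \<cdot> CombK (snd x) (snd x \<rightarrow> snd x) \<cdot> CombK (snd x) (snd x)
      else CombK (snd y) (snd x) \<cdot> Var y)"
| "(\<^bold>\<lambda>x. s \<cdot> t) = CombS (snd x) (ty_of t) (ty_of (s \<cdot> t)) \<cdot> (\<^bold>\<lambda>x. s) \<cdot> (\<^bold>\<lambda>x. t)"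
| "(\<^bold>\<lambda>x. Zero) = CombK Base (snd x) \<cdot> Zero"
| "(\<^bold>\<lambda>x. Succ) = CombK (ty_of Succ) (snd x) \<cdot> Succ"
| "(\<^bold>\<lambda>x. CombK \<sigma> \<tau>) = CombK (ty_of (CombK \<sigma> \<tau>)) (snd x) \<cdot> CombK \<sigma> \<tau>"
| "(\<^bold>\<lambda>x. CombS \<rho> \<sigma> \<tau>) = CombK (ty_of (CombS \<rho> \<sigma> \<tau>)) (snd x) \<cdot> CombS \<rho> \<sigma> \<tau>"
| "(\<^bold>\<lambda>x. Rec \<sigma>) = CombK (ty_of (Rec \<sigma>)) (snd x) \<cdot> Rec \<sigma>"
| "(\<^bold>\<lambda>x. Empty \<sigma>) = CombK (ty_of (Empty \<sigma>)) (snd x) \<cdot> Empty \<sigma>"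
| "(\<^bold>\<lambda>x. Prep \<sigma>) = CombK (ty_of (Prep \<sigma>)) (snd x) \<cdot> Prep \<sigma>"
| "(\<^bold>\<lambda>x. SRec \<sigma> \<rho>) = CombK (ty_of (SRec \<sigma> \<rho>)) (snd x) \<cdot> SRec \<sigma> \<rho>"

text \<open>
  In the following definitions the step terms under the recursors are closed, so that
  the arguments cannot be captured.
\<close>

definition plus_tm :: "tm \<Rightarrow> tm \<Rightarrow> tm" where
  "plus_tm s t = (let k = (0, Base); r = (1, Base) in
     Rec Base \<cdot> s \<cdot> (\<^bold>\<lambda>k. \<^bold>\<lambda>r. Succ \<cdot> Var r) \<cdot> t)"

definition pred_tm :: "tm \<Rightarrow> tm" where
  "pred_tm t = (let k = (0, Base); r = (1, Base) in
     Rec Base \<cdot> Zero \<cdot> (\<^bold>\<lambda>k. \<^bold>\<lambda>r. Var k) \<cdot> t)"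

text \<open>Truncated subtraction.\<close>

definition monus_tm :: "tm \<Rightarrow> tm \<Rightarrow> tm" where
  "monus_tm s t = (let k = (0, Base); r = (1, Base) in
     Rec Base \<cdot> s \<cdot> (\<^bold>\<lambda>k. \<^bold>\<lambda>r. pred_tm (Var r)) \<cdot> t)"

definition Leq :: "tm \<Rightarrow> tm \<Rightarrow> fm" (infix "\<^bold>\<le>" 65) where
  "s \<^bold>\<le> t = (monus_tm s t \<^bold>= Zero)"

text \<open>The pairing function \<open>(m, n) \<mapsto> (m + n)(m + n + 1) / 2 + n\<close>.\<close>

definition triangle_tm :: "tm \<Rightarrow> tm" where
  "triangle_tm t = (let k = (0, Base); r = (1, Base) in
     Rec Base \<cdot> Zero \<cdot> (\<^bold>\<lambda>k. \<^bold>\<lambda>r. plus_tm (Succ \<cdot> Var k) (Var r)) \<cdot> t)"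

definition pair_tm :: "tm \<Rightarrow> tm \<Rightarrow> tm" where
  "pair_tm s t = plus_tm (triangle_tm (plus_tm s t)) t"

text \<open>The code of \<open>\<langle>\<rangle>\<close> is \<open>0\<close>; that of \<open>a\<close> followed by \<open>s\<close> is the successor of
  the pair of \<open>a\<close> and the code of \<open>s\<close>.\<close>

definition code_tm :: "tm \<Rightarrow> tm" where
  "code_tm s = (let a = (0, Base); q = (0, SeqT Base); r = (1, Base) in
     SRec Base Base \<cdot> Zero \<cdot> (\<^bold>\<lambda>a. \<^bold>\<lambda>q. \<^bold>\<lambda>r. Succ \<cdot> pair_tm (Var a) (Var r)) \<cdot> s)"

definition length_tm :: "ty \<Rightarrow> tm \<Rightarrow> tm" where
  "length_tm \<sigma> s = (let a = (0, \<sigma>); q = (0, SeqT \<sigma>); r = (1, Base) in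
     SRec \<sigma> Base \<cdot> Zero \<cdot> (\<^bold>\<lambda>a. \<^bold>\<lambda>q. \<^bold>\<lambda>r. Succ \<cdot> Var r) \<cdot> s)"

primrec zero_tm :: "ty \<Rightarrow> tm" where
  "zero_tm Base = Zero"
| "zero_tm (\<sigma> \<rightarrow> \<tau>) = CombK \<tau> \<sigma> \<cdot> zero_tm \<tau>"
| "zero_tm (SeqT \<sigma>) = Empty \<sigma>"

text \<open>The entry of \<open>s\<close> with index \<open>i\<close> (counting from 0); \<open>zero_tm \<sigma>\<close> if there is none.\<close>

definition nth_tm :: "ty \<Rightarrow> tm \<Rightarrow> tm \<Rightarrow> tm" where
  "nth_tm \<sigma> s i =
    (let a = (0, \<sigma>); q = (0, SeqT \<sigma>); r = (1, Base \<rightarrow> \<sigma>); k = (0, Base); p = (1, \<sigma>) in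
     SRec \<sigma> (Base \<rightarrow> \<sigma>) \<cdot> zero_tm (Base \<rightarrow> \<sigma>)
       \<cdot> (\<^bold>\<lambda>a. \<^bold>\<lambda>q. \<^bold>\<lambda>r. Rec \<sigma> \<cdot> Var a \<cdot> (\<^bold>\<lambda>k. \<^bold>\<lambda>p. Var r \<cdot> Var k)) \<cdot> s \<cdot> i)"

definition append_tm :: "ty \<Rightarrow> tm \<Rightarrow> tm \<Rightarrow> tm" where
  "append_tm \<sigma> s t = (let a = (0, \<sigma>); q = (0, SeqT \<sigma>); r = (1, SeqT \<sigma>) in
     SRec \<sigma> (SeqT \<sigma>) \<cdot> t \<cdot> (\<^bold>\<lambda>a. \<^bold>\<lambda>q. \<^bold>\<lambda>r. Prep \<sigma> \<cdot> Var a \<cdot> Var r) \<cdot> s)"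

text \<open>\<open>initseg_tm g n\<close> is the sequence \<open>\<langle>g 0, \<dots>, g (n - 1)\<rangle>\<close>.\<close>

definition initseg_tm :: "tm \<Rightarrow> tm \<Rightarrow> tm" where
  "initseg_tm g n =
    (let h = (0, Base \<rightarrow> Base); k = (0, Base); r = (1, SeqT Base) in
     Rec (SeqT Base) \<cdot> Empty Base
       \<cdot> ((\<^bold>\<lambda>h. \<^bold>\<lambda>k. \<^bold>\<lambda>r.
            append_tm Base (Var r) (Prep Base \<cdot> (Var h \<cdot> Var k) \<cdot> Empty Base)) \<cdot> g) \<cdot> n)"

text \<open>Membership in a sequence: \<open>\<exists>i < |s|. t = s\<^sub>i\<close>, with a bound variable not occurring in \<open>t\<close>, \<open>s\<close>.\<close>

definition Mem :: "tm \<Rightarrow> tm \<Rightarrow> fm" (infix "\<^bold>\<in>" 65) where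
  "t \<^bold>\<in> s = (let i = (LEAST n. (n, Base) \<notin> fvt t \<union> fvt s, Base) in
     \<^bold>\<exists>i. Succ \<cdot> Var i \<^bold>\<le> length_tm (ty_of t) s \<^bold>\<and> t \<^bold>= nth_tm (ty_of t) s (Var i))"


section \<open>The axioms\<close>

text \<open>
  The schemes below range over arbitrary terms; \<open>derives\<close> uses only their well-formed
  instances.  With \<open>fun_eq\<close>, \<open>cong_fun\<close> and \<open>extensionality\<close>, equality at a function type is
  pointwise equality and is respected by all functionals.  Leibniz's law is derivable: for
  internal formulas from \<open>EPA\<close>, and for all formulas with the help of \<open>st_eq\<close>.
\<close>

inductive_set EPA :: "fm set" where
  refl: "t \<^bold>= t \<in> EPA"
| eucl: "r \<^bold>= s \<^bold>\<longrightarrow> r \<^bold>= t \<^bold>\<longrightarrow> s \<^bold>= t \<in> EPA"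
| cong_fun: "f \<^bold>= g \<^bold>\<longrightarrow> f \<cdot> t \<^bold>= g \<cdot> t \<in> EPA"
| extensionality: "s \<^bold>= t \<^bold>\<longrightarrow> f \<cdot> s \<^bold>= f \<cdot> t \<in> EPA"
| fun_eq: "x \<notin> fvt f \<union> fvt g \<Longrightarrow>
    (\<^bold>\<forall>x. f \<cdot> Var x \<^bold>= g \<cdot> Var x) \<^bold>\<longrightarrow> f \<^bold>= g \<in> EPA"
| comb_K: "CombK \<sigma> \<tau> \<cdot> s \<cdot> t \<^bold>= s \<in> EPA"
| comb_S: "CombS \<rho> \<sigma> \<tau> \<cdot> r \<cdot> s \<cdot> t \<^bold>= r \<cdot> t \<cdot> (s \<cdot> t) \<in> EPA"
| succ_nonzero: "Neg (Succ \<cdot> t \<^bold>= Zero) \<in> EPA"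
| succ_inj: "Succ \<cdot> s \<^bold>= Succ \<cdot> t \<^bold>\<longrightarrow> s \<^bold>= t \<in> EPA"
| induction: "internal A \<Longrightarrow> snd n = Base \<Longrightarrow>
    subf A n Zero \<^bold>\<and> (\<^bold>\<forall>n. A \<^bold>\<longrightarrow> subf A n (Succ \<cdot> Var n)) \<^bold>\<longrightarrow> (\<^bold>\<forall>n. A) \<in> EPA"
| rec_zero: "Rec \<sigma> \<cdot> s \<cdot> f \<cdot> Zero \<^bold>= s \<in> EPA"
| rec_succ: "Rec \<sigma> \<cdot> s \<cdot> f \<cdot> (Succ \<cdot> t) \<^bold>= f \<cdot> t \<cdot> (Rec \<sigma> \<cdot> s \<cdot> f \<cdot> t) \<in> EPA"
| seq_cases: "a = (i, \<sigma>) \<Longrightarrow> q = (j, SeqT \<sigma>) \<Longrightarrow> a \<notin> fvt s \<Longrightarrow> q \<notin> fvt s \<Longrightarrow>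
    s \<^bold>= Empty \<sigma> \<^bold>\<or> (\<^bold>\<exists>a. \<^bold>\<exists>q. s \<^bold>= Prep \<sigma> \<cdot> Var a \<cdot> Var q) \<in> EPA"
| srec_empty: "SRec \<sigma> \<rho> \<cdot> s \<cdot> f \<cdot> Empty \<sigma> \<^bold>= s \<in> EPA"
| srec_prep: "SRec \<sigma> \<rho> \<cdot> s \<cdot> f \<cdot> (Prep \<sigma> \<cdot> t \<cdot> u)
    \<^bold>= f \<cdot> t \<cdot> u \<cdot> (SRec \<sigma> \<rho> \<cdot> s \<cdot> f \<cdot> u) \<in> EPA"

inductive_set SysP :: "fm set" where
  epa: "A \<in> EPA \<Longrightarrow> A \<in> SysP"
| st_eq: "St s \<^bold>\<and> s \<^bold>= t \<^bold>\<longrightarrow> St t \<in> SysP"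
| st_closed: "fvt t = {} \<Longrightarrow> St t \<in> SysP"
| st_app: "St f \<^bold>\<and> St t \<^bold>\<longrightarrow> St (f \<cdot> t) \<in> SysP"
| external_induction: "snd n = Base \<Longrightarrow>
    subf A n Zero \<^bold>\<and> (\<^bold>\<forall>\<^sup>s\<^sup>t n. A \<^bold>\<longrightarrow> subf A n (Succ \<cdot> Var n)) \<^bold>\<longrightarrow> (\<^bold>\<forall>\<^sup>s\<^sup>t n. A) \<in> SysP"
| idealisation: "internal A \<Longrightarrow> x = (i, SeqT \<sigma>) \<Longrightarrow> y = (j, \<tau>) \<Longrightarrow> z = (k, \<sigma>) \<Longrightarrow>
    distinct [x, y, z] \<Longrightarrow> x \<notin> fvf A \<Longrightarrow>
    (\<^bold>\<forall>\<^sup>s\<^sup>t x. \<^bold>\<exists>y. \<^bold>\<forall>z. Var z \<^bold>\<in> Var x \<^bold>\<longrightarrow> A) \<^bold>\<longrightarrow> (\<^bold>\<exists>y. \<^bold>\<forall>\<^sup>s\<^sup>t z. A) \<in> SysP"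
| HAC_int: "internal A \<Longrightarrow> x = (i, \<rho>) \<Longrightarrow> y = (j, \<tau>) \<Longrightarrow> F = (k, \<rho> \<rightarrow> SeqT \<tau>) \<Longrightarrow>
    distinct [x, y, F] \<Longrightarrow> F \<notin> fvf A \<Longrightarrow>
    (\<^bold>\<forall>\<^sup>s\<^sup>t x. \<^bold>\<exists>\<^sup>s\<^sup>t y. A) \<^bold>\<longrightarrow>
    (\<^bold>\<exists>\<^sup>s\<^sup>t F. \<^bold>\<forall>\<^sup>s\<^sup>t x. \<^bold>\<exists>y. Var y \<^bold>\<in> Var F \<cdot> Var x \<^bold>\<and> A) \<in> SysP"

definition Pi11_TRANS :: fm where
  "Pi11_TRANS =
    (let f = (0, Base \<rightarrow> Base); g = (1, Base \<rightarrow> Base); n = (0, Base);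
         B = (\<^bold>\<forall>n. Var f \<cdot> code_tm (initseg_tm (Var g) (Var n)) \<^bold>= Zero) in
     \<^bold>\<forall>\<^sup>s\<^sup>t f. (\<^bold>\<exists>g. B) \<^bold>\<longrightarrow> (\<^bold>\<exists>\<^sup>s\<^sup>t g. B))"

definition STP :: fm where
  "STP =
    (let \<alpha> = (0, Base \<rightarrow> Base); \<beta> = (1, Base \<rightarrow> Base); n = (0, Base);
         binary = (\<lambda>\<gamma>. \<^bold>\<forall>n. Var \<gamma> \<cdot> Var n \<^bold>\<le> Succ \<cdot> Zero) in
     \<^bold>\<forall>\<alpha>. binary \<alpha> \<^bold>\<longrightarrow>
       (\<^bold>\<exists>\<^sup>s\<^sup>t \<beta>. binary \<beta> \<^bold>\<and> (\<^bold>\<forall>\<^sup>s\<^sup>t n. Var \<alpha> \<cdot> Var n \<^bold>= Var \<beta> \<cdot> Var n)))"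

end

theory Submission
  imports Defs "HOL-Library.Countable"
begin

text \<open>
  Finite types are interpreted as partial equivalence relations over the values of an untyped
  functional language with two oracles: one picks a branch of any number tree that has one, the
  other is an injection \<open>nu\<close> of the countably many computable functions into the numbers.  The
  Herbrandised functional interpretation of nonstandard arithmetic, read semantically in this
  model, realizes the axioms of \<open>P\<close> by programs, and the first oracle realizes \<open>\<Pi>\<^sup>1\<^sub>1\<close>-transfer.
  A realizer of \<open>STP\<close> would compute from \<open>G\<close> a finite cover of Cantor space by neighbourhoods whose
  sizes \<open>G\<close> prescribes.  With \<open>nu\<close> one makes the neighbourhoods of the computable points so small that no
  finite number of them covers even the computable points.
\<close>

section \<open>Programs with oracles\<close>

text \<open>Over all set-theoretic functionals \<open>STP\<close> would be realized: compactness of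
  Cantor space gives a finite cover for every assignment of neighbourhoods. So the model must have
  few enough type-1 objects for compactness to fail inside it, while staying closed under choosing
  branches of number trees. Countability yields an injection into the numbers from outside, but the
  refutation must use it as an object of the model. It then has to be total on the type-1 functions
  of that very model, give one number to all programs for the same function, and be available for
  building further functions. This circularity is why evaluation carries a possibly partial index
  \<open>G\<close> as a parameter. The Herbrandised form matters twice. Standardness is witnessed by
  a list of candidates, so a realizer need not know which one is right. Quantifiers carry no
  computational content, so the ideal element in idealisation only has to exist and is never
  computed.\<close>

datatype prim = PFst | PSnd | PSuc | PAppend | PConcat | PUpt | PSum | PTab "nat list"

datatype prog =
    EVar nat
  | ELam prog
  | EApp prog prog (infixl "\<bullet>" 90)
  | ENum nat
  | EPair prog prog
  | EPrim prim prog
  | ERec prog prog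
  | EMap prog prog
  | EPath prog prog
  | ENu prog

text \<open>\<open>EVar\<close> is a de Bruijn index into an environment, itself a list value.  \<open>RecV u f\<close> is at once
  the recursor on numbers and on lists; this works because \<open>Num 0\<close> also serves as the empty list.\<close>

datatype val = Num nat | Pair val val | Clo prog val | RecV val val

instance prim :: countable by countable_datatype
instance prog :: countable by countable_datatype
instance val :: countable by countable_datatype

primrec vlist :: "val list \<Rightarrow> val" where
  "vlist [] = Num 0"
| "vlist (x # xs) = Pair x (vlist xs)"

primrec elems :: "val \<Rightarrow> val list" where
  "elems (Num n) = []"
| "elems (Pair a b) = a # elems b"
| "elems (Clo b e) = []"
| "elems (RecV a b) = []"

lemma elems_vlist [simp]: "elems (vlist xs) = xs"
  by (induction xs) auto

primrec vfst :: "val \<Rightarrow> val" where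
  "vfst (Num n) = Num 0"
| "vfst (Pair a b) = a"
| "vfst (Clo b e) = Num 0"
| "vfst (RecV a b) = Num 0"

primrec vsnd :: "val \<Rightarrow> val" where
  "vsnd (Num n) = Num 0"
| "vsnd (Pair a b) = b"
| "vsnd (Clo b e) = Num 0"
| "vsnd (RecV a b) = Num 0"

primrec vnat :: "val \<Rightarrow> nat" where
  "vnat (Num n) = n"
| "vnat (Pair a b) = 0"
| "vnat (Clo b e) = 0"
| "vnat (RecV a b) = 0"

text \<open>\<open>PSum\<close> adds the successors, so its result strictly exceeds every entry.
  \<open>PTab\<close> makes every finite table, continued by 0, a program; this later puts a
  diagonal sequence into the model.\<close>

primrec prim_ap :: "prim \<Rightarrow> val \<Rightarrow> val" where
  "prim_ap PFst v = vfst v"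
| "prim_ap PSnd v = vsnd v"
| "prim_ap PSuc v = Num (Suc (vnat v))"
| "prim_ap PAppend v = vlist (elems (vfst v) @ elems (vsnd v))"
| "prim_ap PConcat v = vlist (concat (map elems (elems v)))"
| "prim_ap PUpt v = vlist (map Num [0..<vnat v])"
| "prim_ap PSum v = Num (sum_list (map (Suc \<circ> vnat) (elems v)))"
| "prim_ap (PTab xs) v = Num (if vnat v < length xs then xs ! vnat v else 0)"

primrec lookup :: "val \<Rightarrow> nat \<Rightarrow> val" where
  "lookup v 0 = vfst v"
| "lookup v (Suc i) = lookup (vsnd v) i"

text \<open>The numerical counterpart of \<open>code_tm\<close>: the sum is a triangular number, so
  the successor is taken of a Cantor pairing.\<close>

primrec seq_code :: "nat list \<Rightarrow> nat" where
  "seq_code [] = 0"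
| "seq_code (a # s) = Suc (\<Sum>{..a + seq_code s} + seq_code s)"

text \<open>Without a branch the choice is arbitrary, but it still depends on \<open>f\<close>
  alone, which is what extensionality of the oracle requires.\<close>

definition tree_path :: "(nat \<Rightarrow> nat) \<Rightarrow> nat \<Rightarrow> nat" where
  "tree_path f = (SOME g. \<forall>n. f (seq_code (map g [0..<n])) = 0)"

text \<open>The premises of \<open>EPath\<close> and \<open>ENu\<close> are infinitary: the argument must be total.  \<open>EPath\<close> then
  answers from an arbitrary fixed functional on all of \<open>nat \<Rightarrow> nat\<close>, and \<open>ENu\<close> returns the number that
  \<open>G\<close> assigns to the function.\<close>

inductive ev :: "((nat \<Rightarrow> nat) \<times> val) set \<Rightarrow> val \<Rightarrow> prog \<Rightarrow> val \<Rightarrow> bool"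
  and app :: "((nat \<Rightarrow> nat) \<times> val) set \<Rightarrow> val \<Rightarrow> val \<Rightarrow> val \<Rightarrow> bool"
  for G :: "((nat \<Rightarrow> nat) \<times> val) set"
where
  ev_var: "ev G \<rho> (EVar i) (lookup \<rho> i)"
| ev_lam: "ev G \<rho> (ELam b) (Clo b \<rho>)"
| ev_app: "ev G \<rho> s f \<Longrightarrow> ev G \<rho> t a \<Longrightarrow> app G f a v \<Longrightarrow> ev G \<rho> (s \<bullet> t) v"
| ev_num: "ev G \<rho> (ENum n) (Num n)"
| ev_pair: "ev G \<rho> s a \<Longrightarrow> ev G \<rho> t b \<Longrightarrow> ev G \<rho> (EPair s t) (Pair a b)"
| ev_prim: "ev G \<rho> s a \<Longrightarrow> ev G \<rho> (EPrim p s) (prim_ap p a)"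
| ev_rec: "ev G \<rho> s a \<Longrightarrow> ev G \<rho> t b \<Longrightarrow> ev G \<rho> (ERec s t) (RecV a b)"
| ev_map: "ev G \<rho> s f \<Longrightarrow> ev G \<rho> t l \<Longrightarrow> length ws = length (elems l) \<Longrightarrow>
    (\<And>i. i < length ws \<Longrightarrow> app G f (elems l ! i) (ws ! i)) \<Longrightarrow> ev G \<rho> (EMap s t) (vlist ws)"
| ev_path: "ev G \<rho> s f \<Longrightarrow> ev G \<rho> t (Num n) \<Longrightarrow> (\<And>k. app G f (Num k) (Num (h k))) \<Longrightarrow>
    ev G \<rho> (EPath s t) (Num (tree_path h n))"
| ev_nu: "ev G \<rho> s f \<Longrightarrow> (\<And>k. app G f (Num k) (Num (h k))) \<Longrightarrow> (h, d) \<in> G \<Longrightarrow>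
    ev G \<rho> (ENu s) (Num (to_nat d))"
| app_clo: "ev G (Pair a \<rho>) b v \<Longrightarrow> app G (Clo b \<rho>) a v"
| app_rec_0: "app G (RecV u f) (Num 0) u"
| app_rec_Suc: "app G (RecV u f) (Num n) r \<Longrightarrow> app G f (Num n) g \<Longrightarrow> app G g r v \<Longrightarrow>
    app G (RecV u f) (Num (Suc n)) v"
| app_rec_Pair: "app G (RecV u f) b r \<Longrightarrow> app G f a g \<Longrightarrow> app G g b g' \<Longrightarrow> app G g' r v \<Longrightarrow>
    app G (RecV u f) (Pair a b) v"

inductive_cases ev_cases:
  "ev G \<rho> (EVar i) v" "ev G \<rho> (ELam b) v" "ev G \<rho> (s \<bullet> t) v" "ev G \<rho> (ENum n) v"
  "ev G \<rho> (EPair s t) v" "ev G \<rho> (EPrim p s) v" "ev G \<rho> (ERec s t) v" "ev G \<rho> (EMap s t) v"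
  "ev G \<rho> (EPath s t) v" "ev G \<rho> (ENu s) v"

inductive_cases app_cases:
  "app G (Clo b \<rho>) a v" "app G (RecV u f) (Num 0) v" "app G (RecV u f) (Num (Suc n)) v"
  "app G (RecV u f) (Pair a b) v"

text \<open>Rule induction. In the infinitary rules the induction hypothesis fixes \<open>h\<close>
  value by value; for \<open>ENu\<close>, single-valuedness of \<open>G\<close> then fixes the
  program stored for \<open>h\<close>.\<close>

lemma ev_app_det:
  assumes "single_valued G"
  shows "ev G \<rho> e v \<Longrightarrow> ev G \<rho> e v' \<Longrightarrow> v' = v"
    and "app G f a w \<Longrightarrow> app G f a w' \<Longrightarrow> w' = w"
proof (induction arbitrary: v' and w' rule: ev_app.inducts)
  case (ev_map \<rho> s f t l ws)
  obtain f' l' ws' where *: "v' = vlist ws'" "ev G \<rho> s f'" "ev G \<rho> t l'"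
    "length ws' = length (elems l')" "\<And>i. i < length (elems l') \<Longrightarrow> app G f' (elems l' ! i) (ws' ! i)"
    by (rule ev_cases(8)[OF ev_map.prems]) (rule that)
  have "f' = f" "l' = l"
    by (rule ev_map.IH(2)[OF *(2)], rule ev_map.IH(4)[OF *(3)])
  have "ws' = ws"
  proof (rule nth_equalityI)
    show "length ws' = length ws"
      using *(4) \<open>l' = l\<close> ev_map.hyps by simp
    show "ws' ! i = ws ! i" if "i < length ws'" for i
      using that *(4) *(5)[of i] \<open>f' = f\<close> \<open>l' = l\<close> ev_map.hyps ev_map.IH(6)[of i "ws' ! i"]
      by simp
  qed
  with *(1) show ?case by simp
next
  case (ev_path \<rho> s f t n h)
  obtain f' n' h' where *: "v' = Num (tree_path h' n')" "ev G \<rho> s f'" "ev G \<rho> t (Num n')"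
    "\<And>k. app G f' (Num k) (Num (h' k))"
    by (rule ev_cases(9)[OF ev_path.prems]) (rule that)
  have "f' = f" "n' = n"
    using ev_path.IH(2)[OF *(2)] ev_path.IH(4)[OF *(3)] by simp_all
  have "h' k = h k" for k
    using *(4)[of k] \<open>f' = f\<close> ev_path.IH(6)[of k "Num (h' k)"] by simp
  then have "h' = h" ..
  with *(1) \<open>n' = n\<close> show ?case by simp
next
  case (ev_nu \<rho> s f h d)
  obtain f' h' d' where *: "v' = Num (to_nat d')" "ev G \<rho> s f'"
    "\<And>k. app G f' (Num k) (Num (h' k))" "(h', d') \<in> G"
    by (rule ev_cases(10)[OF ev_nu.prems]) (rule that)
  have "f' = f"
    by (rule ev_nu.IH(2)[OF *(2)])
  have "h' k = h k" for k
    using *(3)[of k] \<open>f' = f\<close> ev_nu.IH(4)[of k "Num (h' k)"] by simp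
  then have "h' = h" ..
  then have "d' = d"
    using *(4) assms ev_nu.IH(5) by (auto dest: single_valuedD)
  with *(1) show ?case by simp
next
  case (app_rec_Suc u f n r g v)
  obtain r' g' where *: "app G (RecV u f) (Num n) r'" "app G f (Num n) g'" "app G g' r' w'"
    by (rule app_cases(3)[OF app_rec_Suc.prems]) (rule that)
  have "r' = r" "g' = g"
    by (rule app_rec_Suc.IH(2)[OF *(1)], rule app_rec_Suc.IH(4)[OF *(2)])
  with *(3) show ?case by (simp add: app_rec_Suc.IH(6))
next
  case (app_rec_Pair u f b r a g g' v)
  obtain r1 g1 g1' where *: "app G (RecV u f) b r1" "app G f a g1" "app G g1 b g1'"
    "app G g1' r1 w'"
    by (rule app_cases(4)[OF app_rec_Pair.prems]) (rule that)
  have "r1 = r" "g1 = g"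
    by (rule app_rec_Pair.IH(2)[OF *(1)], rule app_rec_Pair.IH(4)[OF *(2)])
  moreover from this have "g1' = g'"
    using *(3) by (simp add: app_rec_Pair.IH(6))
  ultimately show ?case
    using *(4) by (simp add: app_rec_Pair.IH(8))
next
  case (ev_app \<rho> s f t a v)
  obtain f' a' where *: "ev G \<rho> s f'" "ev G \<rho> t a'" "app G f' a' v'"
    by (rule ev_cases(3)[OF ev_app.prems]) (rule that)
  have "f' = f" "a' = a"
    by (rule ev_app.IH(2)[OF *(1)], rule ev_app.IH(4)[OF *(2)])
  with *(3) show ?case by (simp add: ev_app.IH(6))
next
  case (ev_pair \<rho> s a t b)
  show ?case
    by (rule ev_cases(5)[OF ev_pair.prems]) (metis ev_pair.IH(2,4))
next
  case (ev_prim \<rho> s a p)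
  show ?case
    by (rule ev_cases(6)[OF ev_prim.prems]) (metis ev_prim.IH(2))
next
  case (ev_rec \<rho> s a t b)
  show ?case
    by (rule ev_cases(7)[OF ev_rec.prems]) (metis ev_rec.IH(2,4))
next
  case (app_clo a \<rho> b v)
  show ?case
    by (rule app_cases(1)[OF app_clo.prems]) (rule app_clo.IH(2))
next
  case (ev_var \<rho> i)
  show ?case by (rule ev_cases(1)[OF ev_var.prems])
next
  case (ev_lam \<rho> b)
  show ?case by (rule ev_cases(2)[OF ev_lam.prems])
next
  case (ev_num \<rho> n)
  show ?case by (rule ev_cases(4)[OF ev_num.prems])
next
  case (app_rec_0 u f)
  show ?case by (rule app_cases(2)[OF app_rec_0.prems])
qed

text \<open>\<open>G\<close> occurs only in the positive premise \<open>(h, d) \<in> G\<close> of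
  \<open>ev_nu\<close>, so enlarging it keeps every earlier evaluation.\<close>

lemma ev_app_mono:
  assumes "G \<subseteq> G'"
  shows "ev G \<rho> e v \<Longrightarrow> ev G' \<rho> e v"
    and "app G f a w \<Longrightarrow> app G' f a w"
  using assms by (induction rule: ev_app.inducts) (auto intro: ev_app.intros)

section \<open>A self-referential index of the computable functions\<close>

definition computes :: "((nat \<Rightarrow> nat) \<times> val) set \<Rightarrow> val \<Rightarrow> (nat \<Rightarrow> nat) \<Rightarrow> bool" where
  "computes G d h \<longleftrightarrow> (\<forall>k. app G d (Num k) (Num (h k)))"

text \<open>The program \<open>d\<close> may itself call \<open>ENu\<close> with the same
  \<open>G\<close>. The index may be partial; a call on a function outside its domain has no
  value.\<close>

definition sound_index :: "((nat \<Rightarrow> nat) \<times> val) set \<Rightarrow> bool" where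
  "sound_index G \<longleftrightarrow> single_valued G \<and> (\<forall>(h, d) \<in> G. computes G d h)"

lemma computes_mono: "G \<subseteq> G' \<Longrightarrow> computes G d h \<Longrightarrow> computes G' d h"
  unfolding computes_def using ev_app_mono(2) by blast

text \<open>\<open>G\<close> has to index exactly the functions computable with \<open>G\<close> itself.  Since computability is
  monotone in \<open>G\<close>, a maximal \<open>G\<close> sending every function to a program for it does this, and such an
  index is automatically injective.\<close>

lemma total_index_exists:
  "\<exists>G. sound_index G \<and> (\<forall>d h. computes G d h \<longrightarrow> h \<in> Domain G)"
proof -
  have "\<exists>M\<in>Collect sound_index. \<forall>X\<in>Collect sound_index. M \<subseteq> X \<longrightarrow> X = M"
  proof (rule subset_Zorn')
    fix \<C> assume "subset.chain (Collect sound_index) \<C>"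
    then have snd: "\<And>G. G \<in> \<C> \<Longrightarrow> sound_index G"
      and lin: "\<And>G G'. G \<in> \<C> \<Longrightarrow> G' \<in> \<C> \<Longrightarrow> G \<subseteq> G' \<or> G' \<subseteq> G"
      by (auto simp: subset.chain_def)
    have "single_valued (\<Union>\<C>)"
    proof (rule single_valuedI)
      fix h d d' assume "(h, d) \<in> \<Union>\<C>" "(h, d') \<in> \<Union>\<C>"
      \<comment> \<open>Members of a chain are comparable, so both pairs already lie in the larger
        one.\<close>
      then obtain G where "G \<in> \<C>" "(h, d) \<in> G" "(h, d') \<in> G"
        using lin by blast
      then show "d = d'"
        using snd by (auto simp: sound_index_def dest: single_valuedD)
    qed
    moreover have "computes (\<Union>\<C>) d h" if "(h, d) \<in> G" "G \<in> \<C>" for h d G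
      using snd[OF that(2)] that computes_mono[of G "\<Union>\<C>" d h] by (auto simp: sound_index_def)
    ultimately show "\<Union>\<C> \<in> Collect sound_index"
      by (auto simp: sound_index_def)
  qed
  then obtain G where G: "sound_index G" and max: "\<And>X. sound_index X \<Longrightarrow> G \<subseteq> X \<Longrightarrow> X = G"
    by blast
  have "h \<in> Domain G" if "computes G d h" for d h
  proof (rule ccontr)
    \<comment> \<open>A computable function missing from the domain can be added together with its
      own program, against maximality.\<close>
    assume "h \<notin> Domain G"
    with G that have "sound_index (insert (h, d) G)"
      unfolding sound_index_def
      by (auto simp: single_valued_def intro: computes_mono[of G])
    from max[OF this] \<open>h \<notin> Domain G\<close> show False by auto
  qed
  with G show ?thesis by blast
qed

definition idx :: "((nat \<Rightarrow> nat) \<times> val) set" where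
  "idx = (SOME G. sound_index G \<and> (\<forall>d h. computes G d h \<longrightarrow> h \<in> Domain G))"

lemma idx: "sound_index idx" "computes idx d h \<Longrightarrow> h \<in> Domain idx"
  using someI_ex[OF total_index_exists] unfolding idx_def by auto

text \<open>Evaluation is deterministic, so one program cannot compute two functions.\<close>

lemma idx_inj: "(h, d) \<in> idx \<Longrightarrow> (h', d) \<in> idx \<Longrightarrow> h = h'"
proof
  fix k
  assume "(h, d) \<in> idx" "(h', d) \<in> idx"
  then have "app idx d (Num k) (Num (h k))" "app idx d (Num k) (Num (h' k))"
    using idx(1) unfolding sound_index_def computes_def by blast+
  then show "h k = h' k"
    using ev_app_det(2) idx(1) unfolding sound_index_def by blast
qed

section \<open>Evaluation with the fixed index, recast as total functions\<close>

abbreviation evals :: "val \<Rightarrow> prog \<Rightarrow> val \<Rightarrow> bool" where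
  "evals \<equiv> ev idx"

abbreviation apps :: "val \<Rightarrow> val \<Rightarrow> val \<Rightarrow> bool" where
  "apps \<equiv> app idx"

lemma apps_det: "apps f a w \<Longrightarrow> apps f a w' \<Longrightarrow> w' = w"
  using idx(1) ev_app_det(2) unfolding sound_index_def by blast

text \<open>Application made total, with an unspecified value where there is no result, so that
  equations can be written without tracking definedness.\<close>

definition ap :: "val \<Rightarrow> val \<Rightarrow> val" where
  "ap f a = (THE v. apps f a v)"

lemma ap_eq: "apps f a v \<Longrightarrow> ap f a = v"
  unfolding ap_def using apps_det by blast

definition nu :: "(nat \<Rightarrow> nat) \<Rightarrow> nat" where
  "nu h = to_nat (THE d. (h, d) \<in> idx)"

lemma nu_eq: "(h, d) \<in> idx \<Longrightarrow> nu h = to_nat d"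
  using idx(1) unfolding nu_def sound_index_def by (metis single_valuedD the_equality)

text \<open>\<open>to_nat\<close> is injective on values, so equal numbers come from the same
  indexed program, which determines the function. This is the property that the diagonal argument
  against \<open>STP\<close> rests on.\<close>

lemma nu_inj:
  assumes "computes idx d h" "computes idx d' h'" "nu h = nu h'"
  shows "h = h'"
  using assms idx(2)[OF assms(1)] idx(2)[OF assms(2)] nu_eq idx_inj by (metis DomainE from_nat_to_nat)

definition fn :: "val \<Rightarrow> nat \<Rightarrow> nat" where
  "fn f k = vnat (ap f (Num k))"

lemma computes_fn: "computes idx d h \<Longrightarrow> fn d = h"
proof
  show "fn d k = h k" if "computes idx d h" for k
    using that ap_eq[of d "Num k" "Num (h k)"] by (simp add: computes_def fn_def)
qed

text \<open>Evaluation as a recursive function on which the simplifier can compute. It is meaningful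
  where \<open>evals\<close> has a result, and typing will guarantee that.\<close>

primrec den :: "val \<Rightarrow> prog \<Rightarrow> val" where
  "den \<rho> (EVar i) = lookup \<rho> i"
| "den \<rho> (ELam b) = Clo b \<rho>"
| "den \<rho> (s \<bullet> t) = ap (den \<rho> s) (den \<rho> t)"
| "den \<rho> (ENum n) = Num n"
| "den \<rho> (EPair s t) = Pair (den \<rho> s) (den \<rho> t)"
| "den \<rho> (EPrim p s) = prim_ap p (den \<rho> s)"
| "den \<rho> (ERec s t) = RecV (den \<rho> s) (den \<rho> t)"
| "den \<rho> (EMap s t) = vlist (map (ap (den \<rho> s)) (elems (den \<rho> t)))"
| "den \<rho> (EPath s t) = Num (tree_path (fn (den \<rho> s)) (vnat (den \<rho> t)))"
| "den \<rho> (ENu s) = Num (nu (fn (den \<rho> s)))"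

lemma den_eq: "evals \<rho> e v \<Longrightarrow> den \<rho> e = v"
proof (induction e arbitrary: v)
  case (EApp s t)
  show ?case by (rule ev_cases(3)[OF EApp.prems]) (simp add: EApp.IH ap_eq)
next
  case (EMap s t)
  obtain f l ws where *: "v = vlist ws" "evals \<rho> s f" "evals \<rho> t l"
    "length ws = length (elems l)" "\<And>i. i < length (elems l) \<Longrightarrow> apps f (elems l ! i) (ws ! i)"
    by (rule ev_cases(8)[OF EMap.prems]) (rule that)
  have "map (ap f) (elems l) = ws"
  proof (rule nth_equalityI)
    show "map (ap f) (elems l) ! i = ws ! i" if "i < length (map (ap f) (elems l))" for i
      using that ap_eq[OF *(5)[of i]] by simp
  qed (simp add: *(4))
  then show ?case
    using *(1) EMap.IH(1)[OF *(2)] EMap.IH(2)[OF *(3)] by simp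
next
  case (EPath s t)
  obtain f n h where *: "v = Num (tree_path h n)" "evals \<rho> s f" "evals \<rho> t (Num n)"
    "\<And>k. apps f (Num k) (Num (h k))"
    by (rule ev_cases(9)[OF EPath.prems]) (rule that)
  then have "fn f = h"
    by (intro computes_fn) (simp add: computes_def)
  with * EPath.IH(1)[OF *(2)] EPath.IH(2)[OF *(3)] show ?case by simp
next
  case (ENu s)
  obtain f h d where *: "v = Num (to_nat d)" "evals \<rho> s f"
    "\<And>k. apps f (Num k) (Num (h k))" "(h, d) \<in> idx"
    by (rule ev_cases(10)[OF ENu.prems]) (rule that)
  then have "fn f = h"
    by (intro computes_fn) (simp add: computes_def)
  with * ENu.IH[OF *(2)] nu_eq[OF *(4)] show ?case by simp
next
  case (EPair s t)
  show ?case by (rule ev_cases(5)[OF EPair.prems]) (simp add: EPair.IH)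
next
  case (EPrim p s)
  show ?case by (rule ev_cases(6)[OF EPrim.prems]) (simp add: EPrim.IH)
next
  case (ERec s t)
  show ?case by (rule ev_cases(7)[OF ERec.prems]) (simp add: ERec.IH)
next
  case (EVar i)
  show ?case by (rule ev_cases(1)[OF EVar.prems]) simp
next
  case (ELam b)
  show ?case by (rule ev_cases(2)[OF ELam.prems]) simp
next
  case (ENum n)
  show ?case by (rule ev_cases(4)[OF ENum.prems]) simp
qed

section \<open>Partial equivalence relations\<close>

type_synonym per = "val \<Rightarrow> val \<Rightarrow> bool"

definition pnat :: per where
  "pnat a b \<longleftrightarrow> (\<exists>n. a = Num n \<and> b = Num n)"

text \<open>The domain for challenges and responses without information; any value serves as a
  filler.\<close>

definition pun :: per where
  "pun a b \<longleftrightarrow> True"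

definition pprod :: "per \<Rightarrow> per \<Rightarrow> per" where
  "pprod P Q x y \<longleftrightarrow> (\<exists>a b c d. x = Pair a b \<and> y = Pair c d \<and> P a c \<and> Q b d)"

definition plist :: "per \<Rightarrow> per" where
  "plist P l m \<longleftrightarrow> (\<exists>xs ys. l = vlist xs \<and> m = vlist ys \<and> list_all2 P xs ys)"

definition pfun :: "per \<Rightarrow> per \<Rightarrow> per" where
  "pfun P Q f g \<longleftrightarrow> (\<forall>a b. P a b \<longrightarrow> (\<exists>u v. apps f a u \<and> apps g b v \<and> Q u v))"

definition is_per :: "per \<Rightarrow> bool" where
  "is_per P \<longleftrightarrow> symp P \<and> transp P"

lemma is_perD:
  assumes "is_per P"
  shows "P a b \<Longrightarrow> P b a" "P a b \<Longrightarrow> P b c \<Longrightarrow> P a c" "P a b \<Longrightarrow> P a a" "P a b \<Longrightarrow> P b b"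
  using assms unfolding is_per_def by (meson sympD transpD)+

lemma is_perI: "(\<And>a b. P a b \<Longrightarrow> P b a) \<Longrightarrow> (\<And>a b c. P a b \<Longrightarrow> P b c \<Longrightarrow> P a c) \<Longrightarrow> is_per P"
  unfolding is_per_def by (blast intro: sympI transpI)

lemma is_per_pnat [simp]: "is_per pnat"
  by (rule is_perI) (auto simp: pnat_def)

lemma is_per_pun [simp]: "is_per pun"
  by (rule is_perI) (auto simp: pun_def)

lemma is_per_pprod [simp]:
  assumes "is_per P" "is_per Q"
  shows "is_per (pprod P Q)"
  by (rule is_perI) (auto simp: pprod_def dest: is_perD[OF assms(1)] is_perD[OF assms(2)])

lemma vlist_inject [simp]: "vlist xs = vlist ys \<longleftrightarrow> xs = ys"
  using elems_vlist by metis

lemma is_per_plist [simp]: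
  assumes "is_per P"
  shows "is_per (plist P)"
proof (rule is_perI)
  have "list_all2 P ys xs" if "list_all2 P xs ys" for xs ys
    using that by (induction rule: list_all2_induct) (auto intro: is_perD(1)[OF assms])
  note sym = this
  fix a b c
  assume "plist P a b"
  then obtain xs ys where ab: "a = vlist xs" "b = vlist ys" "list_all2 P xs ys"
    unfolding plist_def by auto
  from ab(1,2) sym[OF ab(3)] show "plist P b a"
    unfolding plist_def by auto
  assume "plist P b c"
  with ab(2) obtain zs where c: "c = vlist zs" "list_all2 P ys zs"
    unfolding plist_def by auto
  have "list_all2 P xs zs"
    using list_all2_trans[OF is_perD(2)[OF assms] ab(3) c(2)] .
  with ab(1) c(1) show "plist P a c"
    unfolding plist_def by auto
qed

lemma pfunE:
  assumes "pfun P Q f g" "P a b"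
  shows "apps f a (ap f a)" "apps g b (ap g b)" "Q (ap f a) (ap g b)"
  using assms ap_eq unfolding pfun_def by metis+

lemma is_per_pfun [simp]:
  assumes "is_per P" "is_per Q"
  shows "is_per (pfun P Q)"
proof (rule is_perI)
  note P = is_perD[OF assms(1)] and Q = is_perD[OF assms(2)]
  show "pfun P Q g f" if "pfun P Q f g" for f g
    using that P(1) Q(1) unfolding pfun_def by meson
  show "pfun P Q f h" if fg: "pfun P Q f g" and gh: "pfun P Q g h" for f g h
    unfolding pfun_def
  proof (intro allI impI)
    fix a b assume ab: "P a b"
    then have "P b b" by (rule P(4))
    have "Q (ap f a) (ap h b)"
      using pfunE(3)[OF fg ab] pfunE(3)[OF gh \<open>P b b\<close>] by (rule Q(2))
    then show "\<exists>u v. apps f a u \<and> apps h b v \<and> Q u v"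
      using pfunE(1)[OF fg ab] pfunE(2)[OF gh ab] by blast
  qed
qed

lemma plist_Nil [simp]: "plist P (Num 0) (Num 0)"
  unfolding plist_def by (rule exI[of _ "[]"], rule exI[of _ "[]"]) simp

lemma plist_Pair [simp]: "plist P (Pair a l) (Pair b m) \<longleftrightarrow> P a b \<and> plist P l m"
proof
  assume "plist P (Pair a l) (Pair b m)"
  then obtain xs ys where "Pair a l = vlist xs" "Pair b m = vlist ys" "list_all2 P xs ys"
    unfolding plist_def by blast
  then show "P a b \<and> plist P l m"
    unfolding plist_def by (cases xs; cases ys) auto
next
  assume "P a b \<and> plist P l m"
  then obtain xs ys where "P a b" "l = vlist xs" "m = vlist ys" "list_all2 P xs ys"
    unfolding plist_def by blast
  then show "plist P (Pair a l) (Pair b m)"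
    unfolding plist_def by (intro exI[of _ "a # xs"] exI[of _ "b # ys"]) simp
qed

lemma plist_vlist: "list_all2 P xs ys \<Longrightarrow> plist P (vlist xs) (vlist ys)"
  unfolding plist_def by blast

lemma plistD: "plist P l m \<Longrightarrow> list_all2 P (elems l) (elems m)"
  unfolding plist_def by auto

lemma plist_elems: "plist P l m \<Longrightarrow> vlist (elems l) = l \<and> vlist (elems m) = m"
  unfolding plist_def by auto

lemma plist_mem: "plist P l l \<Longrightarrow> x \<in> set (elems l) \<Longrightarrow> P x x"
  by (metis plistD in_set_conv_nth list_all2_nthD)

lemma pprod_Pair [simp]: "pprod P Q (Pair a b) (Pair c d) \<longleftrightarrow> P a c \<and> Q b d"
  unfolding pprod_def by auto

lemma pnat_Num [simp]: "pnat (Num m) (Num n) \<longleftrightarrow> m = n"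
  unfolding pnat_def by auto

lemma punI: "pun a b"
  unfolding pun_def ..

text \<open>A semantic judgement in place of a syntactic type system. Termination and extensionality
  of a realizer both follow from one derivation with the rules below.\<close>

definition typed :: "per \<Rightarrow> prog \<Rightarrow> per \<Rightarrow> bool" ("_ \<tturnstile> _ : _" [60, 60, 60] 59) where
  "\<Gamma> \<tturnstile> e : P \<longleftrightarrow> (\<forall>\<rho> \<rho>'. \<Gamma> \<rho> \<rho>' \<longrightarrow> (\<exists>u v. evals \<rho> e u \<and> evals \<rho>' e v \<and> P u v))"

lemma typedD:
  assumes "\<Gamma> \<tturnstile> e : P" "\<Gamma> \<rho> \<rho>'"
  shows "evals \<rho> e (den \<rho> e)" "evals \<rho>' e (den \<rho>' e)" "P (den \<rho> e) (den \<rho>' e)"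
  using assms den_eq unfolding typed_def by metis+

lemma typedI:
  "(\<And>\<rho> \<rho>'. \<Gamma> \<rho> \<rho>' \<Longrightarrow> \<exists>u v. evals \<rho> e u \<and> evals \<rho>' e v \<and> P u v) \<Longrightarrow> \<Gamma> \<tturnstile> e : P"
  unfolding typed_def by blast

section \<open>Typing rules for programs\<close>

lemma typed_var_0: "pprod P \<Gamma> \<tturnstile> EVar 0 : P"
  by (rule typedI) (use ev_var[of idx _ 0] in \<open>fastforce simp: pprod_def\<close>)

lemma typed_var_Suc:
  assumes "\<Gamma> \<tturnstile> EVar i : P"
  shows "pprod Q \<Gamma> \<tturnstile> EVar (Suc i) : P"
proof (rule typedI)
  fix \<rho> \<rho>' assume "pprod Q \<Gamma> \<rho> \<rho>'"
  then obtain a b c d where *: "\<rho> = Pair a b" "\<rho>' = Pair c d" "\<Gamma> b d"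
    unfolding pprod_def by blast
  show "\<exists>u v. evals \<rho> (EVar (Suc i)) u \<and> evals \<rho>' (EVar (Suc i)) v \<and> P u v"
    using typedD(3)[OF assms *(3)] ev_var[of idx \<rho> "Suc i"] ev_var[of idx \<rho>' "Suc i"] *(1,2)
    by auto
qed

lemma typed_vars:
  "pprod P \<Gamma> \<tturnstile> EVar 0 : P"
  "\<Gamma> \<tturnstile> EVar 0 : P \<Longrightarrow> pprod Q \<Gamma> \<tturnstile> EVar 1 : P"
  "\<Gamma> \<tturnstile> EVar 0 : P \<Longrightarrow> pprod Q \<Gamma> \<tturnstile> EVar (Suc 0) : P"
  "\<Gamma> \<tturnstile> EVar 1 : P \<Longrightarrow> pprod Q \<Gamma> \<tturnstile> EVar 2 : P"
  "\<Gamma> \<tturnstile> EVar 2 : P \<Longrightarrow> pprod Q \<Gamma> \<tturnstile> EVar 3 : P"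
  "\<Gamma> \<tturnstile> EVar 3 : P \<Longrightarrow> pprod Q \<Gamma> \<tturnstile> EVar 4 : P"
  "\<Gamma> \<tturnstile> EVar 4 : P \<Longrightarrow> pprod Q \<Gamma> \<tturnstile> EVar 5 : P"
  using typed_var_0 typed_var_Suc[of \<Gamma> 0] typed_var_Suc[of \<Gamma> 1] typed_var_Suc[of \<Gamma> 2]
    typed_var_Suc[of \<Gamma> 3] typed_var_Suc[of \<Gamma> 4]
  by (simp_all add: eval_nat_numeral)

lemma clo_pfun:
  assumes "pprod P \<Gamma> \<tturnstile> b : Q" "\<Gamma> \<rho> \<rho>'"
  shows "pfun P Q (Clo b \<rho>) (Clo b \<rho>')"
  unfolding pfun_def
proof (intro allI impI)
  fix a a' assume "P a a'"
  with assms(2) have "pprod P \<Gamma> (Pair a \<rho>) (Pair a' \<rho>')" by simp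
  from typedD[OF assms(1) this] show "\<exists>u v. apps (Clo b \<rho>) a u \<and> apps (Clo b \<rho>') a' v \<and> Q u v"
    by (blast intro: app_clo)
qed

lemma ap_clo:
  assumes "pfun P Q (Clo b \<rho>) g" "P a a'"
  shows "ap (Clo b \<rho>) a = den (Pair a \<rho>) b"
proof -
  have "evals (Pair a \<rho>) b (ap (Clo b \<rho>) a)"
    by (rule app_cases(1)[OF pfunE(1)[OF assms]])
  then show ?thesis by (rule den_eq[symmetric])
qed

lemma typed_lam: "pprod P \<Gamma> \<tturnstile> b : Q \<Longrightarrow> \<Gamma> \<tturnstile> ELam b : pfun P Q"
  by (rule typedI) (blast intro: ev_lam clo_pfun)

lemma typed_app:
  assumes "\<Gamma> \<tturnstile> s : pfun P Q" "\<Gamma> \<tturnstile> t : P"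
  shows "\<Gamma> \<tturnstile> s \<bullet> t : Q"
proof (rule typedI)
  fix \<rho> \<rho>' assume \<rho>: "\<Gamma> \<rho> \<rho>'"
  note s = typedD[OF assms(1) \<rho>] and t = typedD[OF assms(2) \<rho>]
  show "\<exists>u v. evals \<rho> (s \<bullet> t) u \<and> evals \<rho>' (s \<bullet> t) v \<and> Q u v"
    using pfunE[OF s(3) t(3)] s(1,2) t(1,2) by (blast intro: ev_app)
qed

lemma typed_nil: "\<Gamma> \<tturnstile> ENum 0 : plist P"
  by (rule typedI) (blast intro: ev_num plist_Nil)

lemma typed_unit: "\<Gamma> \<tturnstile> ENum n : pun"
  by (rule typedI) (blast intro: ev_num punI)

lemma typed_pair_gen:
  assumes "\<Gamma> \<tturnstile> s : P" "\<Gamma> \<tturnstile> t : Q"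
    "\<And>a b c d. P a c \<Longrightarrow> Q b d \<Longrightarrow> R (Pair a b) (Pair c d)"
  shows "\<Gamma> \<tturnstile> EPair s t : R"
proof (rule typedI)
  fix \<rho> \<rho>' assume \<rho>: "\<Gamma> \<rho> \<rho>'"
  note s = typedD[OF assms(1) \<rho>] and t = typedD[OF assms(2) \<rho>]
  show "\<exists>u v. evals \<rho> (EPair s t) u \<and> evals \<rho>' (EPair s t) v \<and> R u v"
    using ev_pair[OF s(1) t(1)] ev_pair[OF s(2) t(2)] assms(3)[OF s(3) t(3)] by blast
qed

lemma typed_pair: "\<Gamma> \<tturnstile> s : P \<Longrightarrow> \<Gamma> \<tturnstile> t : Q \<Longrightarrow> \<Gamma> \<tturnstile> EPair s t : pprod P Q"
  by (erule (1) typed_pair_gen) simp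

lemma typed_cons: "\<Gamma> \<tturnstile> s : P \<Longrightarrow> \<Gamma> \<tturnstile> t : plist P \<Longrightarrow> \<Gamma> \<tturnstile> EPair s t : plist P"
  by (erule (1) typed_pair_gen) simp

lemma typed_prim:
  assumes "\<Gamma> \<tturnstile> e : P" "\<And>u v. P u v \<Longrightarrow> Q (prim_ap p u) (prim_ap p v)"
  shows "\<Gamma> \<tturnstile> EPrim p e : Q"
proof (rule typedI)
  fix \<rho> \<rho>' assume \<rho>: "\<Gamma> \<rho> \<rho>'"
  note e = typedD[OF assms(1) \<rho>]
  show "\<exists>u v. evals \<rho> (EPrim p e) u \<and> evals \<rho>' (EPrim p e) v \<and> Q u v"
    using ev_prim[OF e(1)] ev_prim[OF e(2)] assms(2)[OF e(3)] by blast
qed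

lemma typed_fst: "\<Gamma> \<tturnstile> e : pprod P Q \<Longrightarrow> \<Gamma> \<tturnstile> EPrim PFst e : P"
  by (erule typed_prim) (auto simp: pprod_def)

lemma typed_snd: "\<Gamma> \<tturnstile> e : pprod P Q \<Longrightarrow> \<Gamma> \<tturnstile> EPrim PSnd e : Q"
  by (erule typed_prim) (auto simp: pprod_def)

lemma typed_suc: "\<Gamma> \<tturnstile> e : pnat \<Longrightarrow> \<Gamma> \<tturnstile> EPrim PSuc e : pnat"
  by (erule typed_prim) (auto simp: pnat_def)

lemma typed_upt: "\<Gamma> \<tturnstile> e : pnat \<Longrightarrow> \<Gamma> \<tturnstile> EPrim PUpt e : plist pnat"
  by (erule typed_prim) (auto simp: pnat_def intro!: plist_vlist simp: list_all2_conv_all_nth)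

lemma typed_tab: "\<Gamma> \<tturnstile> e : pnat \<Longrightarrow> \<Gamma> \<tturnstile> EPrim (PTab xs) e : pnat"
  by (erule typed_prim) (auto simp: pnat_def)

lemma plist_pnat_eq: "list_all2 pnat xs ys \<Longrightarrow> xs = ys"
  by (induction rule: list_all2_induct) (auto simp: pnat_def)

lemma typed_sum: "\<Gamma> \<tturnstile> e : plist pnat \<Longrightarrow> \<Gamma> \<tturnstile> EPrim PSum e : pnat"
  by (erule typed_prim) (auto dest!: plistD plist_pnat_eq)

lemma typed_append:
  "\<Gamma> \<tturnstile> s : plist P \<Longrightarrow> \<Gamma> \<tturnstile> t : plist P \<Longrightarrow> \<Gamma> \<tturnstile> EPrim PAppend (EPair s t) : plist P"
  by (erule (1) typed_pair[THEN typed_prim])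
    (auto simp: pprod_def intro!: plist_vlist list_all2_appendI dest: plistD)

lemma typed_concat:
  assumes "\<Gamma> \<tturnstile> e : plist (plist P)"
  shows "\<Gamma> \<tturnstile> EPrim PConcat e : plist P"
  using assms
proof (rule typed_prim)
  fix u v assume "plist (plist P) u v"
  then have "list_all2 (plist P) (elems u) (elems v)" by (rule plistD)
  then have "list_all2 P (concat (map elems (elems u))) (concat (map elems (elems v)))"
    by (induction rule: list_all2_induct) (auto intro!: list_all2_appendI dest: plistD)
  then show "plist P (prim_ap PConcat u) (prim_ap PConcat v)"
    by (simp add: plist_vlist)
qed

text \<open>The type-1 objects of the model are thus programs for total functions, identified when
  they compute the same function. Both oracles are typed by means of this.\<close>

lemma pfun_pnatD:
  assumes "pfun pnat pnat f g"
  shows "computes idx f (fn f)" "computes idx g (fn f)" "fn g = fn f"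
proof -
  have *: "\<exists>m. apps f (Num k) (Num m) \<and> apps g (Num k) (Num m)" for k
    using pfunE[OF assms, of "Num k" "Num k"] by (auto simp: pnat_def)
  then obtain h where "computes idx f h" "computes idx g h"
    unfolding computes_def by metis
  then show "computes idx f (fn f)" "computes idx g (fn f)" "fn g = fn f"
    using computes_fn by auto
qed

text \<open>The call terminates because \<open>idx\<close> covers every computable function, and it
  respects equality because the index entry depends only on the function computed.\<close>

lemma typed_nu:
  assumes "\<Gamma> \<tturnstile> e : pfun pnat pnat"
  shows "\<Gamma> \<tturnstile> ENu e : pnat"
proof (rule typedI)
  fix \<rho> \<rho>' assume \<rho>: "\<Gamma> \<rho> \<rho>'"
  note e = typedD[OF assms \<rho>]
  note c = pfun_pnatD[OF e(3)]
  obtain d where d: "(fn (den \<rho> e), d) \<in> idx"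
    using idx(2)[OF c(1)] by blast
  have "evals \<rho> (ENu e) (Num (to_nat d))" "evals \<rho>' (ENu e) (Num (to_nat d))"
    using ev_nu[OF e(1) _ d] ev_nu[OF e(2) _ d] c(1,2) unfolding computes_def by blast+
  then show "\<exists>u v. evals \<rho> (ENu e) u \<and> evals \<rho>' (ENu e) v \<and> pnat u v"
    by (auto simp: pnat_def)
qed

lemma typed_path:
  assumes "\<Gamma> \<tturnstile> e : pfun pnat pnat" "\<Gamma> \<tturnstile> t : pnat"
  shows "\<Gamma> \<tturnstile> EPath e t : pnat"
proof (rule typedI)
  fix \<rho> \<rho>' assume \<rho>: "\<Gamma> \<rho> \<rho>'"
  note e = typedD[OF assms(1) \<rho>] and t = typedD[OF assms(2) \<rho>]
  note c = pfun_pnatD[OF e(3)]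
  obtain n where n: "evals \<rho> t (Num n)" "evals \<rho>' t (Num n)"
    using t unfolding pnat_def by metis
  have "evals \<rho> (EPath e t) (Num (tree_path (fn (den \<rho> e)) n))"
    "evals \<rho>' (EPath e t) (Num (tree_path (fn (den \<rho> e)) n))"
    using ev_path[OF e(1) n(1)] ev_path[OF e(2) n(2)] c(1,2) unfolding computes_def by blast+
  then show "\<exists>u v. evals \<rho> (EPath e t) u \<and> evals \<rho>' (EPath e t) v \<and> pnat u v"
    by (auto simp: pnat_def)
qed

lemma evals_map:
  assumes "evals \<rho> s f" "evals \<rho> t l" "\<And>x. x \<in> set (elems l) \<Longrightarrow> apps f x (ap f x)"
  shows "evals \<rho> (EMap s t) (vlist (map (ap f) (elems l)))"
  using assms by (intro ev_map[OF assms(1,2)]) auto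

lemma typed_map:
  assumes "\<Gamma> \<tturnstile> t : plist P" "\<Gamma> \<tturnstile> s : pfun P Q"
  shows "\<Gamma> \<tturnstile> EMap s t : plist Q"
proof (rule typedI)
  fix \<rho> \<rho>' assume \<rho>: "\<Gamma> \<rho> \<rho>'"
  note s = typedD[OF assms(2) \<rho>] and t = typedD[OF assms(1) \<rho>]
  let ?f = "den \<rho> s" and ?g = "den \<rho>' s" and ?l = "den \<rho> t" and ?m = "den \<rho>' t"
  note P = plistD[OF t(3)]
  have "evals \<rho> (EMap s t) (vlist (map (ap ?f) (elems ?l)))"
  proof (rule evals_map[OF s(1) t(1)])
    fix x assume "x \<in> set (elems ?l)"
    then obtain y where "P x y" using P by (metis in_set_conv_nth list_all2_conv_all_nth)
    then show "apps ?f x (ap ?f x)" by (rule pfunE(1)[OF s(3)])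
  qed
  moreover have "evals \<rho>' (EMap s t) (vlist (map (ap ?g) (elems ?m)))"
  proof (rule evals_map[OF s(2) t(2)])
    fix x assume "x \<in> set (elems ?m)"
    then obtain y where "P y x" using P by (metis in_set_conv_nth list_all2_conv_all_nth)
    then show "apps ?g x (ap ?g x)" by (rule pfunE(2)[OF s(3)])
  qed
  moreover have "plist Q (vlist (map (ap ?f) (elems ?l))) (vlist (map (ap ?g) (elems ?m)))"
    using P pfunE(3)[OF s(3)]
    by (intro plist_vlist) (simp add: list_all2_conv_all_nth)
  ultimately show "\<exists>u v. evals \<rho> (EMap s t) u \<and> evals \<rho>' (EMap s t) v \<and> plist Q u v"
    by blast
qed

section \<open>The recursor on numbers and on lists\<close>

lemma recV_pfun_nat:
  assumes "Q u u'" "pfun pnat (pfun Q Q) f f'"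
  shows "pfun pnat Q (RecV u f) (RecV u' f')"
proof -
  have "\<exists>v v'. apps (RecV u f) (Num n) v \<and> apps (RecV u' f') (Num n) v' \<and> Q v v'" for n
  proof (induction n)
    case 0
    with assms(1) show ?case by (blast intro: app_rec_0)
  next
    case (Suc n)
    then obtain v v' where v: "apps (RecV u f) (Num n) v" "apps (RecV u' f') (Num n) v'" "Q v v'"
      by blast
    have "pnat (Num n) (Num n)" by simp
    note g = pfunE[OF assms(2) this]
    note h = pfunE[OF g(3) v(3)]
    show ?case
      using app_rec_Suc[OF v(1) g(1) h(1)] app_rec_Suc[OF v(2) g(2) h(2)] h(3) by blast
  qed
  then show ?thesis
    unfolding pfun_def by (auto simp: pnat_def)
qed

lemma recV_pfun_list:
  assumes "Q u u'" "pfun P (pfun (plist P) (pfun Q Q)) f f'"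
  shows "pfun (plist P) Q (RecV u f) (RecV u' f')"
proof -
  have "\<exists>v v'. apps (RecV u f) (vlist xs) v \<and> apps (RecV u' f') (vlist ys) v' \<and> Q v v'"
    if "list_all2 P xs ys" for xs ys
    using that
  proof (induction rule: list_all2_induct)
    case Nil
    with assms(1) show ?case by (auto intro: app_rec_0)
  next
    case (Cons x xs y ys)
    then obtain v v' where v: "apps (RecV u f) (vlist xs) v" "apps (RecV u' f') (vlist ys) v'" "Q v v'"
      by blast
    note g = pfunE[OF assms(2) Cons.hyps(1)]
    note h = pfunE[OF g(3) plist_vlist[OF Cons.hyps(2)]]
    note k = pfunE[OF h(3) v(3)]
    show ?case
      using app_rec_Pair[OF v(1) g(1) h(1) k(1)] app_rec_Pair[OF v(2) g(2) h(2) k(2)] k(3) by auto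
  qed
  then show ?thesis
    unfolding pfun_def plist_def by blast
qed

lemma typed_rec:
  assumes "\<Gamma> \<tturnstile> s : Q" "\<Gamma> \<tturnstile> t : P"
    "\<And>u u' f f'. Q u u' \<Longrightarrow> P f f' \<Longrightarrow> R (RecV u f) (RecV u' f')"
  shows "\<Gamma> \<tturnstile> ERec s t : R"
proof (rule typedI)
  fix \<rho> \<rho>' assume \<rho>: "\<Gamma> \<rho> \<rho>'"
  note s = typedD[OF assms(1) \<rho>] and t = typedD[OF assms(2) \<rho>]
  show "\<exists>u v. evals \<rho> (ERec s t) u \<and> evals \<rho>' (ERec s t) v \<and> R u v"
    using ev_rec[OF s(1) t(1)] ev_rec[OF s(2) t(2)] assms(3)[OF s(3) t(3)] by blast
qed

lemma typed_rec_nat: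
  "\<Gamma> \<tturnstile> s : Q \<Longrightarrow> \<Gamma> \<tturnstile> t : pfun pnat (pfun Q Q) \<Longrightarrow> \<Gamma> \<tturnstile> ERec s t : pfun pnat Q"
  by (erule (1) typed_rec) (rule recV_pfun_nat)

lemma typed_rec_list:
  "\<Gamma> \<tturnstile> s : Q \<Longrightarrow> \<Gamma> \<tturnstile> t : pfun P (pfun (plist P) (pfun Q Q)) \<Longrightarrow>
    \<Gamma> \<tturnstile> ERec s t : pfun (plist P) Q"
  by (erule (1) typed_rec) (rule recV_pfun_list)

lemma ap_rec_0 [simp]: "ap (RecV u f) (Num 0) = u"
  by (rule ap_eq, rule app_rec_0)

lemma ap_rec_Suc:
  assumes "Q u u" "pfun pnat (pfun Q Q) f f"
  shows "ap (RecV u f) (Num (Suc n)) = ap (ap f (Num n)) (ap (RecV u f) (Num n))"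
proof -
  have n: "pnat (Num n) (Num n)" by simp
  note r = pfunE[OF recV_pfun_nat[of Q, OF assms] n]
  note g = pfunE[OF assms(2) n]
  show ?thesis
    by (rule ap_eq, rule app_rec_Suc[OF r(1) g(1) pfunE(1)[OF g(3) r(3)]])
qed

lemma ap_rec_Pair:
  assumes "Q u u" "pfun P (pfun (plist P) (pfun Q Q)) f f" "P a a" "plist P b b"
  shows "ap (RecV u f) (Pair a b) = ap (ap (ap f a) b) (ap (RecV u f) b)"
proof -
  note r = pfunE[OF recV_pfun_list[of Q, OF assms(1,2)] assms(4)]
  note g = pfunE[OF assms(2,3)]
  note h = pfunE[OF g(3) assms(4)]
  show ?thesis
    by (rule ap_eq, rule app_rec_Pair[OF r(1) g(1) h(1) pfunE(1)[OF h(3) r(3)]])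
qed

lemmas typed_intros = typed_lam typed_vars typed_app typed_pair typed_fst typed_snd
  typed_append typed_concat typed_map typed_unit


section \<open>The model\<close>

primrec ty_per :: "ty \<Rightarrow> per" where
  "ty_per Base = pnat"
| "ty_per (\<sigma> \<rightarrow> \<tau>) = pfun (ty_per \<sigma>) (ty_per \<tau>)"
| "ty_per (SeqT \<sigma>) = plist (ty_per \<sigma>)"

lemma is_per_ty_per [simp]: "is_per (ty_per \<sigma>)"
  by (induction \<sigma>) simp_all

text \<open>Type indices are erased: each functional constant is one untyped closure over the empty
  environment \<open>Num 0\<close>. \<open>Rec\<close> and \<open>SRec\<close> share a program
  because \<open>RecV\<close> inspects its argument.\<close>

primrec tval :: "(var \<Rightarrow> val) \<Rightarrow> tm \<Rightarrow> val" where
  "tval \<rho> (Var x) = \<rho> x"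
| "tval \<rho> (s \<cdot> t) = ap (tval \<rho> s) (tval \<rho> t)"
| "tval \<rho> Zero = Num 0"
| "tval \<rho> Succ = Clo (EPrim PSuc (EVar 0)) (Num 0)"
| "tval \<rho> (CombK \<sigma> \<tau>) = Clo (ELam (EVar 1)) (Num 0)"
| "tval \<rho> (CombS \<rho>' \<sigma> \<tau>) =
    Clo (ELam (ELam (EVar 2 \<bullet> EVar 0 \<bullet> (EVar 1 \<bullet> EVar 0)))) (Num 0)"
| "tval \<rho> (Rec \<sigma>) = Clo (ELam (ERec (EVar 1) (EVar 0))) (Num 0)"
| "tval \<rho> (Empty \<sigma>) = Num 0"
| "tval \<rho> (Prep \<sigma>) = Clo (ELam (EPair (EVar 1) (EVar 0))) (Num 0)"
| "tval \<rho> (SRec \<sigma> \<tau>) = Clo (ELam (ERec (EVar 1) (EVar 0))) (Num 0)"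

definition env_rel :: "(var \<Rightarrow> val) \<Rightarrow> (var \<Rightarrow> val) \<Rightarrow> bool" where
  "env_rel \<rho> \<rho>' \<longleftrightarrow> (\<forall>x. ty_per (snd x) (\<rho> x) (\<rho>' x))"

abbreviation env_ok :: "(var \<Rightarrow> val) \<Rightarrow> bool" where
  "env_ok \<rho> \<equiv> env_rel \<rho> \<rho>"

lemma env_ok_upd [simp]: "env_ok \<rho> \<Longrightarrow> ty_per (snd x) a a \<Longrightarrow> env_ok (\<rho>(x := a))"
  by (auto simp: env_rel_def)

lemma env_okD: "env_ok \<rho> \<Longrightarrow> ty_per (snd x) (\<rho> x) (\<rho> x)"
  unfolding env_rel_def by blast

lemma env_relD: "env_rel \<rho> \<rho>' \<Longrightarrow> ty_per (snd x) (\<rho> x) (\<rho>' x)"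
  unfolding env_rel_def by blast

lemma clo_nil_pfun: "pprod P pun \<tturnstile> b : Q \<Longrightarrow> pfun P Q (Clo b (Num 0)) (Clo b (Num 0))"
  by (erule clo_pfun) (rule punI)

text \<open>The fundamental lemma of the logical relation: the program of each constant passes the
  typing rules, and application preserves relatedness.\<close>

lemma tval_related:
  assumes "env_rel \<rho> \<rho>'"
  shows "wt t \<Longrightarrow> ty_per (ty_of t) (tval \<rho> t) (tval \<rho>' t)"
proof (induction t)
  case (Var x)
  show ?case using env_relD[OF assms] by simp
next
  case (App s t)
  then obtain \<tau> where \<tau>: "ty_of s = ty_of t \<rightarrow> \<tau>" by auto
  with App have "pfun (ty_per (ty_of t)) (ty_per \<tau>) (tval \<rho> s) (tval \<rho>' s)" by simp
  from pfunE(3)[OF this App.IH(2)] App.prems \<tau> show ?case by simp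
next
  case Succ
  show ?case by simp (intro clo_nil_pfun typed_intros typed_suc)
next
  case (CombK \<sigma> \<tau>)
  show ?case by simp (intro clo_nil_pfun typed_intros)
next
  case (CombS \<rho>' \<sigma> \<tau>)
  show ?case
    by simp (rule clo_nil_pfun typed_lam typed_app typed_vars)+
next
  case (Rec \<sigma>)
  show ?case by simp (intro clo_nil_pfun typed_intros typed_rec_nat)
next
  case (Prep \<sigma>)
  show ?case by simp (intro clo_nil_pfun typed_lam typed_vars typed_cons)
next
  case (SRec \<sigma> \<tau>)
  show ?case by simp (intro clo_nil_pfun typed_intros typed_rec_list)
qed simp_all

lemma tval_ok: "env_ok \<rho> \<Longrightarrow> wt t \<Longrightarrow> ty_per (ty_of t) (tval \<rho> t) (tval \<rho> t)"
  by (rule tval_related)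

section \<open>The functional interpretation\<close>

abbreviation "EFst e \<equiv> EPrim PFst e"
abbreviation "ESnd e \<equiv> EPrim PSnd e"

text \<open>Ordinary truth in the model, to which \<open>holds\<close> collapses on internal
  formulas.\<close>

primrec tr :: "fm \<Rightarrow> (var \<Rightarrow> val) \<Rightarrow> bool" where
  "tr Falsum \<rho> = False"
| "tr (s \<^bold>= t) \<rho> = ty_per (ty_of s) (tval \<rho> s) (tval \<rho> t)"
| "tr (St t) \<rho> = True"
| "tr (A \<^bold>\<longrightarrow> B) \<rho> = (tr A \<rho> \<longrightarrow> tr B \<rho>)"
| "tr (\<^bold>\<forall>x. A) \<rho> = (\<forall>a. ty_per (snd x) a a \<longrightarrow> tr A (\<rho>(x := a)))"

text \<open>
  A formula is interpreted as \<open>\<forall>c. \<exists>r. holds A \<rho> c r\<close> with challenges \<open>c\<close> and responses \<open>r\<close>.  A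
  response to \<open>St t\<close> is a finite list of candidates for \<open>t\<close>; a challenge to \<open>A \<^bold>\<longrightarrow> B\<close> is a strategy for
  \<open>A\<close> with a challenge to \<open>B\<close>, and the response lists the challenges on which that strategy is to be
  tested.  Quantifiers are uniform: neither challenges nor responses see the value of \<open>x\<close>.
\<close>

primrec pers :: "fm \<Rightarrow> per \<times> per" where
  "pers Falsum = (pun, pun)"
| "pers (s \<^bold>= t) = (pun, pun)"
| "pers (St t) = (pun, plist (ty_per (ty_of t)))"
| "pers (A \<^bold>\<longrightarrow> B) =
    (pprod (pfun (fst (pers A)) (snd (pers A))) (fst (pers B)),
     pprod (plist (fst (pers A))) (snd (pers B)))"
| "pers (\<^bold>\<forall>x. A) = pers A"

definition chal :: "fm \<Rightarrow> per" where
  "chal A = fst (pers A)"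

definition resp :: "fm \<Rightarrow> per" where
  "resp A = snd (pers A)"

lemma chal_simps [simp]:
  "chal Falsum = pun"
  "chal (s \<^bold>= t) = pun"
  "chal (St t) = pun"
  "chal (A \<^bold>\<longrightarrow> B) = pprod (pfun (chal A) (resp A)) (chal B)"
  "chal (\<^bold>\<forall>x. A) = chal A"
  by (simp_all add: chal_def resp_def)

lemma resp_simps [simp]:
  "resp Falsum = pun"
  "resp (s \<^bold>= t) = pun"
  "resp (St t) = plist (ty_per (ty_of t))"
  "resp (A \<^bold>\<longrightarrow> B) = pprod (plist (chal A)) (resp B)"
  "resp (\<^bold>\<forall>x. A) = resp A"
  by (simp_all add: chal_def resp_def)

primrec holds :: "fm \<Rightarrow> (var \<Rightarrow> val) \<Rightarrow> val \<Rightarrow> val \<Rightarrow> bool" where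
  "holds Falsum \<rho> c r = False"
| "holds (s \<^bold>= t) \<rho> c r = ty_per (ty_of s) (tval \<rho> s) (tval \<rho> t)"
| "holds (St t) \<rho> c r = (\<exists>e\<in>set (elems r). ty_per (ty_of t) e (tval \<rho> t))"
| "holds (A \<^bold>\<longrightarrow> B) \<rho> c r =
    ((\<forall>q\<in>set (elems (vfst r)). holds A \<rho> q (ap (vfst c) q)) \<longrightarrow> holds B \<rho> (vsnd c) (vsnd r))"
| "holds (\<^bold>\<forall>x. A) \<rho> c r = (\<forall>a. ty_per (snd x) a a \<longrightarrow> holds A (\<rho>(x := a)) c r)"

lemma is_per_chal_resp [simp]: "is_per (chal A)" "is_per (resp A)"
  by (induction A) simp_all

lemma tval_cong: "(\<And>x. x \<in> fvt t \<Longrightarrow> \<rho> x = \<rho>' x) \<Longrightarrow> tval \<rho> t = tval \<rho>' t"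
proof (induction t)
  case (App s t)
  then have "tval \<rho> s = tval \<rho>' s" "tval \<rho> t = tval \<rho>' t" by simp_all
  then show ?case by simp
qed simp_all

lemma tr_cong: "(\<And>x. x \<in> fvf A \<Longrightarrow> \<rho> x = \<rho>' x) \<Longrightarrow> tr A \<rho> = tr A \<rho>'"
proof (induction A arbitrary: \<rho> \<rho>')
  case (Eq s t)
  then have "tval \<rho> s = tval \<rho>' s" "tval \<rho> t = tval \<rho>' t" by (auto intro!: tval_cong)
  then show ?case by simp
next
  case (Imp A B)
  have "tr A \<rho> = tr A \<rho>'" "tr B \<rho> = tr B \<rho>'"
    by (rule Imp.IH, simp add: Imp.prems)+
  then show ?case by simp
next
  case (All x A)
  have "tr A (\<rho>(x := a)) = tr A (\<rho>'(x := a))" for a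
    by (rule All.IH) (simp add: All.prems)
  then show ?case by simp
qed simp_all

lemma holds_cong: "(\<And>x. x \<in> fvf A \<Longrightarrow> \<rho> x = \<rho>' x) \<Longrightarrow> holds A \<rho> c r = holds A \<rho>' c r"
proof (induction A arbitrary: \<rho> \<rho>' c r)
  case (Eq s t)
  then have "tval \<rho> s = tval \<rho>' s" "tval \<rho> t = tval \<rho>' t" by (auto intro!: tval_cong)
  then show ?case by simp
next
  case (St t)
  then have "tval \<rho> t = tval \<rho>' t" by (auto intro!: tval_cong)
  then show ?case by simp
next
  case (Imp A B)
  have "holds A \<rho> c r = holds A \<rho>' c r" "holds B \<rho> c r = holds B \<rho>' c r" for c r
    by (rule Imp.IH, simp add: Imp.prems)+
  then show ?case by simp
next
  case (All x A)
  have "holds A (\<rho>(x := a)) c r = holds A (\<rho>'(x := a)) c r" for a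
    by (rule All.IH) (simp add: All.prems)
  then show ?case by simp
qed simp_all

lemma tval_subt: "tval \<rho> (subt t x u) = tval (\<rho>(x := tval \<rho> u)) t"
  by (induction t) simp_all

lemma ty_of_subt [simp]: "ty_of u = snd x \<Longrightarrow> ty_of (subt t x u) = ty_of t"
  by (induction t) simp_all

lemma subt_id: "x \<notin> fvt t \<Longrightarrow> subt t x u = t"
  by (induction t) simp_all

lemma subf_id: "x \<notin> fvf A \<Longrightarrow> subf A x u = A"
  by (induction A) (auto simp: subt_id)

lemma chal_resp_subf [simp]:
  assumes "ty_of u = snd x"
  shows "chal (subf A x u) = chal A" "resp (subf A x u) = resp A"
  using assms by (induction A) simp_all

lemma tr_subf:
  "free_for u x A \<Longrightarrow> ty_of u = snd x \<Longrightarrow> tr (subf A x u) \<rho> = tr A (\<rho>(x := tval \<rho> u))"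
proof (induction A arbitrary: \<rho>)
  case (All y A)
  show ?case
  proof (cases "y = x \<or> x \<notin> fvf A")
    case True
    then have "subf (\<^bold>\<forall>y. A) x u = (\<^bold>\<forall>y. A)" by (auto simp: subf_id)
    moreover have "tr (\<^bold>\<forall>y. A) \<rho> = tr (\<^bold>\<forall>y. A) (\<rho>(x := tval \<rho> u))"
      by (rule tr_cong) (use True in auto)
    ultimately show ?thesis by (simp only:)
  next
    case False
    with All.prems have "y \<notin> fvt u" "free_for u x A" by auto
    then have "tval (\<rho>(y := a)) u = tval \<rho> u" for a
      by (intro tval_cong) auto
    then have "(\<rho>(y := a))(x := tval (\<rho>(y := a)) u) = \<rho>(x := tval \<rho> u, y := a)" for a
      using False by (auto simp: fun_eq_iff)
    then have "tr (subf A x u) (\<rho>(y := a)) = tr A (\<rho>(x := tval \<rho> u, y := a))" for a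
      using All.IH[OF \<open>free_for u x A\<close> All.prems(2), of "\<rho>(y := a)"] by (simp only:)
    with False show ?thesis by (simp del: fun_upd_apply)
  qed
qed (simp_all add: tval_subt)

lemma holds_subf:
  "free_for u x A \<Longrightarrow> ty_of u = snd x \<Longrightarrow>
    holds (subf A x u) \<rho> c r = holds A (\<rho>(x := tval \<rho> u)) c r"
proof (induction A arbitrary: \<rho> c r)
  case (All y A)
  show ?case
  proof (cases "y = x \<or> x \<notin> fvf A")
    case True
    then have "subf (\<^bold>\<forall>y. A) x u = (\<^bold>\<forall>y. A)" by (auto simp: subf_id)
    moreover have "holds (\<^bold>\<forall>y. A) \<rho> c r = holds (\<^bold>\<forall>y. A) (\<rho>(x := tval \<rho> u)) c r"
      by (rule holds_cong) (use True in auto)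
    ultimately show ?thesis by (simp only:)
  next
    case False
    with All.prems have "y \<notin> fvt u" "free_for u x A" by auto
    then have "tval (\<rho>(y := a)) u = tval \<rho> u" for a
      by (intro tval_cong) auto
    then have "(\<rho>(y := a))(x := tval (\<rho>(y := a)) u) = \<rho>(x := tval \<rho> u, y := a)" for a
      using False by (auto simp: fun_eq_iff)
    then have "holds (subf A x u) (\<rho>(y := a)) c r = holds A (\<rho>(x := tval \<rho> u, y := a)) c r" for a
      using All.IH[OF \<open>free_for u x A\<close> All.prems(2), of "\<rho>(y := a)"] by (simp only:)
    with False show ?thesis by (simp del: fun_upd_apply)
  qed
qed (simp_all add: tval_subt)

section \<open>Canonical challenges and responses, and the collapse of internal formulas to
  truth\<close>

definition const_val :: "val \<Rightarrow> val" where
  "const_val v = Clo (EVar 1) (Pair v (Num 0))"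

lemma const_val_pfun: "Q v w \<Longrightarrow> pfun P Q (const_val v) (const_val w)"
  unfolding const_val_def
  by (rule clo_pfun[where \<Gamma> = "pprod Q pun"], (rule typed_vars)+, simp add: punI)

lemma ap_const_val [simp]: "ap (const_val v) a = v"
proof -
  \<comment> \<open>Singleton relations serve as types here, so that neither \<open>v\<close> nor
    \<open>a\<close> needs a typing hypothesis.\<close>
  have "pfun (\<lambda>x y. x = a \<and> y = a) (\<lambda>x y. x = v \<and> y = v) (const_val v) (const_val v)"
    by (rule const_val_pfun) simp
  from ap_clo[OF this[unfolded const_val_def]] show ?thesis
    by (simp add: const_val_def)
qed

text \<open>The first component is a challenge, the second a response. The challenge to an
  implication plays the canonical response to the premise constantly, and the response tests the
  premise on its canonical challenge; this is what makes the pair decide internal formulas.\<close>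

primrec canon :: "fm \<Rightarrow> val \<times> val" where
  "canon Falsum = (Num 0, Num 0)"
| "canon (s \<^bold>= t) = (Num 0, Num 0)"
| "canon (St t) = (Num 0, Num 0)"
| "canon (A \<^bold>\<longrightarrow> B) =
    (Pair (const_val (snd (canon A))) (fst (canon B)), Pair (vlist [fst (canon A)]) (snd (canon B)))"
| "canon (\<^bold>\<forall>x. A) = canon A"

definition cev :: "fm \<Rightarrow> val" where
  "cev A = fst (canon A)"

definition crv :: "fm \<Rightarrow> val" where
  "crv A = snd (canon A)"

lemma canon_simps [simp]:
  "cev (A \<^bold>\<longrightarrow> B) = Pair (const_val (crv A)) (cev B)"
  "crv (A \<^bold>\<longrightarrow> B) = Pair (vlist [cev A]) (crv B)"
  "cev (\<^bold>\<forall>x. A) = cev A"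
  "crv (\<^bold>\<forall>x. A) = crv A"
  "crv (St t) = Num 0"
  by (simp_all add: cev_def crv_def)

lemma cev_crv: "chal A (cev A) (cev A) \<and> resp A (crv A) (crv A)"
  by (induction A) (auto simp: const_val_pfun cev_def crv_def chal_def resp_def punI)

lemma cev_chal [simp]: "chal A (cev A) (cev A)" and crv_resp [simp]: "resp A (crv A) (crv A)"
  using cev_crv by blast+

text \<open>Simultaneous induction, since the two claims change places on the left of an
  implication: a canonical response meets every challenge to a true formula, and a canonical
  challenge can be met only if the formula is true.\<close>

lemma holds_internal:
  assumes "internal A"
  shows "tr A \<rho> \<Longrightarrow> holds A \<rho> c (crv A)" "holds A \<rho> (cev A) r \<Longrightarrow> tr A \<rho>"
proof -
  have "(tr A \<rho> \<longrightarrow> (\<forall>c. holds A \<rho> c (crv A))) \<and> (\<forall>r. holds A \<rho> (cev A) r \<longrightarrow> tr A \<rho>)"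
    using assms
  proof (induction A arbitrary: \<rho>)
    case (Imp A B)
    then show ?case by auto
  qed auto
  then show "tr A \<rho> \<Longrightarrow> holds A \<rho> c (crv A)" "holds A \<rho> (cev A) r \<Longrightarrow> tr A \<rho>"
    by blast+
qed

text \<open>Realizing double negation elimination yields a list of responses of which at least one is
  correct; these have to be merged into a single response.\<close>

primrec merge :: "fm \<Rightarrow> val" where
  "merge Falsum = Clo (ENum 0) (Num 0)"
| "merge (s \<^bold>= t) = Clo (ENum 0) (Num 0)"
| "merge (St t) = Clo (EPrim PConcat (EVar 0)) (Num 0)"
| "merge (A \<^bold>\<longrightarrow> B) =
    Clo (EPair (EPrim PConcat (EMap (ELam (EFst (EVar 0))) (EVar 0)))
           (EVar 1 \<bullet> EMap (ELam (ESnd (EVar 0))) (EVar 0)))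
        (Pair (merge B) (Num 0))"
| "merge (\<^bold>\<forall>x. A) = merge A"

lemma merge_pfun: "pfun (plist (resp A)) (resp A) (merge A) (merge A)"
proof (induction A)
  case (Imp A B)
  show ?case
    unfolding merge.simps resp_simps
    by (rule clo_pfun[where \<Gamma> = "pprod (pfun (plist (resp B)) (resp B)) pun"],
        (rule typed_intros)+, simp add: Imp.IH punI)
next
  case (All x A)
  then show ?case by simp
qed (unfold merge.simps resp_simps; (rule clo_nil_pfun typed_intros)+)+

text \<open>A closure can be unfolded only at typed arguments; the elements of a typed list are such
  arguments.\<close>

lemma map_clo:
  assumes "pfun P Q (Clo b \<rho>) g" "plist P l l"
  shows "map (ap (Clo b \<rho>)) (elems l) = map (\<lambda>x. den (Pair x \<rho>) b) (elems l)"
  by (rule map_cong[OF HOL.refl]) (rule ap_clo[OF assms(1) plist_mem[OF assms(2)]])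

text \<open>More candidates for \<open>St\<close> can only help. At an implication, joining the test
  lists strengthens what the strategy for the premise must pass, and the conclusions are merged
  recursively.\<close>

lemma holds_merge:
  "plist (resp A) l l \<Longrightarrow> r \<in> set (elems l) \<Longrightarrow> holds A \<rho> c r \<Longrightarrow> holds A \<rho> c (ap (merge A) l)"
proof (induction A arbitrary: \<rho> c r l)
  case (St t)
  have "ap (merge (St t)) l = vlist (concat (map elems (elems l)))"
    using ap_clo[OF merge_pfun[of "St t", unfolded merge.simps] St.prems(1)] by simp
  with St.prems show ?case by auto
next
  case (Imp A B)
  let ?\<rho> = "Pair l (Pair (merge B) (Num 0))"
  let ?\<Gamma> = "pprod (plist (resp (A \<^bold>\<longrightarrow> B))) (pprod (pfun (plist (resp B)) (resp B)) pun)"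
  have \<rho>: "?\<Gamma> ?\<rho> ?\<rho>"
    using Imp.prems(1) merge_pfun by (simp add: punI)
  have fst: "pfun (resp (A \<^bold>\<longrightarrow> B)) (plist (chal A)) (Clo (EFst (EVar 0)) ?\<rho>) (Clo (EFst (EVar 0)) ?\<rho>)"
    and snd: "pfun (resp (A \<^bold>\<longrightarrow> B)) (resp B) (Clo (ESnd (EVar 0)) ?\<rho>) (Clo (ESnd (EVar 0)) ?\<rho>)"
    unfolding resp_simps
    by (rule clo_pfun[where \<Gamma> = ?\<Gamma>], unfold resp_simps, (rule typed_intros)+,
        rule \<rho>[unfolded resp_simps])+
  let ?l = "vlist (map vsnd (elems l))"
  have "ap (merge (A \<^bold>\<longrightarrow> B)) l =
      Pair (vlist (concat (map (elems \<circ> vfst) (elems l)))) (ap (merge B) ?l)"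
    using ap_clo[OF merge_pfun[of "A \<^bold>\<longrightarrow> B", unfolded merge.simps] Imp.prems(1)]
    by (simp add: map_clo[OF fst Imp.prems(1)] map_clo[OF snd Imp.prems(1)] comp_def)
  moreover have "plist (resp B) ?l ?l"
  proof (rule plist_vlist)
    have "list_all2 (resp (A \<^bold>\<longrightarrow> B)) (elems l) (elems l)" by (rule plistD[OF Imp.prems(1)])
    then show "list_all2 (resp B) (map vsnd (elems l)) (map vsnd (elems l))"
      by (auto simp: list_all2_conv_all_nth pprod_def)
  qed
  moreover have "vsnd r \<in> set (elems ?l)"
    using Imp.prems(2) by simp
  ultimately show ?case
    using Imp.prems Imp.IH(2)[of ?l "vsnd r" \<rho> "vsnd c"] by auto
qed auto

text \<open>One \<open>d\<close> must work for all environments, so free variables are treated like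
  uniform quantifiers and generalisation leaves the realizer unchanged.\<close>

definition realizes :: "val \<Rightarrow> fm \<Rightarrow> bool" where
  "realizes d A \<longleftrightarrow> pfun (chal A) (resp A) d d \<and>
    (\<forall>\<rho> c. env_ok \<rho> \<longrightarrow> chal A c c \<longrightarrow> holds A \<rho> c (ap d c))"

definition valid :: "fm \<Rightarrow> bool" where
  "valid A \<longleftrightarrow> (\<exists>d. realizes d A)"

text \<open>The format of all explicit realizers below: a program body with the challenge as
  variable 0, followed by an environment of fixed values that the body may use.\<close>

lemma validI:
  assumes "pprod (chal A) \<Gamma> \<tturnstile> b : resp A" "\<Gamma> \<rho>0 \<rho>0"
    "\<And>\<rho> c. env_ok \<rho> \<Longrightarrow> chal A c c \<Longrightarrow> holds A \<rho> c (den (Pair c \<rho>0) b)"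
  shows "valid A"
proof -
  have "pfun (chal A) (resp A) (Clo b \<rho>0) (Clo b \<rho>0)"
    by (rule clo_pfun[OF assms(1,2)])
  with assms(3) ap_clo[OF this] show ?thesis
    unfolding valid_def realizes_def by metis
qed

lemma valid_internal:
  assumes "internal A" "\<And>\<rho>. env_ok \<rho> \<Longrightarrow> tr A \<rho>"
  shows "valid A"
  unfolding valid_def realizes_def
  by (rule exI[of _ "const_val (crv A)"])
    (auto simp: const_val_pfun holds_internal(1)[OF assms(1)] assms(2))

section \<open>Soundness of the logical rules\<close>

lemma pprodE:
  assumes "pprod P Q c c"
  obtains a b where "c = Pair a b" "P a a" "Q b b"
  using assms unfolding pprod_def by auto

lemma valid_P1: "valid (A \<^bold>\<longrightarrow> B \<^bold>\<longrightarrow> A)"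
proof (rule validI)
  \<comment> \<open>A challenge is \<open>(Y, (Z, v))\<close> with strategies \<open>Y\<close> for
    \<open>A\<close> and \<open>Z\<close> for \<open>B\<close>. Only \<open>A\<close> is tested, at
    \<open>v\<close>, and the answer of \<open>Y\<close> at \<open>v\<close> is returned.\<close>
  let ?v = "ESnd (ESnd (EVar 0))"
  show "pprod (chal (A \<^bold>\<longrightarrow> B \<^bold>\<longrightarrow> A)) pun \<tturnstile>
      EPair (EPair ?v (ENum 0)) (EPair (ENum 0) (EFst (EVar 0) \<bullet> ?v)) : resp (A \<^bold>\<longrightarrow> B \<^bold>\<longrightarrow> A)"
    unfolding chal_simps resp_simps by (rule typed_intros typed_nil typed_cons)+
  show "pun (Num 0) (Num 0)" by (rule punI)
qed simp

lemma valid_P2: "valid ((A \<^bold>\<longrightarrow> B \<^bold>\<longrightarrow> C) \<^bold>\<longrightarrow> (A \<^bold>\<longrightarrow> B) \<^bold>\<longrightarrow> A \<^bold>\<longrightarrow> C)" (is "valid ?F")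
proof (rule validI)
  \<comment> \<open>A challenge consists of strategies \<open>Y1\<close>, \<open>Y2\<close>,
    \<open>Y3\<close> for the three premises and a challenge \<open>v\<close> to \<open>C\<close>.
    \<open>Y2\<close> and \<open>Y3\<close> combine to the strategy \<open>?YB\<close> for
    \<open>B\<close>; playing it with \<open>Y3\<close> against \<open>Y1\<close> yields tests of
    \<open>A\<close> and of \<open>B\<close>. A test \<open>b\<close> of \<open>B\<close> turns into
    the test \<open>(Y3, b)\<close> of the second premise together with the tests of
    \<open>A\<close> that \<open>Y2\<close> then requests.\<close>
  let ?Y1 = "\<lambda>i. EFst (EVar i)" and ?Y2 = "\<lambda>i. EFst (ESnd (EVar i))"
  let ?Y3 = "\<lambda>i. EFst (ESnd (ESnd (EVar i)))" and ?v = "ESnd (ESnd (ESnd (EVar 0)))"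
  let ?cB = "EPair (?Y3 1) (EVar 0)"
  let ?YB = "ELam (ESnd (?Y2 1 \<bullet> ?cB))"
  let ?c1 = "EPair (?Y3 0) (EPair ?YB ?v)"
  let ?out = "?Y1 0 \<bullet> ?c1"
  let ?Lb = "EFst (ESnd ?out)"
  let ?La = "ELam (EFst (?Y2 1 \<bullet> ?cB))"
  show typed: "pprod (chal ?F) pun \<tturnstile>
      EPair (EPair ?c1 (ENum 0)) (EPair (EMap (ELam ?cB) ?Lb)
        (EPair (EPrim PAppend (EPair (EFst ?out) (EPrim PConcat (EMap ?La ?Lb))))
          (ESnd (ESnd ?out)))) : resp ?F"
    unfolding chal_simps resp_simps
    by (rule typed_intros typed_nil typed_cons)+
  show "pun (Num 0) (Num 0)" by (rule punI)
  fix \<rho> c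
  assume "env_ok \<rho>" and c: "chal ?F c c"
  then obtain Y1 Y2 Y3 v where c_eq: "c = Pair Y1 (Pair Y2 (Pair Y3 v))"
    and Y1: "pfun (chal (A \<^bold>\<longrightarrow> B \<^bold>\<longrightarrow> C)) (resp (A \<^bold>\<longrightarrow> B \<^bold>\<longrightarrow> C)) Y1 Y1"
    and Y3: "pfun (chal A) (resp A) Y3 Y3" and v: "chal C v v"
    unfolding chal_simps by (elim pprodE) auto
  let ?\<rho> = "Pair c (Num 0)" and ?\<Gamma> = "pprod (chal ?F) pun"
  have \<rho>: "?\<Gamma> ?\<rho> ?\<rho>" using c by (simp add: punI)
  have "pfun (chal B) (resp B) (den ?\<rho> ?YB) (den ?\<rho> ?YB)"
    "pfun (chal B) (chal (A \<^bold>\<longrightarrow> B)) (den ?\<rho> (ELam ?cB)) (den ?\<rho> (ELam ?cB))"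
    "pfun (chal B) (plist (chal A)) (den ?\<rho> ?La) (den ?\<rho> ?La)"
    by (rule typedD(3)[where \<Gamma> = ?\<Gamma>, OF _ \<rho>], unfold chal_simps resp_simps, (rule typed_intros typed_nil)+)+
  note YB = this(1)[unfolded den.simps] and LB = this(2)[unfolded den.simps]
    and LA = this(3)[unfolded den.simps]
  let ?q = "den ?\<rho> ?c1"
  have q: "chal (A \<^bold>\<longrightarrow> B \<^bold>\<longrightarrow> C) ?q ?q"
    using Y3 YB v by (simp add: c_eq)
  obtain la lb w where out: "ap Y1 ?q = Pair la (Pair lb w)" and lb: "plist (chal B) lb lb"
    using pfunE(3)[OF Y1 q] unfolding resp_simps by (elim pprodE) auto
  have "den ?\<rho> (?Y1 0 \<bullet> ?c1) = Pair la (Pair lb w)"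
    using out by (simp add: c_eq)
  then show "holds ?F \<rho> c (den ?\<rho> (EPair (EPair ?c1 (ENum 0)) (EPair (EMap (ELam ?cB) ?Lb)
        (EPair (EPrim PAppend (EPair (EFst ?out) (EPrim PConcat (EMap ?La ?Lb))))
          (ESnd (ESnd ?out))))))"
    using map_clo[OF LB lb] map_clo[OF LA lb] map_clo[OF YB lb]
    by (auto simp: c_eq ball_Un)
qed

lemma valid_P3: "valid (Neg (Neg A) \<^bold>\<longrightarrow> A)" (is "valid ?F")
proof (rule validI)
  let ?\<Gamma> = "pprod (pfun (plist (resp A)) (resp A)) pun"
  let ?Y = "EFst (EVar 0)" and ?v = "\<lambda>i. ESnd (EVar i)"
  \<comment> \<open>A challenge to \<open>Neg A\<close> contains a strategy for \<open>A\<close>;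
    \<open>?Z\<close> asks to test it at \<open>v\<close>. Since \<open>Falsum\<close> never holds,
    \<open>?Z\<close> must fail on some member of \<open>?fs\<close>, which means that its strategy
    answers \<open>v\<close> correctly. Which member is unknown, so all answers are merged.\<close>
  let ?Z = "ELam (EPair (EPair (?v 1) (ENum 0)) (ENum 0))"
  let ?q = "EPair ?Z (ENum 0)"
  let ?fs = "EFst (?Y \<bullet> ?q)"
  let ?w = "ELam (EFst (EVar 0) \<bullet> ?v 1)"
  show "pprod (chal ?F) ?\<Gamma> \<tturnstile>
      EPair (EPair ?q (ENum 0)) (EVar 1 \<bullet> EMap ?w ?fs) : resp ?F"
    unfolding Neg_def chal_simps resp_simps by (rule typed_intros typed_nil typed_cons)+
  show mrg: "?\<Gamma> (Pair (merge A) (Num 0)) (Pair (merge A) (Num 0))"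
    by (simp add: merge_pfun punI)
  fix \<rho> c
  assume "env_ok \<rho>" and c: "chal ?F c c"
  then obtain Y v where c_eq: "c = Pair Y v"
    and Y: "pfun (chal (Neg (Neg A))) (resp (Neg (Neg A))) Y Y" and v: "chal A v v"
    unfolding chal_simps by (elim pprodE) auto
  let ?\<rho> = "Pair c (Pair (merge A) (Num 0))"
  have \<rho>: "pprod (chal ?F) ?\<Gamma> ?\<rho> ?\<rho>" using c mrg by simp
  have "pfun (chal (Neg A)) (resp (Neg A)) (den ?\<rho> ?Z) (den ?\<rho> ?Z)"
    "pfun (chal (Neg A)) (resp A) (den ?\<rho> ?w) (den ?\<rho> ?w)"
    by (rule typedD(3)[where \<Gamma> = "pprod (chal ?F) ?\<Gamma>", OF _ \<rho>], unfold Neg_def chal_simps resp_simps,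
        (rule typed_intros typed_nil typed_cons)+)+
  note Z = this(1)[unfolded den.simps] and W = this(2)[unfolded den.simps]
  have q: "chal (Neg (Neg A)) (den ?\<rho> ?q) (den ?\<rho> ?q)"
    using Z by (simp add: Neg_def punI)
  obtain fs u where out: "ap Y (den ?\<rho> ?q) = Pair fs u" and fs: "plist (chal (Neg A)) fs fs"
    using pfunE(3)[OF Y q] unfolding Neg_def resp_simps by (elim pprodE) auto
  have ws: "plist (resp A) (vlist (map (ap (den ?\<rho> ?w)) (elems fs))) (vlist (map (ap (den ?\<rho> ?w)) (elems fs)))"
    using plistD[OF fs] pfunE(3)[OF W] by (intro plist_vlist) (simp add: list_all2_conv_all_nth)
  show "holds ?F \<rho> c (den ?\<rho> (EPair (EPair ?q (ENum 0)) (EVar 1 \<bullet> EMap ?w ?fs)))"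
    unfolding holds.simps(4)
  proof
    assume "\<forall>q\<in>set (elems (vfst (den ?\<rho> (EPair (EPair ?q (ENum 0)) (EVar 1 \<bullet> EMap ?w ?fs))))).
      holds (Neg (Neg A)) \<rho> q (ap (vfst c) q)"
    then have "holds (Neg (Neg A)) \<rho> (den ?\<rho> ?q) (Pair fs u)"
      using out by (simp add: c_eq)
    then obtain f where f: "f \<in> set (elems fs)" "holds A \<rho> v (ap (vfst f) v)"
      using map_clo[OF Z fs] by (auto simp: Neg_def c_eq)
    have "ap (den ?\<rho> ?w) f = ap (vfst f) v"
      using f(1) map_clo[OF W fs] by (simp add: c_eq)
    then have "ap (vfst f) v \<in> ap (den ?\<rho> ?w) ` set (elems fs)"
      using f(1) by (metis image_eqI)
    then have "holds A \<rho> v (ap (merge A) (vlist (map (ap (den ?\<rho> ?w)) (elems fs))))"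
      using f(2) by (intro holds_merge[OF ws, of "ap (vfst f) v"]) simp_all
    moreover have "den ?\<rho> (EVar 1 \<bullet> EMap ?w ?fs) =
        ap (merge A) (vlist (map (ap (den ?\<rho> ?w)) (elems fs)))"
      using out by (simp add: c_eq)
    ultimately show "holds A \<rho> (vsnd c) (vsnd (den ?\<rho> (EPair (EPair ?q (ENum 0)) (EVar 1 \<bullet> EMap ?w ?fs))))"
      by (simp only: den.simps(5) vsnd.simps c_eq)
  qed
qed

text \<open>Because quantifiers are uniform, the universal formula and its instance have the same
  challenges and responses, so passing them through unchanged is enough.\<close>

lemma valid_Inst:
  assumes "ty_of t = snd x" "wt t" "free_for t x A"
  shows "valid ((\<^bold>\<forall>x. A) \<^bold>\<longrightarrow> subf A x t)"
proof (rule validI)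
  let ?v = "ESnd (EVar 0)"
  show "pprod (chal ((\<^bold>\<forall>x. A) \<^bold>\<longrightarrow> subf A x t)) pun \<tturnstile>
      EPair (EPair ?v (ENum 0)) (EFst (EVar 0) \<bullet> ?v) : resp ((\<^bold>\<forall>x. A) \<^bold>\<longrightarrow> subf A x t)"
    unfolding chal_simps resp_simps chal_resp_subf[OF assms(1)]
    by (rule typed_intros typed_nil typed_cons)+
  show "pun (Num 0) (Num 0)" by (rule punI)
  show "holds ((\<^bold>\<forall>x. A) \<^bold>\<longrightarrow> subf A x t) \<rho> c
      (den (Pair c (Num 0)) (EPair (EPair ?v (ENum 0)) (EFst (EVar 0) \<bullet> ?v)))" if "env_ok \<rho>" for \<rho> c
    using tval_ok[OF that assms(2)] assms(1)
    by (simp add: holds_subf[OF assms(3,1)])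
qed

text \<open>Both sides have the same challenges and responses; only the environment differs, and
  \<open>A\<close> does not depend on \<open>x\<close>.\<close>

lemma valid_Distr:
  assumes "x \<notin> fvf A"
  shows "valid ((\<^bold>\<forall>x. A \<^bold>\<longrightarrow> B) \<^bold>\<longrightarrow> A \<^bold>\<longrightarrow> (\<^bold>\<forall>x. B))" (is "valid ?F")
proof (rule validI)
  let ?q = "ESnd (EVar 0)"
  show "pprod (chal ?F) pun \<tturnstile>
      EPair (EPair ?q (ENum 0)) (EFst (EVar 0) \<bullet> ?q) : resp ?F"
    unfolding chal_simps resp_simps by (rule typed_intros typed_nil typed_cons)+
  show "pun (Num 0) (Num 0)" by (rule punI)
  have "holds A (\<rho>(x := a)) c r = holds A \<rho> c r" for \<rho> a c r
    by (rule holds_cong) (use assms in auto)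
  then show "holds ?F \<rho> c (den (Pair c (Num 0)) (EPair (EPair ?q (ENum 0)) (EFst (EVar 0) \<bullet> ?q)))" for \<rho> c
    by simp
qed

text \<open>The realizer of \<open>A\<close> is itself a strategy to play against the realizer of
  the implication, and it passes every test listed there.\<close>

lemma valid_MP:
  assumes "valid (A \<^bold>\<longrightarrow> B)" "valid A"
  shows "valid B"
proof -
  from assms obtain d e where d: "realizes d (A \<^bold>\<longrightarrow> B)" and e: "realizes e A"
    unfolding valid_def by blast
  show ?thesis
  proof (rule validI)
    let ?\<Gamma> = "pprod (pfun (chal (A \<^bold>\<longrightarrow> B)) (resp (A \<^bold>\<longrightarrow> B))) (pprod (pfun (chal A) (resp A)) pun)"
    show "pprod (chal B) ?\<Gamma> \<tturnstile> ESnd (EVar 1 \<bullet> EPair (EVar 2) (EVar 0)) : resp B"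
      unfolding chal_simps resp_simps by (rule typed_intros)+
    show "?\<Gamma> (Pair d (Pair e (Num 0))) (Pair d (Pair e (Num 0)))"
      using d e by (simp add: realizes_def punI)
    fix \<rho> c
    assume \<rho>: "env_ok \<rho>" and c: "chal B c c"
    have ec: "chal (A \<^bold>\<longrightarrow> B) (Pair e c) (Pair e c)"
      using e c by (simp add: realizes_def)
    have "plist (chal A) (vfst (ap d (Pair e c))) (vfst (ap d (Pair e c)))"
      using d pfunE(3)[of "chal (A \<^bold>\<longrightarrow> B)" "resp (A \<^bold>\<longrightarrow> B)", OF _ ec]
      unfolding realizes_def resp_simps by (metis pprodE vfst.simps(2))
    then have "\<forall>q\<in>set (elems (vfst (ap d (Pair e c)))). holds A \<rho> q (ap e q)"
      using e \<rho> plist_mem unfolding realizes_def by blast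
    moreover have "holds (A \<^bold>\<longrightarrow> B) \<rho> (Pair e c) (ap d (Pair e c))"
      using d \<rho> ec unfolding realizes_def by blast
    ultimately show "holds B \<rho> c (den (Pair c (Pair d (Pair e (Num 0)))) (ESnd (EVar 1 \<bullet> EPair (EVar 2) (EVar 0))))"
      by (simp add: eval_nat_numeral)
  qed
qed

lemma valid_Gen: "valid A \<Longrightarrow> valid (\<^bold>\<forall>x. A)"
  unfolding valid_def realizes_def by auto

lemma valid_derives:
  assumes "T \<^bold>\<turnstile> A" "\<And>B. B \<in> T \<Longrightarrow> wff B \<Longrightarrow> valid B"
  shows "valid A"
  using assms(1)
  by induction (blast intro: assms(2) valid_P1 valid_P2 valid_P3 valid_Inst valid_Distr valid_Gen
      dest: valid_MP)+

section \<open>Truth of the arithmetical axioms\<close>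

lemma tr_connectives [simp]:
  "tr (Neg A) \<rho> \<longleftrightarrow> \<not> tr A \<rho>"
  "tr (A \<^bold>\<and> B) \<rho> \<longleftrightarrow> tr A \<rho> \<and> tr B \<rho>"
  "tr (A \<^bold>\<or> B) \<rho> \<longleftrightarrow> tr A \<rho> \<or> tr B \<rho>"
  "tr (\<^bold>\<exists>x. A) \<rho> \<longleftrightarrow> (\<exists>a. ty_per (snd x) a a \<and> tr A (\<rho>(x := a)))"
  by (auto simp: Neg_def And_def Or_def Ex_def)

lemma internal_connectives [simp]:
  "internal (Neg A) \<longleftrightarrow> internal A"
  "internal (A \<^bold>\<and> B) \<longleftrightarrow> internal A \<and> internal B"
  "internal (A \<^bold>\<or> B) \<longleftrightarrow> internal A \<and> internal B"
  "internal (\<^bold>\<exists>x. A) \<longleftrightarrow> internal A"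
  by (auto simp: Neg_def And_def Or_def Ex_def)

lemma wff_connectives [simp]:
  "wff (Neg A) \<longleftrightarrow> wff A"
  "wff (A \<^bold>\<and> B) \<longleftrightarrow> wff A \<and> wff B"
  "wff (A \<^bold>\<or> B) \<longleftrightarrow> wff A \<and> wff B"
  "wff (\<^bold>\<exists>x. A) \<longleftrightarrow> wff A"
  by (auto simp: Neg_def And_def Or_def Ex_def)

lemma fvf_connectives [simp]:
  "fvf (Neg A) = fvf A"
  "fvf (A \<^bold>\<and> B) = fvf A \<union> fvf B"
  "fvf (A \<^bold>\<or> B) = fvf A \<union> fvf B"
  "fvf (\<^bold>\<exists>x. A) = fvf A - {x}"
  by (auto simp: Neg_def And_def Or_def Ex_def)

lemma internal_subf [simp]: "internal (subf A x u) \<longleftrightarrow> internal A"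
  by (induction A) auto

lemma free_for_var: "fvt u \<subseteq> {x} \<Longrightarrow> free_for u x A"
  by (induction A) auto

section \<open>Computation rules for the closures of the constants\<close>

lemma ap_Clo_eq: "evals (Pair a \<rho>) b v \<Longrightarrow> ap (Clo b \<rho>) a = v"
  by (rule ap_eq, rule app_clo)

lemma ap_Succ [simp]: "ap (Clo (EPrim PSuc (EVar 0)) (Num 0)) a = Num (Suc (vnat a))"
proof (rule ap_Clo_eq)
  have "evals (Pair a (Num 0)) (EPrim PSuc (EVar 0)) (prim_ap PSuc (lookup (Pair a (Num 0)) 0))"
    by (intro ev_prim ev_var)
  then show "evals (Pair a (Num 0)) (EPrim PSuc (EVar 0)) (Num (Suc (vnat a)))" by simp
qed

lemma ap_lam_Clo: "ap (Clo (ELam b) \<rho>) a = Clo b (Pair a \<rho>)"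
  by (rule ap_Clo_eq, rule ev_lam)

lemma ap_K [simp]: "ap (ap (Clo (ELam (EVar (Suc 0))) (Num 0)) a) b = a"
  using ap_const_val[of a b] by (simp add: ap_lam_Clo const_val_def)

lemma ap_Prep [simp]: "ap (ap (Clo (ELam (EPair (EVar (Suc 0)) (EVar 0))) (Num 0)) a) b = Pair a b"
  unfolding ap_lam_Clo
proof (rule ap_Clo_eq)
  let ?\<rho> = "Pair b (Pair a (Num 0))"
  have "evals ?\<rho> (EPair (EVar (Suc 0)) (EVar 0)) (Pair (lookup ?\<rho> (Suc 0)) (lookup ?\<rho> 0))"
    by (intro ev_pair ev_var)
  then show "evals ?\<rho> (EPair (EVar (Suc 0)) (EVar 0)) (Pair a b)" by simp
qed

lemma ap_Rec [simp]: "ap (ap (Clo (ELam (ERec (EVar (Suc 0)) (EVar 0))) (Num 0)) a) b = RecV a b"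
  unfolding ap_lam_Clo
proof (rule ap_Clo_eq)
  let ?\<rho> = "Pair b (Pair a (Num 0))"
  have "evals ?\<rho> (ERec (EVar (Suc 0)) (EVar 0)) (RecV (lookup ?\<rho> (Suc 0)) (lookup ?\<rho> 0))"
    by (intro ev_rec ev_var)
  then show "evals ?\<rho> (ERec (EVar (Suc 0)) (EVar 0)) (RecV a b)" by simp
qed

text \<open>Unlike the other constants, \<open>CombS\<close> performs applications, so its equation
  needs arguments for which these are defined.\<close>

lemma ap_S:
  assumes x: "pfun P (pfun Q R) x x" and y: "pfun P Q y y" and z: "P z z"
  shows "ap (ap (ap (Clo (ELam (ELam (EVar 2 \<bullet> EVar 0 \<bullet> (EVar (Suc 0) \<bullet> EVar 0)))) (Num 0)) x) y) z =
    ap (ap x z) (ap y z)"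
proof -
  let ?b = "EVar 2 \<bullet> EVar 0 \<bullet> (EVar (Suc 0) \<bullet> EVar 0)"
  let ?\<rho> = "Pair y (Pair x (Num 0))"
  have "pprod P (pprod (pfun P Q) (pprod (pfun P (pfun Q R)) pun)) \<tturnstile> ?b : R"
    by (rule typed_app typed_vars)+
  from clo_pfun[OF this, of ?\<rho> ?\<rho>] have "pfun P R (Clo ?b ?\<rho>) (Clo ?b ?\<rho>)"
    using x y by (simp add: punI)
  from ap_clo[OF this z] show ?thesis
    by (simp add: ap_lam_Clo eval_nat_numeral)
qed

lemma ty_FunE:
  assumes "env_ok \<rho>" "wt s" "ty_of s = \<sigma> \<rightarrow> \<tau>"
  shows "pfun (ty_per \<sigma>) (ty_per \<tau>) (tval \<rho> s) (tval \<rho> s)"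
  using tval_ok[OF assms(1,2)] assms(3) by simp

lemma ty_BaseE:
  assumes "env_ok \<rho>" "wt s" "ty_of s = Base"
  obtains n where "tval \<rho> s = Num n"
  using tval_ok[OF assms(1,2)] assms(3) by (auto simp: pnat_def)

lemma tval_upd [simp]: "x \<notin> fvt t \<Longrightarrow> tval (\<rho>(x := a)) t = tval \<rho> t"
  by (rule tval_cong) auto

lemma plist_cases:
  assumes "plist P l l"
  obtains "l = Num 0" | a b where "l = Pair a b" "P a a" "plist P b b"
proof -
  obtain xs where xs: "l = vlist xs" using assms unfolding plist_def by auto
  show ?thesis
  proof (cases xs)
    case Nil
    with xs that(1) show ?thesis by simp
  next
    case (Cons a ys)
    with xs assms that(2)[of a "vlist ys"] show ?thesis by simp
  qed
qed

lemma tr_EPA: "A \<in> EPA \<Longrightarrow> wff A \<Longrightarrow> env_ok \<rho> \<Longrightarrow> tr A \<rho>"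
proof (induction rule: EPA.induct)
  case (refl t)
  then show ?case using tval_ok[of \<rho> t] by simp
next
  case (eucl r s t)
  then have "ty_of r = ty_of s" by simp
  moreover have "ty_per (ty_of s) (tval \<rho> s) (tval \<rho> t)"
    if "ty_per (ty_of s) (tval \<rho> r) (tval \<rho> s)" "ty_per (ty_of s) (tval \<rho> r) (tval \<rho> t)"
    using is_perD(2)[OF is_per_ty_per is_perD(1)[OF is_per_ty_per that(1)] that(2)] .
  ultimately show ?case by simp
next
  case (cong_fun f g t)
  then obtain \<tau> where "ty_of f = ty_of t \<rightarrow> \<tau>" "ty_of g = ty_of t \<rightarrow> \<tau>" "wt t" by auto
  with pfunE(3)[of "ty_per (ty_of t)" "ty_per \<tau>" "tval \<rho> f" "tval \<rho> g" "tval \<rho> t" "tval \<rho> t"]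
    tval_ok[OF \<open>env_ok \<rho>\<close> \<open>wt t\<close>]
  show ?case by simp
next
  case (extensionality s t f)
  then obtain \<tau> where f: "ty_of f = ty_of t \<rightarrow> \<tau>" "ty_of s = ty_of t" "wt f" by auto
  with pfunE(3)[OF ty_FunE[OF \<open>env_ok \<rho>\<close> f(3,1)], of "tval \<rho> s" "tval \<rho> t"] show ?case by simp
next
  case (fun_eq x f g)
  then obtain \<tau> where f: "ty_of f = snd x \<rightarrow> \<tau>" "ty_of g = snd x \<rightarrow> \<tau>" "wt f" "wt g" by auto
  have "ty_per (ty_of f) (tval \<rho> f) (tval \<rho> g)"
    if *: "\<And>a. ty_per (snd x) a a \<Longrightarrow> ty_per \<tau> (ap (tval \<rho> f) a) (ap (tval \<rho> g) a)"
    unfolding f(1) ty_per.simps pfun_def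
  proof (intro allI impI)
    fix a b assume ab: "ty_per (snd x) a b"
    note F = pfunE[OF ty_FunE[OF \<open>env_ok \<rho>\<close> f(3,1)] ab]
    note G = pfunE[OF ty_FunE[OF \<open>env_ok \<rho>\<close> f(4,2)] ab]
    \<comment> \<open>The hypothesis compares \<open>f\<close> and \<open>g\<close> at the same
      \<open>a\<close>; extensionality of \<open>g\<close> moves its argument from \<open>a\<close>
      to \<open>b\<close>.\<close>
    have "ty_per \<tau> (ap (tval \<rho> f) a) (ap (tval \<rho> g) b)"
      using is_perD(2)[OF is_per_ty_per *[OF is_perD(3)[OF is_per_ty_per ab]] G(3)] .
    with F(1) G(2) show "\<exists>u v. apps (tval \<rho> f) a u \<and> apps (tval \<rho> g) b v \<and> ty_per \<tau> u v"
      by blast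
  qed
  with fun_eq f show ?case by simp
next
  case (comb_K \<sigma> \<tau> s t)
  then show ?case using tval_ok[of \<rho> s] by fastforce
next
  case (comb_S \<rho>' \<sigma> \<tau> r s t)
  then have ty: "wt r" "wt s" "wt t" "ty_of r = \<rho>' \<rightarrow> \<sigma> \<rightarrow> \<tau>" "ty_of s = \<rho>' \<rightarrow> \<sigma>" "ty_of t = \<rho>'"
    "wt (r \<cdot> t \<cdot> (s \<cdot> t))" by auto
  from ap_S[of "ty_per \<rho>'" "ty_per \<sigma>" "ty_per \<tau>" "tval \<rho> r" "tval \<rho> s" "tval \<rho> t"]
  have "tval \<rho> (CombS \<rho>' \<sigma> \<tau> \<cdot> r \<cdot> s \<cdot> t) = tval \<rho> (r \<cdot> t \<cdot> (s \<cdot> t))"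
    using ty_FunE[OF comb_S(2) ty(1,4)] ty_FunE[OF comb_S(2) ty(2,5)] tval_ok[OF comb_S(2) ty(3)] ty(6)
    by simp
  with tval_ok[OF comb_S(2) ty(7)] ty(4-6) show ?case by simp
next
  case (succ_nonzero t)
  then show ?case by (simp add: pnat_def)
next
  case (succ_inj s t)
  then have "ty_of s = Base" "ty_of t = Base" "wt s" "wt t" by auto
  with succ_inj obtain m n where "tval \<rho> s = Num m" "tval \<rho> t = Num n"
    by (metis ty_BaseE)
  with \<open>ty_of s = Base\<close> show ?case by simp
next
  case (induction A n)
  have ty: "ty_of Zero = snd n" "ty_of (Succ \<cdot> Var n) = snd n"
    and ff: "free_for Zero n A" "free_for (Succ \<cdot> Var n) n A"
    using induction by (auto intro!: free_for_var)
  show ?case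
    unfolding tr_connectives tr.simps tr_subf[OF ff(1) ty(1)] tr_subf[OF ff(2) ty(2)]
  proof (intro impI allI)
    assume *: "tr A (\<rho>(n := tval \<rho> Zero)) \<and>
      (\<forall>a. ty_per (snd n) a a \<longrightarrow> tr A (\<rho>(n := a)) \<longrightarrow>
        tr A (\<rho>(n := a, n := tval (\<rho>(n := a)) (Succ \<cdot> Var n))))"
    \<comment> \<open>Values of type \<open>Base\<close> are exactly the numerals, so induction in
      the model is induction on \<open>nat\<close>.\<close>
    have "tr A (\<rho>(n := Num k))" for k
    proof (induction k)
      case (Suc k)
      with *[THEN conjunct2, rule_format, of "Num k"] show ?case
        using induction(2) by (simp del: fun_upd_apply add: fun_upd_same)
    qed (use * in \<open>simp del: fun_upd_apply\<close>)
    then show "tr A (\<rho>(n := a))" if "ty_per (snd n) a a" for a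
      using that induction(2) by (auto simp: pnat_def)
  qed
next
  case (rec_zero \<sigma> s f)
  then show ?case using tval_ok[of \<rho> s] by fastforce
next
  case (rec_succ \<sigma> s f t)
  then have ty: "wt s" "wt f" "wt t" "ty_of s = \<sigma>" "ty_of f = Base \<rightarrow> \<sigma> \<rightarrow> \<sigma>" "ty_of t = Base"
    "wt (f \<cdot> t \<cdot> (Rec \<sigma> \<cdot> s \<cdot> f \<cdot> t))" by auto
  obtain n where n: "tval \<rho> t = Num n" using ty_BaseE[OF rec_succ(2) ty(3,6)] .
  have "tval \<rho> (Rec \<sigma> \<cdot> s \<cdot> f \<cdot> (Succ \<cdot> t)) = tval \<rho> (f \<cdot> t \<cdot> (Rec \<sigma> \<cdot> s \<cdot> f \<cdot> t))"
    using ap_rec_Suc[of "ty_per \<sigma>" "tval \<rho> s" "tval \<rho> f" n] tval_ok[OF rec_succ(2) ty(1)]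
      ty_FunE[OF rec_succ(2) ty(2,5)] ty(4) n by simp
  with tval_ok[OF rec_succ(2) ty(7)] ty(4-6) show ?case by simp
next
  case (seq_cases a i \<sigma> q j s)
  then have s: "wt s" "ty_of s = SeqT \<sigma>" by auto
  then have "plist (ty_per \<sigma>) (tval \<rho> s) (tval \<rho> s)"
    using tval_ok[of \<rho> s] seq_cases by simp
  then show ?case
  proof (cases rule: plist_cases)
    case 1
    with s show ?thesis by simp
  next
    case (2 b l)
    have "a \<noteq> q" using seq_cases(1,2) by auto
    with 2 s seq_cases(1-4) have "tr (s \<^bold>= Prep \<sigma> \<cdot> Var a \<cdot> Var q) (\<rho>(a := b, q := l))"
      by simp
    moreover have "ty_per (snd a) b b" "ty_per (snd q) l l"
      using 2 seq_cases(1,2) by simp_all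
    ultimately have "tr (\<^bold>\<exists>a. \<^bold>\<exists>q. s \<^bold>= Prep \<sigma> \<cdot> Var a \<cdot> Var q) \<rho>"
      unfolding tr_connectives by blast
    then show ?thesis by simp
  qed
next
  case (srec_empty \<sigma> \<tau> s f)
  then show ?case using tval_ok[of \<rho> s] by fastforce
next
  case (srec_prep \<sigma> \<tau> s f t u)
  then have ty: "wt s" "wt f" "wt t" "wt u" "ty_of s = \<tau>" "ty_of f = \<sigma> \<rightarrow> SeqT \<sigma> \<rightarrow> \<tau> \<rightarrow> \<tau>"
    "ty_of t = \<sigma>" "ty_of u = SeqT \<sigma>" "wt (f \<cdot> t \<cdot> u \<cdot> (SRec \<sigma> \<tau> \<cdot> s \<cdot> f \<cdot> u))" by auto
  have "tval \<rho> (SRec \<sigma> \<tau> \<cdot> s \<cdot> f \<cdot> (Prep \<sigma> \<cdot> t \<cdot> u)) = tval \<rho> (f \<cdot> t \<cdot> u \<cdot> (SRec \<sigma> \<tau> \<cdot> s \<cdot> f \<cdot> u))"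
    using ap_rec_Pair[of "ty_per \<tau>" "tval \<rho> s" "ty_per \<sigma>" "tval \<rho> f" "tval \<rho> t" "tval \<rho> u"]
      tval_ok[OF srec_prep(2) ty(1)] ty_FunE[OF srec_prep(2) ty(2,6)] tval_ok[OF srec_prep(2) ty(3)]
      tval_ok[OF srec_prep(2) ty(4)] ty(5,7,8) by simp
  with tval_ok[OF srec_prep(2) ty(9)] ty(5-8) show ?case by simp
qed

lemma internal_EPA: "A \<in> EPA \<Longrightarrow> internal A"
  by (induction rule: EPA.induct) simp_all

lemma valid_EPA: "A \<in> EPA \<Longrightarrow> wff A \<Longrightarrow> valid A"
  by (rule valid_internal[OF internal_EPA tr_EPA])

section \<open>Defined terms\<close>

lemma wt_lam [simp]: "wt t \<Longrightarrow> wt (\<^bold>\<lambda>x. t)"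
  and ty_of_lam [simp]: "wt t \<Longrightarrow> ty_of (\<^bold>\<lambda>x. t) = snd x \<rightarrow> ty_of t"
  by (induction t) auto

text \<open>Induction on the term. The typing assumptions are inherited from \<open>ap_S\<close>,
  which the application and identity cases invoke.\<close>

lemma ap_lam [simp]:
  assumes "env_ok \<rho>" "ty_per (snd x) a a"
  shows "wt t \<Longrightarrow> ap (tval \<rho> (\<^bold>\<lambda>x. t)) a = tval (\<rho>(x := a)) t"
proof (induction t)
  case (App s t)
  then obtain \<tau> where ty: "wt s" "wt t" "ty_of s = ty_of t \<rightarrow> \<tau>" by auto
  have "pfun (ty_per (snd x)) (pfun (ty_per (ty_of t)) (ty_per \<tau>)) (tval \<rho> (\<^bold>\<lambda>x. s)) (tval \<rho> (\<^bold>\<lambda>x. s))"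
    "pfun (ty_per (snd x)) (ty_per (ty_of t)) (tval \<rho> (\<^bold>\<lambda>x. t)) (tval \<rho> (\<^bold>\<lambda>x. t))"
    using tval_ok[OF assms(1), of "\<^bold>\<lambda>x. s"] tval_ok[OF assms(1), of "\<^bold>\<lambda>x. t"] ty by simp_all
  from ap_S[OF this assms(2)] App.IH ty show ?case by simp
next
  case (Var y)
  let ?K = "\<lambda>\<sigma>. tval \<rho> (CombK (snd x) \<sigma>)" and ?\<sigma> = "snd x"
  have "pfun (ty_per ?\<sigma>) (pfun (ty_per (?\<sigma> \<rightarrow> ?\<sigma>)) (ty_per ?\<sigma>)) (?K (?\<sigma> \<rightarrow> ?\<sigma>)) (?K (?\<sigma> \<rightarrow> ?\<sigma>))"
    "pfun (ty_per ?\<sigma>) (ty_per (?\<sigma> \<rightarrow> ?\<sigma>)) (?K ?\<sigma>) (?K ?\<sigma>)"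
    using tval_ok[OF assms(1), of "CombK ?\<sigma> (?\<sigma> \<rightarrow> ?\<sigma>)"] tval_ok[OF assms(1), of "CombK ?\<sigma> ?\<sigma>"]
    by simp_all
  from ap_S[OF this assms(2)] show ?case by simp
qed auto

declare lam.simps [simp del]

lemma ap_lam2 [simp]:
  assumes "env_ok \<rho>" "ty_per (snd x) a a" "ty_per (snd y) b b" "wt t"
  shows "ap (ap (tval \<rho> (\<^bold>\<lambda>x. \<^bold>\<lambda>y. t)) a) b = tval (\<rho>(x := a, y := b)) t"
  using assms by (simp del: fun_upd_apply)

lemma ap_lam3 [simp]:
  assumes "env_ok \<rho>" "ty_per (snd x) a a" "ty_per (snd y) b b" "ty_per (snd z) c c" "wt t"
  shows "ap (ap (ap (tval \<rho> (\<^bold>\<lambda>x. \<^bold>\<lambda>y. \<^bold>\<lambda>z. t)) a) b) c = tval (\<rho>(x := a, y := b, z := c)) t"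
  using assms by (simp del: fun_upd_apply)

text \<open>Bundles type and value, so that compound terms are evaluated by composing rules.\<close>

definition has :: "(var \<Rightarrow> val) \<Rightarrow> tm \<Rightarrow> ty \<Rightarrow> val \<Rightarrow> bool" where
  "has \<rho> t \<sigma> v \<longleftrightarrow> wt t \<and> ty_of t = \<sigma> \<and> tval \<rho> t = v"

lemma hasI: "wt t \<Longrightarrow> ty_of t = \<sigma> \<Longrightarrow> tval \<rho> t = v \<Longrightarrow> has \<rho> t \<sigma> v"
  unfolding has_def by simp

lemma hasD: "has \<rho> t \<sigma> v \<Longrightarrow> wt t" "has \<rho> t \<sigma> v \<Longrightarrow> ty_of t = \<sigma>" "has \<rho> t \<sigma> v \<Longrightarrow> tval \<rho> t = v"
  unfolding has_def by simp_all

lemma has_ok: "env_ok \<rho> \<Longrightarrow> has \<rho> t \<sigma> v \<Longrightarrow> ty_per \<sigma> v v"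
  unfolding has_def using tval_ok by blast

lemma has_Var: "\<rho> x = v \<Longrightarrow> snd x = \<sigma> \<Longrightarrow> has \<rho> (Var x) \<sigma> v"
  by (simp add: has_def)

lemma has_app: "has \<rho> s (\<sigma> \<rightarrow> \<tau>) f \<Longrightarrow> has \<rho> t \<sigma> a \<Longrightarrow> has \<rho> (s \<cdot> t) \<tau> (ap f a)"
  by (simp add: has_def)

lemma has_Zero: "has \<rho> Zero Base (Num 0)"
  by (simp add: has_def)

lemma has_Succ: "has \<rho> t Base (Num n) \<Longrightarrow> has \<rho> (Succ \<cdot> t) Base (Num (Suc n))"
  by (simp add: has_def)

lemma has_Empty: "has \<rho> (Empty \<sigma>) (SeqT \<sigma>) (Num 0)"
  by (simp add: has_def)

text \<open>\<open>g\<close> is the expected sequence of values. The step equation is demanded only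
  at self-related values, where beta reduction applies; self-relatedness is carried along in the
  induction.\<close>

lemma has_rec:
  assumes \<rho>: "env_ok \<rho>" and s: "has \<rho> s \<sigma> (g 0)" and f: "wt f" "ty_of f = Base \<rightarrow> \<sigma> \<rightarrow> \<sigma>"
    and t: "has \<rho> t Base (Num n)"
    and step: "\<And>i. ty_per \<sigma> (g i) (g i) \<Longrightarrow> ap (ap (tval \<rho> f) (Num i)) (g i) = g (Suc i)"
  shows "has \<rho> (Rec \<sigma> \<cdot> s \<cdot> f \<cdot> t) \<sigma> (g n)"
proof (rule hasI)
  note F = ty_FunE[OF \<rho> f, unfolded ty_per.simps]
  have "ap (RecV (g 0) (tval \<rho> f)) (Num n) = g n \<and> ty_per \<sigma> (g n) (g n)"
  proof (induction n)
    case 0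
    show ?case using has_ok[OF \<rho> s] by simp
  next
    case (Suc n)
    then have eq: "ap (RecV (g 0) (tval \<rho> f)) (Num (Suc n)) = g (Suc n)"
      using ap_rec_Suc[of "ty_per \<sigma>", OF has_ok[OF \<rho> s] F] step by simp
    with pfunE(3)[OF recV_pfun_nat[of "ty_per \<sigma>", OF has_ok[OF \<rho> s] F], of "Num (Suc n)" "Num (Suc n)"]
    show ?case by simp
  qed
  then show "tval \<rho> (Rec \<sigma> \<cdot> s \<cdot> f \<cdot> t) = g n"
    using hasD[OF s] hasD[OF t] by simp
qed (use hasD[OF s] hasD[OF t] f in simp_all)

lemma has_srec:
  assumes \<rho>: "env_ok \<rho>" and s: "has \<rho> s \<tau> (g [])"
    and f: "wt f" "ty_of f = \<sigma> \<rightarrow> SeqT \<sigma> \<rightarrow> \<tau> \<rightarrow> \<tau>" and t: "has \<rho> t (SeqT \<sigma>) (vlist xs)"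
    and step: "\<And>x ys. ty_per \<sigma> x x \<Longrightarrow> ty_per (SeqT \<sigma>) (vlist ys) (vlist ys) \<Longrightarrow>
      ty_per \<tau> (g ys) (g ys) \<Longrightarrow> ap (ap (ap (tval \<rho> f) x) (vlist ys)) (g ys) = g (x # ys)"
  shows "has \<rho> (SRec \<sigma> \<tau> \<cdot> s \<cdot> f \<cdot> t) \<tau> (g xs)"
proof (rule hasI)
  note F = ty_FunE[OF \<rho> f, unfolded ty_per.simps]
  have "plist (ty_per \<sigma>) (vlist xs) (vlist xs)"
    using has_ok[OF \<rho> t] by simp
  then have "ap (RecV (g []) (tval \<rho> f)) (vlist xs) = g xs \<and> ty_per \<tau> (g xs) (g xs)"
  proof (induction xs)
    case Nil
    show ?case using has_ok[OF \<rho> s] by simp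
  next
    case (Cons x xs)
    then have xs: "ty_per \<sigma> x x" "plist (ty_per \<sigma>) (vlist xs) (vlist xs)" by simp_all
    with Cons.IH have eq: "ap (RecV (g []) (tval \<rho> f)) (vlist (x # xs)) = g (x # xs)"
      using ap_rec_Pair[of "ty_per \<tau>", OF has_ok[OF \<rho> s] F] step by simp
    with pfunE(3)[OF recV_pfun_list[of "ty_per \<tau>", OF has_ok[OF \<rho> s] F] Cons.prems]
    show ?case by simp
  qed
  then show "tval \<rho> (SRec \<sigma> \<tau> \<cdot> s \<cdot> f \<cdot> t) = g xs"
    using hasD[OF s] hasD[OF t] by simp
qed (use hasD[OF s] hasD[OF t] f in simp_all)

lemma has_plus:
  assumes "env_ok \<rho>" "has \<rho> s Base (Num m)" "has \<rho> t Base (Num n)"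
  shows "has \<rho> (plus_tm s t) Base (Num (m + n))"
  unfolding plus_tm_def Let_def
  by (rule has_rec[where g = "\<lambda>i. Num (m + i)"]) (use assms in simp_all)

lemma has_pred:
  assumes "env_ok \<rho>" "has \<rho> t Base (Num n)"
  shows "has \<rho> (pred_tm t) Base (Num (n - 1))"
  unfolding pred_tm_def Let_def
  by (rule has_rec[where g = "\<lambda>i. Num (i - 1)"]) (use assms in \<open>simp_all add: has_Zero\<close>)

lemma has_monus:
  assumes "env_ok \<rho>" "has \<rho> s Base (Num m)" "has \<rho> t Base (Num n)"
  shows "has \<rho> (monus_tm s t) Base (Num (m - n))"
  unfolding monus_tm_def Let_def
proof (rule has_rec[where g = "\<lambda>i. Num (m - i)"])
  let ?b = "pred_tm (Var (1, Base))"
  have b: "has \<rho>' ?b Base (Num (i - 1))" if "env_ok \<rho>'" "\<rho>' (1, Base) = Num i" for \<rho>' i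
    by (rule has_pred[OF that(1) has_Var]) (use that in simp_all)
  have wtb: "wt ?b" "ty_of ?b = Base"
    by (simp_all add: pred_tm_def Let_def)
  then show "wt (\<^bold>\<lambda>(0, Base). \<^bold>\<lambda>(1, Base). ?b)"
    "ty_of (\<^bold>\<lambda>(0, Base). \<^bold>\<lambda>(1, Base). ?b) = Base \<rightarrow> Base \<rightarrow> Base"
    by simp_all
  show "ap (ap (tval \<rho> (\<^bold>\<lambda>(0, Base). \<^bold>\<lambda>(1, Base). ?b)) (Num i)) (Num (m - i)) = Num (m - Suc i)" for i
    using assms(1) wtb hasD(3)[OF b, of "\<rho>((0, Base) := Num i, (1, Base) := Num (m - i))"] by simp
qed (use assms in simp_all)

lemma has_triangle:
  assumes "env_ok \<rho>" "has \<rho> t Base (Num n)"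
  shows "has \<rho> (triangle_tm t) Base (Num (\<Sum>{..n}))"
  unfolding triangle_tm_def Let_def
proof (rule has_rec[where g = "\<lambda>i. Num (\<Sum>{..i})"])
  let ?b = "plus_tm (Succ \<cdot> Var (0, Base)) (Var (1, Base))"
  have b: "has \<rho>' ?b Base (Num (Suc i + j))"
    if "env_ok \<rho>'" "\<rho>' (0, Base) = Num i" "\<rho>' (1, Base) = Num j" for \<rho>' i j
    by (rule has_plus[OF that(1) has_Succ[OF has_Var] has_Var]) (use that in simp_all)
  have wtb: "wt ?b" "ty_of ?b = Base"
    by (simp_all add: plus_tm_def Let_def)
  then show "wt (\<^bold>\<lambda>(0, Base). \<^bold>\<lambda>(1, Base). ?b)"
    "ty_of (\<^bold>\<lambda>(0, Base). \<^bold>\<lambda>(1, Base). ?b) = Base \<rightarrow> Base \<rightarrow> Base"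
    by simp_all
  show "ap (ap (tval \<rho> (\<^bold>\<lambda>(0, Base). \<^bold>\<lambda>(1, Base). ?b)) (Num i)) (Num (\<Sum>{..i})) = Num (\<Sum>{..Suc i})" for i
    using assms(1) wtb hasD(3)[OF b, of "\<rho>((0, Base) := Num i, (1, Base) := Num (\<Sum>{..i}))"] by simp
qed (use assms in \<open>simp_all add: has_Zero\<close>)

lemma has_pair:
  assumes "env_ok \<rho>" "has \<rho> s Base (Num m)" "has \<rho> t Base (Num n)"
  shows "has \<rho> (pair_tm s t) Base (Num (\<Sum>{..m + n} + n))"
  unfolding pair_tm_def by (intro has_plus has_triangle assms)

lemma has_code:
  assumes "env_ok \<rho>" "has \<rho> s (SeqT Base) (vlist xs)"
  shows "has \<rho> (code_tm s) Base (Num (seq_code (map vnat xs)))"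
  unfolding code_tm_def Let_def
proof (rule has_srec[where g = "\<lambda>ys. Num (seq_code (map vnat ys))"])
  let ?b = "Succ \<cdot> pair_tm (Var (0, Base)) (Var (1, Base))"
  have b: "has \<rho>' ?b Base (Num (Suc (\<Sum>{..m + n} + n)))"
    if "env_ok \<rho>'" "\<rho>' (0, Base) = Num m" "\<rho>' (1, Base) = Num n" for \<rho>' m n
    by (rule has_Succ[OF has_pair[OF that(1) has_Var has_Var]]) (use that in simp_all)
  have wtb: "wt ?b" "ty_of ?b = Base"
    by (simp_all add: pair_tm_def plus_tm_def triangle_tm_def Let_def)
  let ?f = "\<^bold>\<lambda>(0, Base). \<^bold>\<lambda>(0, SeqT Base). \<^bold>\<lambda>(1, Base). ?b"
  from wtb show "wt ?f" "ty_of ?f = Base \<rightarrow> SeqT Base \<rightarrow> Base \<rightarrow> Base"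
    by simp_all
  fix x ys
  let ?r = "Num (seq_code (map vnat ys))"
  assume "ty_per Base x x" "ty_per (SeqT Base) (vlist ys) (vlist ys)"
  then obtain m where "x = Num m" by (auto simp: pnat_def)
  with \<open>ty_per (SeqT Base) (vlist ys) (vlist ys)\<close>
  show "ap (ap (ap (tval \<rho> ?f) x) (vlist ys)) ?r = Num (seq_code (map vnat (x # ys)))"
    using assms(1) wtb
      hasD(3)[OF b, of "\<rho>((0, Base) := x, (0, SeqT Base) := vlist ys, (1, Base) := ?r)"]
    by simp
qed (use assms in \<open>simp_all add: has_Zero\<close>)

lemma has_length:
  assumes "env_ok \<rho>" "has \<rho> s (SeqT \<sigma>) (vlist xs)"
  shows "has \<rho> (length_tm \<sigma> s) Base (Num (length xs))"
  unfolding length_tm_def Let_def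
  by (rule has_srec[where g = "\<lambda>ys. Num (length ys)"]) (use assms in \<open>simp_all add: has_Zero\<close>)

lemma has_append:
  assumes "env_ok \<rho>" "has \<rho> s (SeqT \<sigma>) (vlist xs)" "has \<rho> t (SeqT \<sigma>) (vlist ys)"
  shows "has \<rho> (append_tm \<sigma> s t) (SeqT \<sigma>) (vlist (xs @ ys))"
  unfolding append_tm_def Let_def
  by (rule has_srec[where g = "\<lambda>zs. vlist (zs @ ys)"]) (use assms in simp_all)

lemma has_zero: "wt (zero_tm \<sigma>)" "ty_of (zero_tm \<sigma>) = \<sigma>"
  by (induction \<sigma>) simp_all

lemma has_initseg:
  assumes "env_ok \<rho>" "has \<rho> g (Base \<rightarrow> Base) f" "has \<rho> t Base (Num n)"
  shows "has \<rho> (initseg_tm g t) (SeqT Base) (vlist (map (\<lambda>i. Num (fn f i)) [0..<n]))"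
  unfolding initseg_tm_def Let_def
proof (rule has_rec[where g = "\<lambda>n. vlist (map (\<lambda>i. Num (fn f i)) [0..<n])"])
  let ?h = "(0, Base \<rightarrow> Base)" and ?k = "(0, Base)" and ?r = "(1, SeqT Base)"
  let ?b = "append_tm Base (Var ?r) (Prep Base \<cdot> (Var ?h \<cdot> Var ?k) \<cdot> Empty Base)"
  have wtb: "wt ?b" "ty_of ?b = SeqT Base"
    by (simp_all add: append_tm_def Let_def)
  then show "wt ((\<^bold>\<lambda>?h. \<^bold>\<lambda>?k. \<^bold>\<lambda>?r. ?b) \<cdot> g)"
    "ty_of ((\<^bold>\<lambda>?h. \<^bold>\<lambda>?k. \<^bold>\<lambda>?r. ?b) \<cdot> g) = Base \<rightarrow> SeqT Base \<rightarrow> SeqT Base"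
    using assms(2) by (simp_all add: has_def)
  have f: "pfun pnat pnat f f" using has_ok[OF assms(1,2)] by simp
  fix i
  let ?l = "\<lambda>i. vlist (map (\<lambda>i. Num (fn f i)) [0..<i])"
  assume l: "ty_per (SeqT Base) (?l i) (?l i)"
  let ?\<rho> = "\<rho>(?h := f, ?k := Num i, ?r := ?l i)"
  have ok: "env_ok ?\<rho>" using assms(1) f l by simp
  have "ap f (Num i) = Num (fn f i)"
    using pfunE(3)[OF f, of "Num i" "Num i"] by (auto simp: pnat_def fn_def)
  then have "has ?\<rho> (Prep Base \<cdot> (Var ?h \<cdot> Var ?k) \<cdot> Empty Base) (SeqT Base) (vlist [Num (fn f i)])"
    by (simp add: has_def)
  from hasD(3)[OF has_append[OF ok has_Var this, of ?r "map (\<lambda>i. Num (fn f i)) [0..<i]"]]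
  have "tval ?\<rho> ?b = ?l (Suc i)" by simp
  then show "ap (ap (tval \<rho> ((\<^bold>\<lambda>?h. \<^bold>\<lambda>?k. \<^bold>\<lambda>?r. ?b) \<cdot> g)) (Num i)) (?l i) = ?l (Suc i)"
    using ap_lam3[OF assms(1), of ?h f ?k "Num i" ?r "?l i" ?b] f l wtb hasD(3)[OF assms(2)]
    by (simp del: fun_upd_apply)
qed (use assms in \<open>simp_all add: has_Empty\<close>)

text \<open>Keeps apart variables of \<open>nth_tm\<close> that have equal numbers, such as
  \<open>(1, \<sigma>)\<close> and \<open>(1, Base \<rightarrow> \<sigma>)\<close>.\<close>

lemma ty_neq: "\<sigma> \<noteq> \<tau> \<rightarrow> \<sigma>" "\<sigma> \<noteq> SeqT \<sigma>"
  by (induction \<sigma> arbitrary: \<tau>) auto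

lemma has_nth:
  assumes "env_ok \<rho>" "has \<rho> s (SeqT \<sigma>) (vlist xs)" "has \<rho> t Base (Num i)" "i < length xs"
  shows "has \<rho> (nth_tm \<sigma> s t) \<sigma> (xs ! i)"
proof -
  let ?a = "(0, \<sigma>)" and ?q = "(0, SeqT \<sigma>)" and ?r = "(1, Base \<rightarrow> \<sigma>)"
    and ?k = "(0, Base)" and ?p = "(1, \<sigma>)"
  let ?L = "\<^bold>\<lambda>?k. \<^bold>\<lambda>?p. Var ?r \<cdot> Var ?k"
  let ?b = "Rec \<sigma> \<cdot> Var ?a \<cdot> ?L"
  let ?f = "\<^bold>\<lambda>?a. \<^bold>\<lambda>?q. \<^bold>\<lambda>?r. ?b"
  let ?env = "\<lambda>x ys g. \<rho>(?a := x, ?q := vlist ys, ?r := g)"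
  \<comment> \<open>The recursion builds index functions whose closures depend on the environment.
    \<open>g\<close> records these values literally, and that they return the entries is proved
    separately.\<close>
  define g where "g = rec_list (tval \<rho> (zero_tm (Base \<rightarrow> \<sigma>)))
    (\<lambda>x ys g. RecV x (tval (?env x ys g) ?L))"
  have g_simps: "g [] = tval \<rho> (zero_tm (Base \<rightarrow> \<sigma>))"
    "g (x # ys) = RecV x (tval (?env x ys (g ys)) ?L)" for x ys
    by (simp_all add: g_def)
  have L: "wt ?L" "ty_of ?L = Base \<rightarrow> \<sigma> \<rightarrow> \<sigma>"
    by simp_all
  have "ty_per (Base \<rightarrow> \<sigma>) (g ys) (g ys) \<and> (\<forall>j<length ys. ap (g ys) (Num j) = ys ! j)"
    if "plist (ty_per \<sigma>) (vlist ys) (vlist ys)" for ys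
    using that
  proof (induction ys)
    case Nil
    show ?case
      using tval_ok[OF assms(1) has_zero(1)[of "Base \<rightarrow> \<sigma>"]] has_zero(2)[of "Base \<rightarrow> \<sigma>"]
      by (simp add: g_simps del: zero_tm.simps)
  next
    case (Cons x ys)
    then have x: "ty_per \<sigma> x x" and ys: "plist (ty_per \<sigma>) (vlist ys) (vlist ys)"
      and IH: "pfun pnat (ty_per \<sigma>) (g ys) (g ys)" "\<And>j. j < length ys \<Longrightarrow> ap (g ys) (Num j) = ys ! j"
      by simp_all
    let ?\<rho> = "?env x ys (g ys)"
    have ok: "env_ok ?\<rho>"
      using assms(1) x ys IH(1) by simp
    note F = ty_FunE[OF ok L, unfolded ty_per.simps]
    have rec: "pfun pnat (ty_per \<sigma>) (RecV x (tval ?\<rho> ?L)) (RecV x (tval ?\<rho> ?L))"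
      by (rule recV_pfun_nat[of "ty_per \<sigma>", OF x F])
    have "ap (RecV x (tval ?\<rho> ?L)) (Num (Suc j)) = ap (g ys) (Num j)" for j
    proof -
      let ?v = "ap (RecV x (tval ?\<rho> ?L)) (Num j)"
      have v: "ty_per (snd ?p) ?v ?v"
        using pfunE(3)[OF rec, of "Num j" "Num j"] by simp
      have "ap (RecV x (tval ?\<rho> ?L)) (Num (Suc j)) = ap (ap (tval ?\<rho> ?L) (Num j)) ?v"
        by (rule ap_rec_Suc[of "ty_per \<sigma>", OF x F])
      also have "\<dots> = tval (?\<rho>(?k := Num j, ?p := ?v)) (Var ?r \<cdot> Var ?k)"
        by (rule ap_lam2[OF ok _ v]) simp_all
      finally show ?thesis
        using ty_neq by simp
    qed
    with rec IH(2) show ?case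
      by (auto simp: g_simps nth_Cons split: nat.split)
  qed
  then have g: "\<And>j. j < length xs \<Longrightarrow> ap (g xs) (Num j) = xs ! j"
    using has_ok[OF assms(1,2)] by simp
  have "has \<rho> (SRec \<sigma> (Base \<rightarrow> \<sigma>) \<cdot> zero_tm (Base \<rightarrow> \<sigma>) \<cdot> ?f \<cdot> s) (Base \<rightarrow> \<sigma>) (g xs)"
  proof (rule has_srec[OF assms(1) _ _ _ assms(2)])
    show "has \<rho> (zero_tm (Base \<rightarrow> \<sigma>)) (Base \<rightarrow> \<sigma>) (g [])"
      by (rule hasI[OF has_zero]) (simp add: g_simps)
    show "wt ?f" "ty_of ?f = \<sigma> \<rightarrow> SeqT \<sigma> \<rightarrow> (Base \<rightarrow> \<sigma>) \<rightarrow> Base \<rightarrow> \<sigma>"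
      by simp_all
    fix x ys
    assume *: "ty_per \<sigma> x x" "ty_per (SeqT \<sigma>) (vlist ys) (vlist ys)" "ty_per (Base \<rightarrow> \<sigma>) (g ys) (g ys)"
    have "ap (ap (ap (tval \<rho> ?f) x) (vlist ys)) (g ys) = tval (?env x ys (g ys)) ?b"
      by (rule ap_lam3[OF assms(1)]) (use * in simp_all)
    also have "\<dots> = g (x # ys)"
      using ty_neq by (simp add: g_simps)
    finally show "ap (ap (ap (tval \<rho> ?f) x) (vlist ys)) (g ys) = g (x # ys)" .
  qed
  from has_app[OF this assms(3)] show ?thesis
    unfolding nth_tm_def Let_def g[OF assms(4)] .
qed

lemma tr_Leq:
  assumes "env_ok \<rho>" "has \<rho> s Base (Num m)" "has \<rho> t Base (Num n)"
  shows "tr (s \<^bold>\<le> t) \<rho> \<longleftrightarrow> m \<le> n"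
  using hasD[OF has_monus[OF assms]] by (simp add: Leq_def)

lemma finite_fvt: "finite (fvt t)"
  by (induction t) simp_all

lemma ex_fresh:
  fixes X :: "var set"
  assumes "finite X"
  shows "\<exists>n. (n, \<sigma>) \<notin> X"
proof (rule ccontr)
  assume "\<nexists>n. (n, \<sigma>) \<notin> X"
  then have "UNIV \<subseteq> fst ` X" by force
  then have "finite (UNIV :: nat set)"
    using assms by (meson finite_imageI finite_subset)
  then show False by simp
qed

lemma tr_Mem:
  assumes \<rho>: "env_ok \<rho>" and t: "has \<rho> t \<sigma> a" and s: "has \<rho> s (SeqT \<sigma>) l"
  shows "tr (t \<^bold>\<in> s) \<rho> \<longleftrightarrow> (\<exists>e\<in>set (elems l). ty_per \<sigma> a e)"
proof -
  define i where "i = (LEAST n. (n, Base) \<notin> fvt t \<union> fvt s, Base)"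
  have i: "i \<notin> fvt t" "i \<notin> fvt s" "snd i = Base"
    using LeastI_ex[OF ex_fresh[of "fvt t \<union> fvt s" Base]] finite_fvt unfolding i_def by auto
  have l: "l = vlist (elems l)"
    using has_ok[OF \<rho> s] by (simp add: plist_elems)
  have *: "tr (Succ \<cdot> Var i \<^bold>\<le> length_tm \<sigma> s \<^bold>\<and> t \<^bold>= nth_tm \<sigma> s (Var i)) (\<rho>(i := Num j)) \<longleftrightarrow>
      j < length (elems l) \<and> ty_per \<sigma> a (elems l ! j)" for j
  proof -
    let ?\<rho> = "\<rho>(i := Num j)"
    have ok: "env_ok ?\<rho>" using \<rho> i(3) by simp
    have s': "has ?\<rho> s (SeqT \<sigma>) (vlist (elems l))" and t': "has ?\<rho> t \<sigma> a"
      using s t i(1,2) l by (simp_all add: has_def)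
    have j: "has ?\<rho> (Var i) Base (Num j)"
      by (rule has_Var) (simp_all add: i(3))
    have "tr (Succ \<cdot> Var i \<^bold>\<le> length_tm \<sigma> s) ?\<rho> \<longleftrightarrow> j < length (elems l)"
      using tr_Leq[OF ok has_Succ[OF j] has_length[OF ok s']] by auto
    moreover have "tr (t \<^bold>= nth_tm \<sigma> s (Var i)) ?\<rho> \<longleftrightarrow> ty_per \<sigma> a (elems l ! j)"
      if "j < length (elems l)"
      using hasD[OF has_nth[OF ok s' j that]] hasD[OF t'] by simp
    ultimately show ?thesis by auto
  qed
  have "tr (t \<^bold>\<in> s) \<rho> \<longleftrightarrow> (\<exists>j. j < length (elems l) \<and> ty_per \<sigma> a (elems l ! j))"
    unfolding Mem_def Let_def i_def[symmetric] hasD(2)[OF t] tr_connectives(4) i(3)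
    using * by (auto simp: pnat_def simp del: tr_connectives fun_upd_apply)
  then show ?thesis
    by (metis in_set_conv_nth)
qed

lemma internal_Mem [simp]: "internal (t \<^bold>\<in> s)"
  by (simp add: Mem_def Leq_def Let_def)

section \<open>Natural deduction\<close>

text \<open>Validity is closed under the Hilbert rules, so purely logical steps need no explicit
  realizers. The order of hypotheses makes discharging the last one a mere unfolding.\<close>

definition entails :: "fm list \<Rightarrow> fm \<Rightarrow> bool" (infix "\<Turnstile>" 50) where
  "\<Gamma> \<Turnstile> A \<longleftrightarrow> valid (foldr (\<^bold>\<longrightarrow>) \<Gamma> A)"

lemma valid_weaken: "valid B \<Longrightarrow> valid (A \<^bold>\<longrightarrow> B)"
  by (rule valid_MP[OF valid_P1])

lemma valid_P2_MP: "valid (A \<^bold>\<longrightarrow> B \<^bold>\<longrightarrow> C) \<Longrightarrow> valid (A \<^bold>\<longrightarrow> B) \<Longrightarrow> valid (A \<^bold>\<longrightarrow> C)"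
  by (rule valid_MP[OF valid_MP[OF valid_P2]])

lemma valid_trans: "valid (A \<^bold>\<longrightarrow> B) \<Longrightarrow> valid (B \<^bold>\<longrightarrow> C) \<Longrightarrow> valid (A \<^bold>\<longrightarrow> C)"
  by (rule valid_P2_MP[OF valid_weaken])

lemma valid_id: "valid (A \<^bold>\<longrightarrow> A)"
  by (rule valid_P2_MP[OF valid_P1[of A "A \<^bold>\<longrightarrow> A"] valid_P1])

lemma entails_mp:
  assumes "\<Gamma> \<Turnstile> A \<^bold>\<longrightarrow> B" "\<Gamma> \<Turnstile> A"
  shows "\<Gamma> \<Turnstile> B"
proof -
  have "valid (foldr (\<^bold>\<longrightarrow>) \<Gamma> (A \<^bold>\<longrightarrow> B) \<^bold>\<longrightarrow> foldr (\<^bold>\<longrightarrow>) \<Gamma> A \<^bold>\<longrightarrow> foldr (\<^bold>\<longrightarrow>) \<Gamma> B)"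
  proof (induction \<Gamma>)
    case Nil
    show ?case by (simp add: valid_id)
  next
    case (Cons C \<Gamma>)
    show ?case
      unfolding foldr.simps comp_def
      by (rule valid_trans[OF valid_MP[OF valid_P2 valid_weaken[OF Cons.IH]] valid_P2])
  qed
  from valid_MP[OF valid_MP[OF this]] assms show ?thesis
    unfolding entails_def by blast
qed

lemma entails_valid: "valid A \<Longrightarrow> \<Gamma> \<Turnstile> A"
  unfolding entails_def by (induction \<Gamma>) (simp_all add: valid_weaken)

lemma entails_hyp: "A \<in> set \<Gamma> \<Longrightarrow> \<Gamma> \<Turnstile> A"
proof (induction \<Gamma>)
  case (Cons C \<Gamma>)
  have "valid (C \<^bold>\<longrightarrow> foldr (\<^bold>\<longrightarrow>) \<Gamma> C)" for \<Gamma>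
    by (induction \<Gamma>) (simp_all add: valid_id valid_trans[OF _ valid_P1])
  with Cons show ?case
    unfolding entails_def by (auto simp: valid_weaken)
qed simp

lemma entails_imp: "\<Gamma> @ [A] \<Turnstile> B \<Longrightarrow> \<Gamma> \<Turnstile> A \<^bold>\<longrightarrow> B"
  unfolding entails_def by simp

lemma entails_neg: "\<Gamma> @ [A] \<Turnstile> Falsum \<Longrightarrow> \<Gamma> \<Turnstile> Neg A"
  unfolding Neg_def by (rule entails_imp)

lemma entails_negE: "\<Gamma> \<Turnstile> Neg A \<Longrightarrow> \<Gamma> \<Turnstile> A \<Longrightarrow> \<Gamma> \<Turnstile> Falsum"
  unfolding Neg_def by (rule entails_mp)

lemma entails_ccontr: "\<Gamma> @ [Neg A] \<Turnstile> Falsum \<Longrightarrow> \<Gamma> \<Turnstile> A"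
  by (rule entails_mp[OF entails_valid[OF valid_P3] entails_neg])

lemma entails_gen:
  assumes "\<Gamma> \<Turnstile> A" "x \<notin> \<Union> (fvf ` set \<Gamma>)"
  shows "\<Gamma> \<Turnstile> (\<^bold>\<forall>x. A)"
proof -
  have "valid ((\<^bold>\<forall>x. foldr (\<^bold>\<longrightarrow>) \<Gamma> A) \<^bold>\<longrightarrow> foldr (\<^bold>\<longrightarrow>) \<Gamma> (\<^bold>\<forall>x. A))"
    using assms(2)
  proof (induction \<Gamma>)
    case Nil
    show ?case by (simp add: valid_id)
  next
    case (Cons C \<Gamma>)
    then have C: "x \<notin> fvf C" and IH: "valid ((\<^bold>\<forall>x. foldr (\<^bold>\<longrightarrow>) \<Gamma> A) \<^bold>\<longrightarrow> foldr (\<^bold>\<longrightarrow>) \<Gamma> (\<^bold>\<forall>x. A))"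
      by simp_all
    show ?case
      unfolding foldr.simps comp_def
      by (rule valid_trans[OF valid_Distr[OF C] valid_MP[OF valid_P2 valid_weaken[OF IH]]])
  qed
  from valid_MP[OF this valid_Gen] assms(1) show ?thesis
    unfolding entails_def .
qed

lemma subt_var_id: "subt t x (Var x) = t"
  by (induction t) simp_all

lemma subf_var_id: "subf A x (Var x) = A"
  by (induction A) (simp_all add: subt_var_id)

lemma entails_inst:
  assumes "\<Gamma> \<Turnstile> (\<^bold>\<forall>x. A)"
  shows "\<Gamma> \<Turnstile> A"
proof -
  have "valid ((\<^bold>\<forall>x. A) \<^bold>\<longrightarrow> subf A x (Var x))"
    by (rule valid_Inst) (simp_all add: free_for_var)
  then show ?thesis
    using entails_mp[OF entails_valid assms] by (simp add: subf_var_id)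
qed

lemma entails_andE:
  assumes "\<Gamma> \<Turnstile> A \<^bold>\<and> B"
  shows "\<Gamma> \<Turnstile> A" "\<Gamma> \<Turnstile> B"
proof -
  have "[A \<^bold>\<and> B] \<Turnstile> A"
  proof (rule entails_ccontr, rule entails_negE)
    show "[A \<^bold>\<and> B] @ [Neg A] \<Turnstile> Neg (A \<^bold>\<longrightarrow> Neg B)"
      by (rule entails_hyp) (simp add: And_def)
    show "[A \<^bold>\<and> B] @ [Neg A] \<Turnstile> A \<^bold>\<longrightarrow> Neg B"
      by (rule entails_imp, rule entails_neg, rule entails_negE[of _ A]; rule entails_hyp) simp_all
  qed
  moreover have "[A \<^bold>\<and> B] \<Turnstile> B"
  proof (rule entails_ccontr, rule entails_negE)
    show "[A \<^bold>\<and> B] @ [Neg B] \<Turnstile> Neg (A \<^bold>\<longrightarrow> Neg B)"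
      by (rule entails_hyp) (simp add: And_def)
    show "[A \<^bold>\<and> B] @ [Neg B] \<Turnstile> A \<^bold>\<longrightarrow> Neg B"
      by (rule entails_imp, rule entails_hyp) simp
  qed
  ultimately have "valid (A \<^bold>\<and> B \<^bold>\<longrightarrow> A)" "valid (A \<^bold>\<and> B \<^bold>\<longrightarrow> B)"
    by (simp_all add: entails_def)
  then show "\<Gamma> \<Turnstile> A" "\<Gamma> \<Turnstile> B"
    by (auto intro: entails_mp[OF entails_valid assms])
qed

lemma entails_andI:
  assumes "\<Gamma> \<Turnstile> A" "\<Gamma> \<Turnstile> B"
  shows "\<Gamma> \<Turnstile> A \<^bold>\<and> B"
proof -
  have "[A, B] \<Turnstile> A \<^bold>\<and> B"
    unfolding And_def
  proof (rule entails_neg, rule entails_negE)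
    show "[A, B] @ [A \<^bold>\<longrightarrow> Neg B] \<Turnstile> Neg B"
      by (rule entails_mp[of _ A]; rule entails_hyp) simp_all
  qed (rule entails_hyp, simp)
  then have "valid (A \<^bold>\<longrightarrow> B \<^bold>\<longrightarrow> A \<^bold>\<and> B)"
    by (simp add: entails_def)
  from entails_mp[OF entails_mp[OF entails_valid[OF this] assms(1)] assms(2)] show ?thesis .
qed

lemma valid_uncurry:
  assumes "valid (A \<^bold>\<longrightarrow> B \<^bold>\<longrightarrow> C)"
  shows "valid (A \<^bold>\<and> B \<^bold>\<longrightarrow> C)"
proof -
  have "[A \<^bold>\<and> B] \<Turnstile> A \<^bold>\<and> B" by (rule entails_hyp) simp
  from entails_mp[OF entails_mp[OF entails_valid[OF assms] entails_andE(1)[OF this]] entails_andE(2)[OF this]]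
  show ?thesis by (simp add: entails_def)
qed

text \<open>The primitive \<open>ExSt\<close> contains an encoded conjunction, whose challenges are
  unwieldy. This lemma and its converse allow realizers to be built for the form with two
  negations.\<close>

lemma valid_ExStI: "valid (Neg (\<^bold>\<forall>\<^sup>s\<^sup>t y. Neg A) \<^bold>\<longrightarrow> (\<^bold>\<exists>\<^sup>s\<^sup>t y. A))"
proof -
  let ?N = "Neg (\<^bold>\<forall>y. St (Var y) \<^bold>\<longrightarrow> Neg A)" and ?K = "\<^bold>\<forall>y. Neg (St (Var y) \<^bold>\<and> A)"
  have "[?N] \<Turnstile> Neg ?K"
  proof (rule entails_neg, rule entails_negE)
    show "[?N] @ [?K] \<Turnstile> ?N" by (rule entails_hyp) simp
    show "[?N] @ [?K] \<Turnstile> (\<^bold>\<forall>y. St (Var y) \<^bold>\<longrightarrow> Neg A)"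
    proof (rule entails_gen[OF entails_imp[OF entails_neg]])
      let ?\<Gamma> = "(([?N] @ [?K]) @ [St (Var y)]) @ [A]"
      have "?\<Gamma> \<Turnstile> ?K" "?\<Gamma> \<Turnstile> St (Var y)" "?\<Gamma> \<Turnstile> A"
        by (rule entails_hyp, simp)+
      then show "?\<Gamma> \<Turnstile> Falsum"
        by (rule entails_negE[OF entails_inst entails_andI])
    qed auto
  qed
  then show ?thesis
    by (simp add: entails_def AllSt_def ExSt_def Ex_def)
qed

lemma valid_ExStE: "valid ((\<^bold>\<exists>\<^sup>s\<^sup>t y. A) \<^bold>\<longrightarrow> Neg (\<^bold>\<forall>\<^sup>s\<^sup>t y. Neg A))"
proof -
  let ?N = "\<^bold>\<forall>y. St (Var y) \<^bold>\<longrightarrow> Neg A" and ?K = "Neg (\<^bold>\<forall>y. Neg (St (Var y) \<^bold>\<and> A))"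
  have "[?K] \<Turnstile> Neg ?N"
  proof (rule entails_neg, rule entails_negE)
    show "[?K] @ [?N] \<Turnstile> ?K" by (rule entails_hyp) simp
    show "[?K] @ [?N] \<Turnstile> (\<^bold>\<forall>y. Neg (St (Var y) \<^bold>\<and> A))"
    proof (rule entails_gen[OF entails_neg])
      let ?\<Gamma> = "([?K] @ [?N]) @ [St (Var y) \<^bold>\<and> A]"
      have *: "?\<Gamma> \<Turnstile> ?N" "?\<Gamma> \<Turnstile> St (Var y) \<^bold>\<and> A"
        by (rule entails_hyp, simp)+
      show "?\<Gamma> \<Turnstile> Falsum"
        by (rule entails_negE[OF entails_mp[OF entails_inst[OF *(1)] entails_andE(1)[OF *(2)]]
              entails_andE(2)[OF *(2)]])
    qed auto
  qed
  then show ?thesis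
    by (simp add: entails_def AllSt_def ExSt_def Ex_def)
qed

lemma valid_AllSt_mono:
  assumes "valid (A \<^bold>\<longrightarrow> B)"
  shows "valid ((\<^bold>\<forall>\<^sup>s\<^sup>t x. A) \<^bold>\<longrightarrow> (\<^bold>\<forall>\<^sup>s\<^sup>t x. B))"
proof -
  let ?\<Gamma> = "[\<^bold>\<forall>x. St (Var x) \<^bold>\<longrightarrow> A]"
  have "?\<Gamma> \<Turnstile> (\<^bold>\<forall>x. St (Var x) \<^bold>\<longrightarrow> B)"
  proof (rule entails_gen[OF entails_imp])
    have "?\<Gamma> @ [St (Var x)] \<Turnstile> (\<^bold>\<forall>x. St (Var x) \<^bold>\<longrightarrow> A)" "?\<Gamma> @ [St (Var x)] \<Turnstile> St (Var x)"
      by (rule entails_hyp, simp)+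
    from entails_mp[OF entails_valid[OF assms] entails_mp[OF entails_inst[OF this(1)] this(2)]]
    show "?\<Gamma> @ [St (Var x)] \<Turnstile> B" .
  qed simp
  then show ?thesis
    by (simp add: entails_def AllSt_def)
qed

section \<open>Standardness\<close>

lemma env_exists: "\<exists>\<rho>. env_ok \<rho>"
proof -
  have "\<exists>v. ty_per \<sigma> v v" for \<sigma>
  proof (induction \<sigma>)
    case Base
    show ?case by (rule exI[of _ "Num 0"]) simp
  next
    case (Fun \<sigma> \<tau>)
    then show ?case using const_val_pfun by fastforce
  next
    case (SeqT \<sigma>)
    show ?case by (rule exI[of _ "Num 0"]) simp
  qed
  then obtain z where z: "\<And>\<sigma>. ty_per \<sigma> (z \<sigma>) (z \<sigma>)" by metis
  then have "env_ok (\<lambda>x. z (snd x))" by (simp add: env_rel_def)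
  then show ?thesis by (intro exI)
qed

text \<open>The candidates for \<open>s\<close> serve unchanged for \<open>t\<close>.\<close>

lemma valid_st_eq:
  assumes "ty_of s = ty_of t"
  shows "valid (St s \<^bold>\<longrightarrow> s \<^bold>= t \<^bold>\<longrightarrow> St t)" (is "valid ?F")
proof (rule validI)
  let ?b = "EPair (EPair (ENum 0) (ENum 0)) (EPair (EPair (ENum 0) (ENum 0)) (EFst (EVar 0) \<bullet> ENum 0))"
  show "pprod (chal ?F) pun \<tturnstile> ?b : resp ?F"
    unfolding chal_simps resp_simps assms by (rule typed_intros typed_nil typed_cons)+
  show "pun (Num 0) (Num 0)" by (rule punI)
  show "holds ?F \<rho> c (den (Pair c (Num 0)) ?b)" for \<rho> c
    using is_perD(2)[OF is_per_ty_per[of "ty_of t"]] assms by auto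
qed

text \<open>The value of a closed term does not depend on the environment, so it can be the sole
  candidate.\<close>

lemma valid_st_closed:
  assumes "wt t" "fvt t = {}"
  shows "valid (St t)"
proof -
  obtain \<rho>0 where \<rho>0: "env_ok \<rho>0" using env_exists by blast
  have "ty_per (ty_of t) (tval \<rho>0 t) (tval \<rho> t)" for \<rho>
    using tval_ok[OF \<rho>0 assms(1)] tval_cong[of t \<rho> \<rho>0] assms(2) by simp
  then have "realizes (const_val (vlist [tval \<rho>0 t])) (St t)"
    by (auto simp: realizes_def intro!: const_val_pfun)
  then show ?thesis
    unfolding valid_def by blast
qed

text \<open>Every candidate function is applied to every candidate argument; the correct pair is
  among these combinations.\<close>

lemma valid_st_app:
  assumes "ty_of f = ty_of t \<rightarrow> \<tau>"
  shows "valid (St f \<^bold>\<longrightarrow> St t \<^bold>\<longrightarrow> St (f \<cdot> t))" (is "valid ?F")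
proof (rule validI)
  let ?fs = "EFst (EVar 0) \<bullet> ENum 0" and ?ts = "\<lambda>i. EFst (ESnd (EVar i)) \<bullet> ENum 0"
  let ?w = "ELam (EMap (EVar 0) (?ts 1))"
  let ?b = "EPair (EPair (ENum 0) (ENum 0)) (EPair (EPair (ENum 0) (ENum 0))
    (EPrim PConcat (EMap ?w ?fs)))"
  have ty: "ty_per (ty_of f) = pfun (ty_per (ty_of t)) (ty_per (ty_of (f \<cdot> t)))"
    using assms by simp
  show "pprod (chal ?F) pun \<tturnstile> ?b : resp ?F"
    unfolding chal_simps resp_simps ty by (rule typed_intros typed_nil typed_cons)+
  show pun: "pun (Num 0) (Num 0)" by (rule punI)
  fix \<rho> c
  assume c: "chal ?F c c"
  then obtain Y Z v where c_eq: "c = Pair Y (Pair Z v)" and Y: "pfun pun (plist (ty_per (ty_of f))) Y Y"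
    and Z: "pfun pun (plist (ty_per (ty_of t))) Z Z"
    unfolding chal_simps resp_simps by (elim pprodE) auto
  let ?\<rho> = "Pair c (Num 0)"
  have \<rho>: "pprod (chal ?F) pun ?\<rho> ?\<rho>" using c pun by simp
  have w: "pfun (ty_per (ty_of f)) (plist (ty_per (ty_of (f \<cdot> t)))) (den ?\<rho> ?w) (den ?\<rho> ?w)"
    by (rule typedD(3)[where \<Gamma> = "pprod (chal ?F) pun", OF _ \<rho>],
        unfold chal_simps resp_simps ty, (rule typed_intros)+)
  have fs: "plist (ty_per (ty_of f)) (ap Y (Num 0)) (ap Y (Num 0))"
    by (rule pfunE(3)[OF Y punI])
  have ts: "plist (ty_per (ty_of t)) (ap Z (Num 0)) (ap Z (Num 0))"
    by (rule pfunE(3)[OF Z punI])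
  have "ty_per (ty_of (f \<cdot> t)) (ap g a) (tval \<rho> (f \<cdot> t))"
    if "ty_per (ty_of f) g (tval \<rho> f)" "ty_per (ty_of t) a (tval \<rho> t)" for g a
    using pfunE(3)[OF that(1)[unfolded ty] that(2)] by simp
  then show "holds ?F \<rho> c (den ?\<rho> ?b)"
    using map_clo[OF w[unfolded den.simps] fs] by (simp add: c_eq) blast
qed

text \<open>External induction enters as a rule, whose realizer iterates the one of the induction step.\<close>

lemma valid_st_induct:
  assumes n: "snd n = Base" and zero: "valid (subf B n Zero)"
    and step: "valid (St (Var n) \<^bold>\<longrightarrow> B \<^bold>\<longrightarrow> subf B n (Succ \<cdot> Var n))"
  shows "valid (\<^bold>\<forall>\<^sup>s\<^sup>t n. B)"
proof -
  let ?C = "chal B" and ?R = "resp B" and ?S = "St (Var n) \<^bold>\<longrightarrow> B \<^bold>\<longrightarrow> subf B n (Succ \<cdot> Var n)"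
  have ty: "ty_of Zero = snd n" "ty_of (Succ \<cdot> Var n) = snd n"
    and ff: "free_for Zero n B" "free_for (Succ \<cdot> Var n) n B"
    using n by (auto intro!: free_for_var)
  from zero obtain d0 where "realizes d0 (subf B n Zero)"
    unfolding valid_def by blast
  then have d0: "pfun ?C ?R d0 d0"
    "\<And>\<rho> c. env_ok \<rho> \<Longrightarrow> ?C c c \<Longrightarrow> holds B (\<rho>(n := Num 0)) c (ap d0 c)"
    using holds_subf[OF ff(1) ty(1)] ty by (auto simp: realizes_def simp del: fun_upd_apply)
  from step obtain e where "realizes e ?S"
    unfolding valid_def by blast
  then have e: "pfun (chal ?S) (resp ?S) e e"
    "\<And>\<rho> c. env_ok \<rho> \<Longrightarrow> chal ?S c c \<Longrightarrow> holds ?S \<rho> c (ap e c)"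
    unfolding realizes_def by blast+
  have chal_S: "chal ?S = pprod (pfun pun (plist pnat)) (pprod (pfun ?C ?R) ?C)"
    and resp_S: "resp ?S = pprod (plist pun) (pprod (plist ?C) ?R)"
    using ty n by simp_all
  \<comment> \<open>In the environment \<open>c\<close>, realizer at \<open>k\<close>,
    \<open>k\<close>, \<open>e\<close>, this challenge to the induction step offers \<open>k\<close>
    as the only candidate for \<open>n\<close> (index 3 under the binder), then the realizer at
    \<open>k\<close>, then \<open>c\<close>.\<close>
  let ?q = "EPair (ELam (EPair (EVar 3) (ENum 0))) (EPair (EVar 1) (EVar 0))"
  let ?b = "ESnd (ESnd (EVar 3 \<bullet> ?q))"
  define f where "f = Clo (ELam (ELam ?b)) (Pair e (Num 0))"
  have e1: "pprod (pfun (chal ?S) (resp ?S)) pun (Pair e (Num 0)) (Pair e (Num 0))"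
    using e(1) by (simp add: punI)
  have typed_b: "pprod ?C (pprod (pfun ?C ?R) (pprod pnat (pprod (pfun (chal ?S) (resp ?S)) pun))) \<tturnstile> ?b : ?R"
    unfolding chal_S resp_S by (rule typed_intros typed_nil typed_cons)+
  have f: "pfun pnat (pfun (pfun ?C ?R) (pfun ?C ?R)) f f"
    unfolding f_def by (rule clo_pfun[OF typed_lam[OF typed_lam[OF typed_b]] e1])
  let ?d = "RecV d0 f"
  have d: "pfun pnat (pfun ?C ?R) ?d ?d"
    by (rule recV_pfun_nat[of "pfun ?C ?R", OF d0(1) f])
  have dk: "pfun ?C ?R (ap ?d (Num k)) (ap ?d (Num k))" for k
    using pfunE(3)[OF d, of "Num k" "Num k"] by simp
  have ap_d: "ap (ap ?d (Num (Suc k))) c =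
      vsnd (vsnd (ap e (Pair (Clo (EPair (EVar 3) (ENum 0)) (Pair c (Pair (ap ?d (Num k)) (Pair (Num k) (Pair e (Num 0))))))
        (Pair (ap ?d (Num k)) c))))"
    if c: "?C c c" for k c
  proof -
    have "ap ?d (Num (Suc k)) = ap (ap f (Num k)) (ap ?d (Num k))"
      by (rule ap_rec_Suc[of "pfun ?C ?R", OF d0(1) f])
    also have "\<dots> = Clo ?b (Pair (ap ?d (Num k)) (Pair (Num k) (Pair e (Num 0))))" (is "_ = ?cl")
      by (simp only: f_def ap_lam_Clo)
    finally have eq: "ap ?d (Num (Suc k)) = ?cl" .
    show ?thesis
      unfolding eq using ap_clo[OF dk[of "Suc k", unfolded eq] c]
      by (simp add: eval_nat_numeral)
  qed
  have holds_d: "holds B (\<rho>(n := Num k)) c (ap (ap ?d (Num k)) c)"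
    if \<rho>: "env_ok \<rho>" and c: "?C c c" for \<rho> k c
    using c
  proof (induction k arbitrary: c)
    case 0
    then show ?case using d0(2)[OF \<rho>] by (simp del: fun_upd_apply)
  next
    case (Suc k)
    let ?dk = "ap ?d (Num k)"
    let ?env = "Pair c (Pair ?dk (Pair (Num k) (Pair e (Num 0))))"
    let ?K = "Clo (EPair (EVar 3) (ENum 0)) ?env"
    let ?\<Gamma> = "pprod ?C (pprod (pfun ?C ?R) (pprod pnat (pprod (pfun (chal ?S) (resp ?S)) pun)))"
    have env: "?\<Gamma> ?env ?env"
      using Suc.prems dk[of k] e1 by simp
    have K: "pfun pun (plist pnat) ?K ?K"
      by (rule clo_pfun[where \<Gamma> = ?\<Gamma>, OF _ env]) (rule typed_cons typed_vars typed_nil)+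
    have apK: "ap ?K v = vlist [Num k]" for v
      using ap_clo[OF K punI[of v v]] by (simp add: eval_nat_numeral)
    let ?c = "Pair ?K (Pair ?dk c)"
    have cc: "chal ?S ?c ?c"
      unfolding chal_S using K dk[of k] Suc.prems by simp
    have ok: "env_ok (\<rho>(n := Num k))"
      using \<rho> n by simp
    have "plist ?C (vfst (vsnd (ap e ?c))) (vfst (vsnd (ap e ?c)))"
      using pfunE(3)[OF e(1) cc] unfolding resp_S by (elim pprodE) auto
    then have "\<forall>q\<in>set (elems (vfst (vsnd (ap e ?c)))). holds B (\<rho>(n := Num k)) q (ap ?dk q)"
      using Suc.IH plist_mem by blast
    with e(2)[OF ok cc] have "holds (subf B n (Succ \<cdot> Var n)) (\<rho>(n := Num k)) c (vsnd (vsnd (ap e ?c)))"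
      using n apK by (simp del: fun_upd_apply add: fun_upd_same)
    then show ?case
      unfolding ap_d[OF Suc.prems] holds_subf[OF ff(2) ty(2)] by (simp del: fun_upd_apply add: fun_upd_same)
  qed
  let ?\<Gamma> = "pprod (pfun pnat (pfun ?C ?R)) (pprod (pfun (plist ?R) ?R) pun)"
  let ?\<rho>0 = "Pair ?d (Pair (merge B) (Num 0))"
  \<comment> \<open>The premise \<open>St\<close> supplies only candidates for \<open>n\<close>: the
    iterated realizer is run at each of them and the answers are merged.\<close>
  let ?w = "ELam (EVar 2 \<bullet> EVar 0 \<bullet> ESnd (EVar 1))"
  let ?p = "EPair (EPair (ENum 0) (ENum 0)) (EVar 2 \<bullet> EMap ?w (EFst (EVar 0) \<bullet> ENum 0))"
  have chal_F: "chal (St (Var n) \<^bold>\<longrightarrow> B) = pprod (pfun pun (plist pnat)) ?C"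
    and resp_F: "resp (St (Var n) \<^bold>\<longrightarrow> B) = pprod (plist pun) ?R"
    using n by simp_all
  have "valid (St (Var n) \<^bold>\<longrightarrow> B)"
  proof (rule validI)
    show "pprod (chal (St (Var n) \<^bold>\<longrightarrow> B)) ?\<Gamma> \<tturnstile> ?p : resp (St (Var n) \<^bold>\<longrightarrow> B)"
      unfolding chal_F resp_F by (rule typed_intros typed_nil typed_cons)+
    show \<rho>0: "?\<Gamma> ?\<rho>0 ?\<rho>0"
      using d merge_pfun by (simp add: punI)
    fix \<rho> c
    assume \<rho>: "env_ok \<rho>" and c: "chal (St (Var n) \<^bold>\<longrightarrow> B) c c"
    then obtain Y v where c_eq: "c = Pair Y v" and Y: "pfun pun (plist pnat) Y Y" and v: "?C v v"
      unfolding chal_F by (elim pprodE) auto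
    let ?\<rho> = "Pair c ?\<rho>0"
    have ok: "pprod (chal (St (Var n) \<^bold>\<longrightarrow> B)) ?\<Gamma> ?\<rho> ?\<rho>"
      using c \<rho>0 by simp
    have "pfun pnat ?R (den ?\<rho> ?w) (den ?\<rho> ?w)"
      by (rule typedD(3)[where \<Gamma> = "pprod (chal (St (Var n) \<^bold>\<longrightarrow> B)) ?\<Gamma>", OF _ ok],
          unfold chal_F, (rule typed_intros)+)
    note w = this[unfolded den.simps]
    have ks: "plist pnat (ap Y (Num 0)) (ap Y (Num 0))"
      by (rule pfunE(3)[OF Y punI])
    let ?W = "\<lambda>k. ap (ap ?d k) v"
    have W: "map (ap (den ?\<rho> ?w)) (elems (ap Y (Num 0))) = map ?W (elems (ap Y (Num 0)))"
      using map_clo[OF w ks] by (simp add: c_eq eval_nat_numeral)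
    have ws: "plist ?R (vlist (map ?W (elems (ap Y (Num 0))))) (vlist (map ?W (elems (ap Y (Num 0)))))"
      unfolding W[symmetric]
      using plistD[OF ks] pfunE(3)[OF w] by (intro plist_vlist) (simp add: list_all2_conv_all_nth)
    have "holds B \<rho> v (ap (merge B) (vlist (map ?W (elems (ap Y (Num 0))))))"
      if x: "x \<in> set (elems (ap Y (Num 0)))" "pnat x (\<rho> n)" for x
    proof -
      obtain k where k: "x = Num k" "\<rho> n = Num k" using x(2) by (auto simp: pnat_def)
      have "\<rho>(n := Num k) = \<rho>" using k(2) by auto
      with holds_d[OF \<rho> v, of k] have "holds B \<rho> v (?W x)" by (simp add: k(1))
      then show ?thesis
        using x(1) by (intro holds_merge[OF ws, of "?W x"]) simp_all
    qed
    moreover have eq: "den ?\<rho> ?p = Pair (Pair (Num 0) (Num 0))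
        (ap (merge B) (vlist (map (ap (den ?\<rho> ?w)) (elems (ap Y (Num 0))))))"
      by (simp add: c_eq eval_nat_numeral)
    ultimately show "holds (St (Var n) \<^bold>\<longrightarrow> B) \<rho> c (den ?\<rho> ?p)"
      unfolding eq W using n by (auto simp: c_eq)
  qed
  then show ?thesis
    unfolding AllSt_def by (rule valid_Gen)
qed

section \<open>External induction, idealisation and choice\<close>

lemma fvt_subt: "fvt (subt t x u) \<subseteq> (fvt t - {x}) \<union> fvt u"
  by (induction t) auto

lemma fvf_subf_closed: "fvt u = {} \<Longrightarrow> x \<notin> fvf (subf A x u)"
proof (induction A)
  case (Eq s t)
  then show ?case using fvt_subt[of s x u] fvt_subt[of t x u] by auto
next
  case (St t)
  then show ?case using fvt_subt[of t x u] by auto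
qed auto

text \<open>The induction rule is applied to the formula with both hypotheses as premises. Neither
  contains \<open>n\<close> free, so substitution touches only \<open>A\<close>.\<close>

lemma valid_external_induction:
  assumes "snd n = Base"
  shows "valid (subf A n Zero \<^bold>\<and> (\<^bold>\<forall>\<^sup>s\<^sup>t n. A \<^bold>\<longrightarrow> subf A n (Succ \<cdot> Var n)) \<^bold>\<longrightarrow> (\<^bold>\<forall>\<^sup>s\<^sup>t n. A))"
proof (rule valid_uncurry)
  let ?A0 = "subf A n Zero" and ?A1 = "subf A n (Succ \<cdot> Var n)"
  let ?S = "\<^bold>\<forall>\<^sup>s\<^sup>t n. A \<^bold>\<longrightarrow> ?A1"
  let ?B = "?A0 \<^bold>\<longrightarrow> ?S \<^bold>\<longrightarrow> A"
  have n: "n \<notin> fvf ?A0" "n \<notin> fvf ?S"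
    by (simp_all add: fvf_subf_closed AllSt_def)
  have sub: "subf ?B n u = (?A0 \<^bold>\<longrightarrow> ?S \<^bold>\<longrightarrow> subf A n u)" for u
    using n by (simp add: subf_id del: fvf.simps)
  have "valid (\<^bold>\<forall>\<^sup>s\<^sup>t n. ?B)"
  proof (rule valid_st_induct[OF assms])
    show "valid (subf ?B n Zero)"
      unfolding sub by (rule valid_P1)
    let ?\<Gamma> = "[St (Var n), ?B, ?A0, ?S]"
    have hyp: "?\<Gamma> \<Turnstile> (\<^bold>\<forall>n. St (Var n) \<^bold>\<longrightarrow> A \<^bold>\<longrightarrow> ?A1)" "?\<Gamma> \<Turnstile> St (Var n)" "?\<Gamma> \<Turnstile> ?B" "?\<Gamma> \<Turnstile> ?A0" "?\<Gamma> \<Turnstile> ?S"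
      by (rule entails_hyp, simp add: AllSt_def)+
    have "?\<Gamma> \<Turnstile> ?A1"
      by (rule entails_mp[OF entails_mp[OF entails_inst[OF hyp(1)] hyp(2)]
            entails_mp[OF entails_mp[OF hyp(3,4)] hyp(5)]])
    then show "valid (St (Var n) \<^bold>\<longrightarrow> ?B \<^bold>\<longrightarrow> subf ?B n (Succ \<cdot> Var n))"
      unfolding sub by (simp add: entails_def)
  qed
  then have B: "valid (\<^bold>\<forall>n. St (Var n) \<^bold>\<longrightarrow> ?B)"
    by (simp add: AllSt_def)
  have "[?A0, ?S] \<Turnstile> (\<^bold>\<forall>n. St (Var n) \<^bold>\<longrightarrow> A)"
  proof (rule entails_gen[OF entails_imp])
    let ?\<Gamma> = "[?A0, ?S] @ [St (Var n)]"
    have hyp: "?\<Gamma> \<Turnstile> ?A0" "?\<Gamma> \<Turnstile> ?S" "?\<Gamma> \<Turnstile> St (Var n)"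
      by (rule entails_hyp, simp)+
    show "?\<Gamma> \<Turnstile> A"
      by (rule entails_mp[OF entails_mp[OF entails_mp[OF entails_inst[OF entails_valid[OF B]] hyp(3)] hyp(1)] hyp(2)])
  qed (use n in simp)
  then show "valid (?A0 \<^bold>\<longrightarrow> ?S \<^bold>\<longrightarrow> (\<^bold>\<forall>\<^sup>s\<^sup>t n. A))"
    by (simp add: entails_def AllSt_def)
qed

text \<open>Such thunks arise from \<open>ELam (ELam (EVar 1)) \<bullet> t\<close>, which evaluates
  \<open>t\<close> once and stores the result; they turn a list of candidates into a strategy for
  \<open>St\<close>.\<close>

lemma ap_thunk [simp]: "ap (Clo (EVar (Suc 0)) (Pair v \<rho>)) a = v"
proof (rule ap_Clo_eq)
  have "evals (Pair a (Pair v \<rho>)) (EVar (Suc 0)) (lookup (Pair a (Pair v \<rho>)) (Suc 0))"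
    by (rule ev_var)
  then show "evals (Pair a (Pair v \<rho>)) (EVar (Suc 0)) v" by simp
qed

text \<open>The strategy against the conclusion asks about finitely many candidates \<open>z\<close>
  only. Joined into one list, they are offered as the standard \<open>x\<close> in the premise, and
  the resulting \<open>y\<close> survives all these questions. It need not be computed, as
  quantifiers are uniform.\<close>

lemma valid_idealisation:
  assumes A: "internal A" and x: "x = (i, SeqT \<sigma>)" and y: "y = (j, \<tau>)" and z: "z = (k, \<sigma>)"
    and dist: "distinct [x, y, z]" and fv: "x \<notin> fvf A"
  shows "valid ((\<^bold>\<forall>\<^sup>s\<^sup>t x. \<^bold>\<exists>y. \<^bold>\<forall>z. Var z \<^bold>\<in> Var x \<^bold>\<longrightarrow> A) \<^bold>\<longrightarrow> (\<^bold>\<exists>y. \<^bold>\<forall>\<^sup>s\<^sup>t z. A))"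
proof -
  let ?E = "\<^bold>\<exists>y. \<^bold>\<forall>z. Var z \<^bold>\<in> Var x \<^bold>\<longrightarrow> A"
  let ?P = "\<^bold>\<forall>x. St (Var x) \<^bold>\<longrightarrow> ?E"
  let ?S = "\<^bold>\<forall>z. St (Var z) \<^bold>\<longrightarrow> A"
  let ?N = "\<^bold>\<forall>y. Neg ?S"
  let ?F = "?P \<^bold>\<longrightarrow> Neg ?N"
  let ?s = "ty_per \<sigma>"
  have chal_S: "chal ?S = pprod (pfun pun (plist ?s)) (chal A)"
    and resp_S: "resp ?S = pprod (plist pun) (resp A)"
    and chal_N: "chal ?N = pprod (pfun (chal ?S) (resp ?S)) pun"
    and resp_N: "resp ?N = pprod (plist (chal ?S)) pun"
    and chal_P: "chal ?P = pprod (pfun pun (plist (plist ?s))) (chal ?E)"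
    and resp_P: "resp ?P = pprod (plist pun) (resp ?E)"
    and chal_F: "chal ?F = pprod (pfun (chal ?P) (resp ?P)) (pprod (pfun (chal ?N) (resp ?N)) pun)"
    and resp_F: "resp ?F = pprod (plist (chal ?P)) (pprod (plist (chal ?N)) pun)"
    by (simp_all add: Neg_def x z)
  \<comment> \<open>A constant strategy for \<open>?S\<close>: it asks for the candidates by the
    dummy challenge \<open>Num 0\<close> and gives the canonical response to the internal
    \<open>A\<close>.\<close>
  define K where "K = const_val (Pair (vlist [Num 0]) (crv A))"
  define q where "q = Pair K (Num 0)"
  have K: "pfun (chal ?S) (resp ?S) K K"
    unfolding K_def resp_S by (rule const_val_pfun) (simp add: punI)
  have q: "chal ?N q q"
    unfolding chal_N q_def using K by (simp add: punI)
  let ?\<Gamma> = "pprod (chal ?N) (pprod (chal ?E) pun)"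
  let ?\<rho>0 = "Pair q (Pair (cev ?E) (Num 0))"
  let ?zs = "EPrim PConcat (EMap (ELam (EFst (EVar 0) \<bullet> ENum 0)) (EFst (EFst (ESnd (EVar 0)) \<bullet> EVar 1)))"
  let ?T = "ELam (ELam (EVar 1)) \<bullet> EPair ?zs (ENum 0)"
  let ?p = "EPair (EPair (EPair ?T (EVar 2)) (ENum 0)) (EPair (EPair (EVar 1) (ENum 0)) (ENum 0))"
  have "valid ?F"
  proof (rule validI)
    show "pprod (chal ?F) ?\<Gamma> \<tturnstile> ?p : resp ?F"
      unfolding chal_F resp_F chal_P resp_P chal_N resp_N chal_S resp_S
      by (rule typed_intros typed_nil typed_cons)+
    show \<rho>0: "?\<Gamma> ?\<rho>0 ?\<rho>0"
      using q by (simp add: punI del: chal_simps)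
    fix \<rho> c
    assume \<rho>: "env_ok \<rho>" and c: "chal ?F c c"
    obtain Y Z u where c_eq: "c = Pair Y (Pair Z u)" and Z: "pfun (chal ?N) (resp ?N) Z Z"
      using c unfolding chal_F by (elim pprodE) auto
    let ?\<rho> = "Pair c ?\<rho>0"
    have ok: "pprod (chal ?F) ?\<Gamma> ?\<rho> ?\<rho>" using c \<rho>0 by simp
    define ss where "ss = vfst (ap Z q)"
    have ss: "plist (chal ?S) ss ss"
      using pfunE(3)[OF Z q] unfolding resp_N ss_def by (elim pprodE) auto
    have L: "pfun (chal ?S) (plist ?s) (den ?\<rho> (ELam (EFst (EVar 0) \<bullet> ENum 0))) (den ?\<rho> (ELam (EFst (EVar 0) \<bullet> ENum 0)))"
      by (rule typedD(3)[where \<Gamma> = "pprod (chal ?F) ?\<Gamma>", OF _ ok], unfold chal_S, (rule typed_intros)+)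
    \<comment> \<open>All candidates for \<open>z\<close> in the tests that the opponent puts to
      \<open>K\<close>.\<close>
    define zs where "zs = vlist (concat (map (\<lambda>s. elems (ap (vfst s) (Num 0))) (elems ss)))"
    have den_zs: "den ?\<rho> ?zs = zs"
      using map_clo[OF L[unfolded den.simps] ss] by (simp add: c_eq zs_def ss_def comp_def cong: map_cong)
    have zs: "plist ?s zs zs"
    proof -
      have "plist ?s (den ?\<rho> ?zs) (den ?\<rho> ?zs)"
        by (rule typedD(3)[where \<Gamma> = "pprod (chal ?F) ?\<Gamma>", OF _ ok],
            unfold chal_F chal_P resp_P chal_N resp_N chal_S resp_S, (rule typed_intros)+)
      then show ?thesis by (simp only: den_zs)
    qed
    let ?t = "Clo (EVar 1) (Pair (vlist [zs]) ?\<rho>)"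
    have den_p: "den ?\<rho> ?p = Pair (vlist [Pair ?t (cev ?E)]) (Pair (vlist [q]) (Num 0))"
      using den_zs by (simp add: ap_lam_Clo eval_nat_numeral del: den.simps(6,8))
    show "holds ?F \<rho> c (den ?\<rho> ?p)"
      unfolding den_p holds.simps(4)
    proof
      assume "\<forall>r\<in>set (elems (vfst (Pair (vlist [Pair ?t (cev ?E)]) (Pair (vlist [q]) (Num 0))))).
        holds ?P \<rho> r (ap (vfst c) r)"
      then have "holds ?P \<rho> (Pair ?t (cev ?E)) (ap Y (Pair ?t (cev ?E)))"
        by (simp add: c_eq)
      then have "holds (St (Var x) \<^bold>\<longrightarrow> ?E) (\<rho>(x := zs)) (Pair ?t (cev ?E)) (ap Y (Pair ?t (cev ?E)))"
        unfolding holds.simps(5) using zs x by simp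
      then have "holds ?E (\<rho>(x := zs)) (cev ?E) (vsnd (ap Y (Pair ?t (cev ?E))))"
        using zs x by (simp del: holds.simps(5))
      then have "tr ?E (\<rho>(x := zs))"
        by (rule holds_internal(2)[rotated]) (simp add: A)
      then obtain b where b: "ty_per \<tau> b b"
        and tr: "\<And>a. ?s a a \<Longrightarrow> tr (Var z \<^bold>\<in> Var x) (\<rho>(x := zs, y := b, z := a)) \<Longrightarrow> tr A (\<rho>(x := zs, y := b, z := a))"
        by (auto simp: y z)
      have trA: "tr A (\<rho>(y := b, z := a))" if a: "?s a a" "e \<in> set (elems zs)" "?s e a" for a e
      proof -
        let ?e = "\<rho>(x := zs, y := b, z := a)"
        have ok': "env_ok ?e" using \<rho> zs b a(1) x y z by simp
        have "has ?e (Var z) \<sigma> a" "has ?e (Var x) (SeqT \<sigma>) zs"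
          using dist x y z by (auto simp: has_def)
        from tr_Mem[OF ok' this] have "tr (Var z \<^bold>\<in> Var x) ?e"
          using a(2) is_perD(1)[OF is_per_ty_per a(3)] by blast
        from tr[OF a(1) this] have "tr A ?e" .
        then show ?thesis
          by (rule tr_cong[THEN iffD1, rotated]) (use fv in auto)
      qed
      \<comment> \<open>At the witness \<open>b\<close>, \<open>A\<close> is true for every
        \<open>z\<close> equal to a candidate, so \<open>K\<close> passes all tests and
        \<open>Neg ?S\<close> fails.\<close>
      have "\<not> holds ?N \<rho> q (ap Z q)"
      proof
        assume "holds ?N \<rho> q (ap Z q)"
        then have "holds (Neg ?S) (\<rho>(y := b)) q (ap Z q)"
          unfolding holds.simps(5) using b y by simp
        then obtain s where s: "s \<in> set (elems ss)" "\<not> holds ?S (\<rho>(y := b)) s (ap K s)"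
          by (auto simp: Neg_def ss_def q_def simp del: holds.simps(5))
        then obtain a where a: "?s a a" "\<not> holds (St (Var z) \<^bold>\<longrightarrow> A) (\<rho>(y := b, z := a)) s (ap K s)"
          unfolding holds.simps(5) using z by auto
        then obtain e where "e \<in> set (elems (ap (vfst s) (Num 0)))" "?s e a"
          and A: "\<not> holds A (\<rho>(y := b, z := a)) (vsnd s) (crv A)"
          using z by (auto simp: K_def)
        then have "tr A (\<rho>(y := b, z := a))"
          using s(1) by (intro trA[OF a(1)]) (auto simp: zs_def)
        with A holds_internal(1)[OF assms(1)] show False by blast
      qed
      then show "holds (Neg ?N) \<rho> (vsnd c) (vsnd (Pair (vlist [Pair ?t (cev ?E)]) (Pair (vlist [q]) (Num 0))))"
        unfolding Neg_def[of ?N] holds.simps(4) by (simp add: c_eq del: holds.simps(5))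
    qed
  qed
  then show ?thesis
    by (simp add: AllSt_def Ex_def)
qed

text \<open>\<open>F\<close> is read off from the strategy for the premise: at \<open>a\<close> it
  lists all candidates for \<open>y\<close> that the strategy produces when \<open>a\<close> is the
  sole candidate for \<open>x\<close>. The strategy against the conclusion, confronted with this
  \<open>F\<close>, names finitely many \<open>x\<close>, and the premise is tested at exactly
  those.\<close>

lemma valid_HAC_core:
  assumes A: "internal A" and x: "x = (i, \<sigma>)" and y: "y = (j, \<tau>)" and F: "F = (k, \<sigma> \<rightarrow> SeqT \<tau>)"
    and dist: "distinct [x, y, F]" and fv: "F \<notin> fvf A"
  shows "valid ((\<^bold>\<forall>\<^sup>s\<^sup>t x. Neg (\<^bold>\<forall>\<^sup>s\<^sup>t y. Neg A)) \<^bold>\<longrightarrow>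
    Neg (\<^bold>\<forall>\<^sup>s\<^sup>t F. Neg (\<^bold>\<forall>\<^sup>s\<^sup>t x. \<^bold>\<exists>y. Var y \<^bold>\<in> Var F \<cdot> Var x \<^bold>\<and> A)))"
proof -
  let ?s = "ty_per \<sigma>" and ?t = "ty_per \<tau>"
  let ?E = "\<^bold>\<exists>y. Var y \<^bold>\<in> Var F \<cdot> Var x \<^bold>\<and> A"
  let ?M = "\<^bold>\<forall>y. St (Var y) \<^bold>\<longrightarrow> Neg A"
  let ?P = "\<^bold>\<forall>x. St (Var x) \<^bold>\<longrightarrow> Neg ?M"
  let ?W = "\<^bold>\<forall>x. St (Var x) \<^bold>\<longrightarrow> ?E"
  let ?V = "\<^bold>\<forall>F. St (Var F) \<^bold>\<longrightarrow> Neg ?W"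
  let ?F = "?P \<^bold>\<longrightarrow> Neg ?V"
  have chal_M: "chal ?M = pprod (pfun pun (plist ?t)) (chal (Neg A))"
    and resp_M: "resp ?M = pprod (plist pun) (resp (Neg A))"
    and chal_P: "chal ?P = pprod (pfun pun (plist ?s)) (pprod (pfun (chal ?M) (resp ?M)) pun)"
    and resp_P: "resp ?P = pprod (plist pun) (pprod (plist (chal ?M)) pun)"
    and chal_W: "chal ?W = pprod (pfun pun (plist ?s)) (chal ?E)"
    and resp_W: "resp ?W = pprod (plist pun) (resp ?E)"
    and chal_V: "chal ?V = pprod (pfun pun (plist (pfun ?s (plist ?t)))) (pprod (pfun (chal ?W) (resp ?W)) pun)"
    and resp_V: "resp ?V = pprod (plist pun) (pprod (plist (chal ?W)) pun)"
    and chal_F: "chal ?F = pprod (pfun (chal ?P) (resp ?P)) (pprod (pfun (chal ?V) (resp ?V)) pun)"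
    and resp_F: "resp ?F = pprod (plist (chal ?P)) (pprod (plist (chal ?V)) pun)"
    by (simp_all add: Neg_def x y F)
  note pers = chal_F resp_F chal_P resp_P chal_V resp_V chal_W resp_W chal_M resp_M
  define Z where "Z = const_val (Pair (vlist [Num 0]) (crv (Neg A)))"
  define U where "U = const_val (Pair (vlist [Num 0]) (crv ?E))"
  have Z: "pfun (chal ?M) (resp ?M) Z Z"
    unfolding Z_def resp_M by (rule const_val_pfun) (simp add: punI)
  have U: "pfun (chal ?W) (resp ?W) U U"
    unfolding U_def resp_W by (rule const_val_pfun) (simp add: punI)
  let ?\<Gamma> = "pprod (pfun (chal ?M) (resp ?M)) (pprod (pfun (chal ?W) (resp ?W)) pun)"
  let ?\<rho>0 = "Pair Z (Pair U (Num 0))"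
  \<comment> \<open>With a value of \<open>x\<close> as variable 0: the challenge to
    \<open>?P\<close> that offers this value alone and plays the constant strategy \<open>Z\<close>
    (variable 2) for \<open>?M\<close>.\<close>
  let ?q = "EPair (ELam (EPair (EVar 1) (ENum 0))) (EPair (EVar 2) (ENum 0))"
  let ?force = "ELam (EFst (EVar 0) \<bullet> ENum 0)"
  let ?fbody = "EPrim PConcat (EMap ?force (EFst (ESnd (EFst (EVar 1) \<bullet> ?q))))"
  let ?v = "EPair (ELam (ELam (EVar 1)) \<bullet> EPair (ELam ?fbody) (ENum 0)) (EPair (EVar 2) (ENum 0))"
  let ?xs = "EPrim PConcat (EMap ?force (EFst (ESnd (EFst (ESnd (EVar 0)) \<bullet> ?v))))"
  let ?p = "EPair (EMap (ELam ?q) ?xs) (EPair (EPair ?v (ENum 0)) (ENum 0))"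
  have "valid ?F"
  proof (rule validI)
    show "pprod (chal ?F) ?\<Gamma> \<tturnstile> ?p : resp ?F"
      unfolding pers by (rule typed_intros typed_nil typed_cons)+
    show \<rho>0: "?\<Gamma> ?\<rho>0 ?\<rho>0"
      using Z U by (simp add: punI del: chal_simps resp_simps)
    fix \<rho> c
    assume \<rho>: "env_ok \<rho>" and c: "chal ?F c c"
    obtain Y G u where c_eq: "c = Pair Y (Pair G u)" and Y: "pfun (chal ?P) (resp ?P) Y Y"
      and G: "pfun (chal ?V) (resp ?V) G G"
      using c unfolding chal_F by (elim pprodE) auto
    let ?\<rho> = "Pair c ?\<rho>0"
    have ok: "pprod (chal ?F) ?\<Gamma> ?\<rho> ?\<rho>" using c \<rho>0 by simp
    have f: "pfun ?s (plist ?t) (den ?\<rho> (ELam ?fbody)) (den ?\<rho> (ELam ?fbody))"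
      and Q: "pfun ?s (chal ?P) (den ?\<rho> (ELam ?q)) (den ?\<rho> (ELam ?q))"
      and v: "chal ?V (den ?\<rho> ?v) (den ?\<rho> ?v)"
      and xs: "plist ?s (den ?\<rho> ?xs) (den ?\<rho> ?xs)"
      and force: "pfun (chal ?W) (plist ?s) (den ?\<rho> ?force) (den ?\<rho> ?force)"
      by (rule typedD(3)[where \<Gamma> = "pprod (chal ?F) ?\<Gamma>", OF _ ok],
          unfold pers, (rule typed_intros typed_nil typed_cons)+)+
    define f' where "f' = den ?\<rho> (ELam ?fbody)"
    define v' where "v' = den ?\<rho> ?v"
    have v'_eq: "v' = Pair (Clo (EVar (Suc 0)) (Pair (vlist [f']) ?\<rho>)) (Pair U (Num 0))"
      by (simp add: v'_def f'_def ap_lam_Clo eval_nat_numeral)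
    define q' where "q' = (\<lambda>a. Pair (Clo (EPair (EVar 1) (ENum 0)) (Pair a ?\<rho>)) (Pair Z (Num 0)))"
    have q': "chal ?P (q' a) (q' a)" and q'_eq: "ap (den ?\<rho> (ELam ?q)) a = q' a" if a: "?s a a" for a
    proof -
      show eq: "ap (den ?\<rho> (ELam ?q)) a = q' a"
        using ap_clo[OF Q[unfolded den.simps] a] by (simp add: q'_def eval_nat_numeral)
      show "chal ?P (q' a) (q' a)"
        using pfunE(3)[OF Q a] unfolding eq .
    qed
    have thunk_q: "ap (vfst (q' a)) b = vlist [a]" if a: "?s a a" for a b
    proof -
      have "pfun pun (plist ?s) (vfst (q' a)) (vfst (q' a))"
        using q'[OF a] unfolding chal_P by (elim pprodE) simp
      from ap_clo[OF this[unfolded q'_def vfst.simps] punI[of b b]] show ?thesis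
        by (simp add: q'_def)
    qed
    define ms where "ms = (\<lambda>a. vfst (vsnd (ap Y (q' a))))"
    have ms: "plist (chal ?M) (ms a) (ms a)" if "?s a a" for a
      using pfunE(3)[OF Y q'[OF that]] unfolding resp_P ms_def by (elim pprodE) auto
    have elems_f: "set (elems (ap f' a)) = (\<Union>m\<in>set (elems (ms a)). set (elems (ap (vfst m) (Num 0))))"
      if a: "?s a a" for a
    proof -
      let ?\<rho>a = "Pair a ?\<rho>"
      have oka: "pprod ?s (pprod (chal ?F) ?\<Gamma>) ?\<rho>a ?\<rho>a" using ok a by simp
      have "pfun (chal ?M) (plist ?t) (den ?\<rho>a ?force) (den ?\<rho>a ?force)"
        by (rule typedD(3)[where \<Gamma> = "pprod ?s (pprod (chal ?F) ?\<Gamma>)", OF _ oka],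
            unfold pers, (rule typed_intros typed_nil typed_cons)+)
      note force = this[unfolded den.simps]
      have "den ?\<rho>a ?q = q' a"
        by (simp add: q'_def eval_nat_numeral)
      then have "den ?\<rho>a (EFst (ESnd (EFst (EVar 1) \<bullet> ?q))) = ms a"
        by (simp add: ms_def c_eq)
      moreover have "ap f' a = den ?\<rho>a ?fbody"
        unfolding f'_def den.simps(2) by (rule ap_clo[OF f[unfolded den.simps(2)] a])
      ultimately have "ap f' a = vlist (concat (map elems (map (ap (den ?\<rho>a ?force)) (elems (ms a)))))"
        by (simp only: den.simps(6,8) prim_ap.simps elems_vlist)
      then show ?thesis
        using map_clo[OF force ms[OF a]] by simp
    qed
    define ws where "ws = vfst (vsnd (ap G v'))"
    have ws: "plist (chal ?W) ws ws"
      using pfunE(3)[OF G v] unfolding resp_V ws_def v'_def by (elim pprodE) auto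
    have "den ?\<rho> (EFst (ESnd (EFst (ESnd (EVar 0)) \<bullet> ?v))) = ws"
      unfolding ws_def v'_def by (simp add: c_eq)
    then have "den ?\<rho> ?xs = vlist (concat (map elems (map (ap (den ?\<rho> ?force)) (elems ws))))"
      by (simp only: den.simps(6,8) prim_ap.simps elems_vlist)
    then have elems_xs: "set (elems (den ?\<rho> ?xs)) = (\<Union>w\<in>set (elems ws). set (elems (ap (vfst w) (Num 0))))"
      using map_clo[OF force[unfolded den.simps] ws] by simp
    have den_p: "den ?\<rho> ?p = Pair (vlist (map (ap (den ?\<rho> (ELam ?q))) (elems (den ?\<rho> ?xs)))) (Pair (Pair v' (Num 0)) (Num 0))"
      by (simp only: den.simps(4,5,8) v'_def)
    show "holds ?F \<rho> c (den ?\<rho> ?p)"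
      unfolding den_p holds.simps(4) vfst.simps vsnd.simps elems_vlist set_map
    proof
      assume hyp: "\<forall>r\<in>ap (den ?\<rho> (ELam ?q)) ` set (elems (den ?\<rho> ?xs)). holds ?P \<rho> r (ap (vfst c) r)"
      have hP: "holds ?P \<rho> (q' e) (ap Y (q' e))" if e: "e \<in> set (elems (den ?\<rho> ?xs))" for e
        using bspec[OF hyp imageI[OF e]] unfolding q'_eq[OF plist_mem[OF xs e]] unfolding c_eq vfst.simps .
      have "\<not> holds ?V \<rho> v' (ap G v')"
      proof
        assume "holds ?V \<rho> v' (ap G v')"
        moreover have f2: "pfun ?s (plist ?t) f' f'" using f by (simp add: f'_def)
        ultimately have "holds (St (Var F) \<^bold>\<longrightarrow> Neg ?W) (\<rho>(F := f')) v' (ap G v')"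
          unfolding holds.simps(5) using F by simp
        then have "holds (Neg ?W) (\<rho>(F := f')) (vsnd v') (vsnd (ap G v'))"
          using f2 F by (simp add: v'_eq del: holds.simps(5))
        then obtain w where w: "w \<in> set (elems ws)" "\<not> holds ?W (\<rho>(F := f')) w (ap U w)"
          unfolding Neg_def[of ?W] holds.simps(4) ws_def v'_eq by (auto simp del: holds.simps(5))
        then obtain a where a: "?s a a" "\<not> holds (St (Var x) \<^bold>\<longrightarrow> ?E) (\<rho>(F := f', x := a)) w (ap U w)"
          unfolding holds.simps(5)[of x] using x by auto
        then obtain e where e: "e \<in> set (elems (ap (vfst w) (Num 0)))" "?s e a"
          and nE: "\<not> holds ?E (\<rho>(F := f', x := a)) (vsnd w) (crv ?E)"
          using x by (auto simp: U_def simp del: canon_simps)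
        have not_tr: "\<not> tr ?E (\<rho>(F := f', x := a))"
          using nE holds_internal(1)[of ?E] A by auto
        have e': "e \<in> set (elems (den ?\<rho> ?xs))"
          unfolding elems_xs using w(1) e(1) by blast
        note ee = plist_mem[OF xs e']
        have "holds (St (Var x) \<^bold>\<longrightarrow> Neg ?M) (\<rho>(x := a)) (q' e) (ap Y (q' e))"
          using hP[OF e'] a(1) x unfolding holds.simps(5)[of x] by simp
        then have "holds (Neg ?M) (\<rho>(x := a)) (vsnd (q' e)) (vsnd (ap Y (q' e)))"
          using thunk_q[OF ee] e(2) x by (simp del: holds.simps(5))
        then obtain m where m: "m \<in> set (elems (ms e))" "\<not> holds ?M (\<rho>(x := a)) m (ap Z m)"
          unfolding Neg_def[of ?M] holds.simps(4) ms_def q'_def by (auto simp del: holds.simps(5))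
        then obtain b where b: "?t b b" "\<not> holds (St (Var y) \<^bold>\<longrightarrow> Neg A) (\<rho>(x := a, y := b)) m (ap Z m)"
          unfolding holds.simps(5)[of y] using y by auto
        then obtain d where d: "d \<in> set (elems (ap (vfst m) (Num 0)))" "?t d b"
          and nA: "\<not> holds (Neg A) (\<rho>(x := a, y := b)) (vsnd m) (crv (Neg A))"
          using y by (auto simp: Z_def simp del: canon_simps)
        have trA: "tr A (\<rho>(x := a, y := b))"
          using nA holds_internal(1)[of "Neg A"] A by auto
        have "d \<in> set (elems (ap f' e))"
          unfolding elems_f[OF ee] using m(1) d(1) by blast
        \<comment> \<open>The candidate \<open>e\<close> equals \<open>a\<close> only in the sense
          of its type; extensionality of \<open>f'\<close> carries \<open>d\<close> from the list at
          \<open>e\<close> to the list at \<open>a\<close>.\<close>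
        moreover have "list_all2 ?t (elems (ap f' e)) (elems (ap f' a))"
          by (rule plistD[OF pfunE(3)[OF f2 e(2)]])
        ultimately obtain d' where d': "d' \<in> set (elems (ap f' a))" "?t d d'"
          by (metis in_set_conv_nth list_all2_conv_all_nth)
        let ?e = "\<rho>(F := f', x := a, y := b)"
        have ok': "env_ok ?e" using \<rho> f2 a(1) b(1) x y F by simp
        have "has ?e (Var y) \<tau> b" "has ?e (Var F \<cdot> Var x) (SeqT \<tau>) (ap f' a)"
          using dist x y F by (auto simp: has_def)
        from tr_Mem[OF ok' this] have "tr (Var y \<^bold>\<in> Var F \<cdot> Var x) ?e"
          using d'(1) is_perD(2)[OF is_per_ty_per is_perD(1)[OF is_per_ty_per d(2)] d'(2)] by blast
        moreover have "tr A ?e"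
          by (rule tr_cong[THEN iffD1, OF _ trA]) (use fv in auto)
        ultimately have "tr ?E (\<rho>(F := f', x := a))"
          using b(1) y by (auto simp del: fun_upd_apply)
        with not_tr show False by contradiction
      qed
      then show "holds (Neg ?V) \<rho> (vsnd c) (Pair (Pair v' (Num 0)) (Num 0))"
        unfolding Neg_def[of ?V] holds.simps(4) by (simp add: c_eq del: holds.simps(5))
    qed
  qed
  then show ?thesis
    by (simp add: AllSt_def)
qed

lemma valid_HAC:
  assumes "internal A" "x = (i, \<sigma>)" "y = (j, \<tau>)" "F = (k, \<sigma> \<rightarrow> SeqT \<tau>)" "distinct [x, y, F]" "F \<notin> fvf A"
  shows "valid ((\<^bold>\<forall>\<^sup>s\<^sup>t x. \<^bold>\<exists>\<^sup>s\<^sup>t y. A) \<^bold>\<longrightarrow> (\<^bold>\<exists>\<^sup>s\<^sup>t F. \<^bold>\<forall>\<^sup>s\<^sup>t x. \<^bold>\<exists>y. Var y \<^bold>\<in> Var F \<cdot> Var x \<^bold>\<and> A))"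
  by (rule valid_trans[OF valid_AllSt_mono[OF valid_ExStE] valid_trans[OF valid_HAC_core[OF assms] valid_ExStI]])

lemma valid_SysP: "A \<in> SysP \<Longrightarrow> wff A \<Longrightarrow> valid A"
proof (induction rule: SysP.induct)
  case (epa A)
  then show ?case by (rule valid_EPA)
next
  case (st_eq s t)
  then show ?case by (intro valid_uncurry valid_st_eq) simp
next
  case (st_closed t)
  then show ?case by (intro valid_st_closed) simp_all
next
  case (st_app f t)
  then obtain \<tau> where "ty_of f = ty_of t \<rightarrow> \<tau>" by auto
  then show ?case by (intro valid_uncurry valid_st_app)
next
  case (external_induction n A)
  then show ?case by (intro valid_external_induction)
next
  case (idealisation A x i \<sigma> y j \<tau> z k)
  then show ?case by (intro valid_idealisation)
next
  case (HAC_int A x i \<sigma> y j \<tau> F k)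
  then show ?case by (intro valid_HAC)
qed

section \<open>Transfer and the standard part principle\<close>

definition branch :: fm where
  "branch = (\<^bold>\<forall>(0, Base). Var (0, Base \<rightarrow> Base) \<cdot>
    code_tm (initseg_tm (Var (1, Base \<rightarrow> Base)) (Var (0, Base))) \<^bold>= Zero)"

lemma ap_fn: "pfun pnat pnat f f \<Longrightarrow> ap f (Num n) = Num (fn f n)"
  using pfunE(3)[of pnat pnat f f "Num n" "Num n"] by (auto simp: pnat_def fn_def)

lemma tr_branch:
  assumes "env_ok \<rho>"
  shows "tr branch \<rho> \<longleftrightarrow>
    (\<forall>n. fn (\<rho> (0, Base \<rightarrow> Base)) (seq_code (map (fn (\<rho> (1, Base \<rightarrow> Base))) [0..<n])) = 0)"
proof -
  let ?f = "(0, Base \<rightarrow> Base)" and ?g = "(1, Base \<rightarrow> Base)" and ?n = "(0, Base)"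
  let ?t = "code_tm (initseg_tm (Var ?g) (Var ?n))"
  have f: "pfun pnat pnat (\<rho> ?f) (\<rho> ?f)"
    using env_okD[OF assms, of ?f] by simp
  have "tr (Var ?f \<cdot> ?t \<^bold>= Zero) (\<rho>(?n := Num k)) \<longleftrightarrow>
      fn (\<rho> ?f) (seq_code (map (fn (\<rho> ?g)) [0..<k])) = 0" for k
  proof -
    let ?\<rho> = "\<rho>(?n := Num k)"
    have ok: "env_ok ?\<rho>" using assms by simp
    have "has ?\<rho> (initseg_tm (Var ?g) (Var ?n)) (SeqT Base) (vlist (map (\<lambda>i. Num (fn (\<rho> ?g) i)) [0..<k]))"
      by (rule has_initseg[OF ok]; rule has_Var) simp_all
    from has_code[OF ok this]
    have "has ?\<rho> ?t Base (Num (seq_code (map (fn (\<rho> ?g)) [0..<k])))"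
      by (simp add: comp_def)
    then show ?thesis
      using ap_fn[OF f] by (simp add: has_def)
  qed
  then show ?thesis
    by (auto simp: branch_def pnat_def simp del: tr.simps(2) fun_upd_apply)
qed

lemma internal_branch [simp]: "internal branch"
  by (simp add: branch_def)

text \<open>The path oracle is applied to every candidate for \<open>f\<close>, giving the
  candidates for \<open>g\<close>. Being extensional, it finds a branch at the candidate that equals
  \<open>f\<close>.\<close>

lemma valid_TRANS_core:
  "valid (\<^bold>\<forall>\<^sup>s\<^sup>t (0, Base \<rightarrow> Base). (\<^bold>\<exists>(1, Base \<rightarrow> Base). branch) \<^bold>\<longrightarrow>
    Neg (\<^bold>\<forall>\<^sup>s\<^sup>t (1, Base \<rightarrow> Base). Neg branch))"
proof -
  let ?f = "(0, Base \<rightarrow> Base)" and ?g = "(1, Base \<rightarrow> Base)"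
  let ?E = "\<^bold>\<exists>?g. branch" and ?M = "\<^bold>\<forall>?g. St (Var ?g) \<^bold>\<longrightarrow> Neg branch"
  let ?F = "St (Var ?f) \<^bold>\<longrightarrow> ?E \<^bold>\<longrightarrow> Neg ?M"
  let ?P = "pfun pnat pnat"
  have chal_M: "chal ?M = pprod (pfun pun (plist ?P)) (chal (Neg branch))"
    and resp_M: "resp ?M = pprod (plist pun) (resp (Neg branch))"
    and chal_F: "chal ?F = pprod (pfun pun (plist ?P))
      (pprod (pfun (chal ?E) (resp ?E)) (pprod (pfun (chal ?M) (resp ?M)) pun))"
    and resp_F: "resp ?F = pprod (plist pun) (pprod (plist (chal ?E)) (pprod (plist (chal ?M)) pun))"
    by (simp_all add: Neg_def)
  note pers = chal_F resp_F chal_M resp_M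
  let ?\<Gamma> = "pprod (chal ?E) (pprod (chal (Neg branch)) pun)"
  let ?\<rho>0 = "Pair (cev ?E) (Pair (cev (Neg branch)) (Num 0))"
  let ?path = "ELam (ELam (EPath (EVar 1) (EVar 0)))"
  let ?gs = "EMap ?path (EFst (EVar 0) \<bullet> ENum 0)"
  let ?q = "EPair (ELam (ELam (EVar 1)) \<bullet> ?gs) (EVar 2)"
  let ?p = "EPair (EPair (ENum 0) (ENum 0)) (EPair (EPair (EVar 1) (ENum 0)) (EPair (EPair ?q (ENum 0)) (ENum 0)))"
  have "valid ?F"
  proof (rule validI)
    show "pprod (chal ?F) ?\<Gamma> \<tturnstile> ?p : resp ?F"
      unfolding pers by (rule typed_intros typed_path typed_nil typed_cons)+
    show \<rho>0: "?\<Gamma> ?\<rho>0 ?\<rho>0"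
      by (simp add: punI del: chal_simps canon_simps)
    fix \<rho> c
    assume \<rho>: "env_ok \<rho>" and c: "chal ?F c c"
    obtain Y X G u where c_eq: "c = Pair Y (Pair X (Pair G u))" and Y: "pfun pun (plist ?P) Y Y"
      using c unfolding chal_F by (elim pprodE) auto
    let ?\<rho> = "Pair c ?\<rho>0"
    have ok: "pprod (chal ?F) ?\<Gamma> ?\<rho> ?\<rho>" using c \<rho>0 by simp
    define fs where "fs = ap Y (Num 0)"
    have fs: "plist ?P fs fs"
      unfolding fs_def by (rule pfunE(3)[OF Y punI])
    have path: "pfun ?P ?P (den ?\<rho> ?path) (den ?\<rho> ?path)"
      by (rule typedD(3)[where \<Gamma> = "pprod (chal ?F) ?\<Gamma>", OF _ ok], unfold pers, (rule typed_intros typed_path)+)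
    let ?path' = "ap (den ?\<rho> ?path)"
    define gs where "gs = vlist (map ?path' (elems fs))"
    have fn_path: "fn (?path' h) = tree_path (fn h)" if h: "?P h h" for h
    proof
      fix n
      have eq: "?path' h = Clo (EPath (EVar 1) (EVar 0)) (Pair h ?\<rho>)"
        by (simp only: den.simps ap_lam_Clo)
      have "?P (?path' h) (?path' h)" by (rule pfunE(3)[OF path h])
      from ap_clo[OF this[unfolded eq], of "Num n" "Num n"]
      show "fn (?path' h) n = tree_path (fn h) n"
        unfolding eq by (simp add: fn_def)
    qed
    have den_q: "den ?\<rho> ?q = Pair (Clo (EVar (Suc 0)) (Pair gs ?\<rho>)) (cev (Neg branch))"
      by (simp add: ap_lam_Clo gs_def fs_def c_eq eval_nat_numeral del: canon_simps)
    have den_p: "den ?\<rho> ?p = Pair (Pair (Num 0) (Num 0)) (Pair (Pair (cev ?E) (Num 0)) (Pair (Pair (den ?\<rho> ?q) (Num 0)) (Num 0)))"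
      by (simp del: canon_simps)
    show "holds ?F \<rho> c (den ?\<rho> ?p)"
      unfolding den_p holds.simps(4)[of "St _"] holds.simps(4)[of ?E]
    proof (intro impI)
      assume "\<forall>q\<in>set (elems (vfst (Pair (Pair (Num 0) (Num 0)) (Pair (Pair (cev ?E) (Num 0)) (Pair (Pair (den ?\<rho> ?q) (Num 0)) (Num 0)))))).
        holds (St (Var ?f)) \<rho> q (ap (vfst c) q)"
      then obtain h where h: "h \<in> set (elems fs)" "?P h (\<rho> ?f)"
        by (auto simp: c_eq fs_def)
      assume "\<forall>q\<in>set (elems (vfst (vsnd (Pair (Pair (Num 0) (Num 0)) (Pair (Pair (cev ?E) (Num 0)) (Pair (Pair (den ?\<rho> ?q) (Num 0)) (Num 0))))))).
        holds ?E \<rho> q (ap (vfst (vsnd c)) q)"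
      then have "holds ?E \<rho> (cev ?E) (ap X (cev ?E))"
        by (simp add: c_eq del: canon_simps)
      then have "tr ?E \<rho>"
        by (rule holds_internal(2)[rotated]) simp
      then obtain a where a: "?P a a" "tr branch (\<rho>(?g := a))" by auto
      have hh: "?P h h" by (rule plist_mem[OF fs h(1)])
      have fn_h: "fn (\<rho> ?f) = fn h"
        using pfun_pnatD(3)[OF h(2)] .
      have "\<forall>n. fn h (seq_code (map (fn a) [0..<n])) = 0"
        using a tr_branch[of "\<rho>(?g := a)"] \<rho> fn_h by simp
      \<comment> \<open>The branch \<open>a\<close> in the model shows that the choice defining
        \<open>tree_path\<close> succeeds.\<close>
      then have "\<forall>n. fn h (seq_code (map (tree_path (fn h)) [0..<n])) = 0"
        unfolding tree_path_def
        by (rule someI[of "\<lambda>g. \<forall>n. fn h (seq_code (map g [0..<n])) = 0" "fn a"])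
      moreover have b: "?P (?path' h) (?path' h)"
        by (rule pfunE(3)[OF path hh])
      ultimately have "tr branch (\<rho>(?g := ?path' h))"
        using tr_branch[of "\<rho>(?g := ?path' h)"] \<rho> fn_h fn_path[OF hh] by simp
      then have "\<not> tr (Neg branch) (\<rho>(?g := ?path' h))" by simp
      then have nB: "\<not> holds (Neg branch) (\<rho>(?g := ?path' h)) (cev (Neg branch)) r" for r
        using holds_internal(2)[of "Neg branch"] by auto
      have "\<not> holds ?M \<rho> (den ?\<rho> ?q) (ap G (den ?\<rho> ?q))"
      proof
        assume "holds ?M \<rho> (den ?\<rho> ?q) (ap G (den ?\<rho> ?q))"
        then have "holds (St (Var ?g) \<^bold>\<longrightarrow> Neg branch) (\<rho>(?g := ?path' h)) (den ?\<rho> ?q) (ap G (den ?\<rho> ?q))"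
          unfolding holds.simps(5) using b by simp
        moreover have "?path' h \<in> set (elems gs)"
          using h(1) by (simp add: gs_def)
        ultimately show False
          using nB b unfolding den_q by (auto simp del: canon_simps den.simps)
      qed
      then show "holds (Neg ?M) \<rho> (vsnd (vsnd c)) (vsnd (vsnd (Pair (Pair (Num 0) (Num 0)) (Pair (Pair (cev ?E) (Num 0)) (Pair (Pair (den ?\<rho> ?q) (Num 0)) (Num 0))))))"
        unfolding Neg_def[of ?M] holds.simps(4) by (simp add: c_eq del: holds.simps(5) den.simps canon_simps)
    qed
  qed
  then show ?thesis
    unfolding AllSt_def by (rule valid_Gen)
qed

lemma valid_Pi11_TRANS: "valid Pi11_TRANS"
proof -
  let ?f = "(0, Base \<rightarrow> Base)" and ?g = "(1, Base \<rightarrow> Base)"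
  have "valid (((\<^bold>\<exists>?g. branch) \<^bold>\<longrightarrow> Neg (\<^bold>\<forall>\<^sup>s\<^sup>t ?g. Neg branch)) \<^bold>\<longrightarrow> (\<^bold>\<exists>?g. branch) \<^bold>\<longrightarrow> (\<^bold>\<exists>\<^sup>s\<^sup>t ?g. branch))"
    by (rule valid_MP[OF valid_P2 valid_weaken[OF valid_ExStI]])
  from valid_MP[OF valid_AllSt_mono[OF this] valid_TRANS_core] show ?thesis
    by (simp add: Pi11_TRANS_def branch_def Let_def)
qed

section \<open>Refutation of the standard part principle\<close>

definition binary :: "var \<Rightarrow> fm" where
  "binary x = (\<^bold>\<forall>(0, Base). Var x \<cdot> Var (0, Base) \<^bold>\<le> Succ \<cdot> Zero)"

definition agree :: fm where
  "agree = (\<^bold>\<forall>\<^sup>s\<^sup>t (0, Base). Var (0, Base \<rightarrow> Base) \<cdot> Var (0, Base) \<^bold>= Var (1, Base \<rightarrow> Base) \<cdot> Var (0, Base))"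

text \<open>Replaces the existential and the conjunction by implications and negations, so that the
  challenges can be written down directly.\<close>

lemma valid_STP_core:
  assumes "valid STP"
  shows "valid (binary (0, Base \<rightarrow> Base) \<^bold>\<longrightarrow>
    Neg (\<^bold>\<forall>\<^sup>s\<^sup>t (1, Base \<rightarrow> Base). binary (1, Base \<rightarrow> Base) \<^bold>\<longrightarrow> Neg agree))"
proof -
  let ?a = "(0, Base \<rightarrow> Base)" and ?b = "(1, Base \<rightarrow> Base)"
  let ?H = "\<^bold>\<forall>\<^sup>s\<^sup>t ?b. binary ?b \<^bold>\<longrightarrow> Neg agree" and ?K = "\<^bold>\<forall>\<^sup>s\<^sup>t ?b. Neg (binary ?b \<^bold>\<and> agree)"
  have STP: "valid (\<^bold>\<forall>?a. binary ?a \<^bold>\<longrightarrow> (\<^bold>\<exists>\<^sup>s\<^sup>t ?b. binary ?b \<^bold>\<and> agree))"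
    using assms by (simp add: STP_def binary_def agree_def Let_def)
  have "[binary ?b \<^bold>\<longrightarrow> Neg agree] \<Turnstile> Neg (binary ?b \<^bold>\<and> agree)"
  proof (rule entails_neg)
    let ?\<Gamma> = "[binary ?b \<^bold>\<longrightarrow> Neg agree] @ [binary ?b \<^bold>\<and> agree]"
    have *: "?\<Gamma> \<Turnstile> binary ?b \<^bold>\<longrightarrow> Neg agree" "?\<Gamma> \<Turnstile> binary ?b \<^bold>\<and> agree"
      by (rule entails_hyp, simp)+
    show "?\<Gamma> \<Turnstile> Falsum"
      by (rule entails_negE[OF entails_mp[OF *(1) entails_andE(1)[OF *(2)]] entails_andE(2)[OF *(2)]])
  qed
  then have HK: "valid (?H \<^bold>\<longrightarrow> ?K)"
    by (intro valid_AllSt_mono) (simp add: entails_def)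
  let ?\<Gamma> = "[binary ?a] @ [?H]"
  have hyp: "?\<Gamma> \<Turnstile> binary ?a" "?\<Gamma> \<Turnstile> ?H"
    by (rule entails_hyp, simp)+
  have "?\<Gamma> \<Turnstile> Neg ?K"
    by (rule entails_mp[OF entails_valid[OF valid_ExStE]
          entails_mp[OF entails_inst[OF entails_valid[OF STP]] hyp(1)]])
  then have "?\<Gamma> \<Turnstile> Falsum"
    by (rule entails_negE[OF _ entails_mp[OF entails_valid[OF HK] hyp(2)]])
  from entails_neg[OF this] show ?thesis
    by (simp add: entails_def)
qed

lemma tr_binary:
  assumes "env_ok \<rho>" "snd x = Base \<rightarrow> Base" "\<And>k. fn (\<rho> x) k \<le> 1"
  shows "tr (binary x) \<rho>"
proof -
  have f: "pfun pnat pnat (\<rho> x) (\<rho> x)"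
    using env_okD[OF assms(1), of x] assms(2) by simp
  have "tr (Var x \<cdot> Var (0, Base) \<^bold>\<le> Succ \<cdot> Zero) (\<rho>((0, Base) := Num k))" for k
  proof -
    let ?\<rho> = "\<rho>((0, Base) := Num k)"
    have ok: "env_ok ?\<rho>" using assms(1) by simp
    have "x \<noteq> (0, Base)" using assms(2) by auto
    then have l: "has ?\<rho> (Var x \<cdot> Var (0, Base)) Base (Num (fn (\<rho> x) k))"
      using ap_fn[OF f] assms(2) by (simp add: has_def)
    show ?thesis
      using tr_Leq[OF ok l has_Succ[OF has_Zero]] assms(3)[of k] by simp
  qed
  then show ?thesis
    by (auto simp: binary_def pnat_def simp del: fun_upd_apply)
qed

text \<open>Cantor's diagonal argument: injectivity reserves the position \<open>nu h\<close> for
  defeating \<open>h\<close>, and finiteness of \<open>B\<close> lets a finite table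
  suffice.\<close>

lemma diagonal:
  assumes "finite B" "inj_on nu B"
  obtains xs where "\<forall>k. (if k < length xs then xs ! k else 0) \<le> (1 :: nat)"
    "\<forall>h\<in>B. (if nu h < length xs then xs ! nu h else 0) \<noteq> h (nu h)"
proof -
  \<comment> \<open>At \<open>k = nu h\<close> this flips \<open>h k\<close> within
    \<open>{0, 1}\<close>; off the image the inverse is arbitrary, but the value is still
    binary.\<close>
  define g where "g = (\<lambda>k. if the_inv_into B nu k k = 0 then 1 else 0 :: nat)"
  obtain m where m: "\<And>h. h \<in> B \<Longrightarrow> nu h < m"
    using finite_nat_set_iff_bounded[of "nu ` B"] assms(1) by auto
  show ?thesis
  proof (rule that[of "map g [0..<m]"])
    show "\<forall>k. (if k < length (map g [0..<m]) then map g [0..<m] ! k else 0) \<le> 1"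
      by (simp add: g_def)
    show "\<forall>h\<in>B. (if nu h < length (map g [0..<m]) then map g [0..<m] ! nu h else 0) \<noteq> h (nu h)"
      using m the_inv_into_f_f[OF assms(2)] by (simp add: g_def)
  qed
qed

text \<open>
  A realizer of \<open>STP\<close> must, for every \<open>G\<close>, name finitely many lists \<open>m\<close> such that every binary sequence
  agrees up to \<open>G m\<close> with a member of some \<open>m\<close>.  Taking \<open>G m\<close> above \<open>nu h\<close> for all \<open>h\<close> in \<open>m\<close>, a sequence
  that differs from each \<open>h\<close> at \<open>nu h\<close> escapes; it exists because \<open>nu\<close> is injective.
\<close>

lemma not_valid_STP: "\<not> valid STP"
proof
  assume "valid STP"
  let ?a = "(0, Base \<rightarrow> Base)" and ?b = "(1, Base \<rightarrow> Base)"
  let ?M = "\<^bold>\<forall>?b. St (Var ?b) \<^bold>\<longrightarrow> binary ?b \<^bold>\<longrightarrow> Neg agree"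
  let ?F = "binary ?a \<^bold>\<longrightarrow> Neg ?M"
  let ?P = "pfun pnat pnat"
  from valid_STP_core[OF \<open>valid STP\<close>] obtain d where d: "pfun (chal ?F) (resp ?F) d d"
    "\<And>\<rho> c. env_ok \<rho> \<Longrightarrow> chal ?F c c \<Longrightarrow> holds ?F \<rho> c (ap d c)"
    unfolding valid_def realizes_def AllSt_def by blast
  have chal_Q: "chal agree = pprod (pfun pun (plist pnat)) pun"
    and resp_Q: "resp agree = pprod (plist pun) pun"
    and chal_bin: "chal (binary x) = pun" and resp_bin: "resp (binary x) = pun" for x
    by (simp_all add: agree_def AllSt_def binary_def Leq_def)
  have chal_M: "chal ?M = pprod (pfun pun (plist ?P)) (pprod (pfun pun pun) (pprod (pfun (chal agree) (resp agree)) pun))"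
    and resp_M: "resp ?M = pprod (plist pun) (pprod (plist pun) (pprod (plist (chal agree)) pun))"
    and chal_F: "chal ?F = pprod (pfun pun pun) (pprod (pfun (chal ?M) (resp ?M)) pun)"
    and resp_F: "resp ?F = pprod (plist pun) (pprod (plist (chal ?M)) pun)"
    by (simp_all add: Neg_def chal_bin resp_bin)
  \<comment> \<open>\<open>G\<close> reads off the candidates \<open>h\<close> for the standard
    sequence, adds all \<open>Suc (nu h)\<close> and asks for agreement below this sum. Hence every
    \<open>nu h\<close> is among the tested positions.\<close>
  let ?sum = "EPrim PSum (EMap (ELam (ENu (EVar 0))) (EFst (EVar 0) \<bullet> ENum 0))"
  let ?q = "EPair (ELam (ELam (EVar 1)) \<bullet> EPrim PUpt ?sum) (ENum 0)"
  let ?one = "EPair (ENum 0) (ENum 0)"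
  let ?g = "EPair ?one (EPair ?one (EPair (EPair ?q (ENum 0)) (ENum 0)))"
  define G where "G = Clo ?g (Num 0)"
  have G: "pfun (chal ?M) (resp ?M) G G"
    unfolding G_def
    by (rule clo_nil_pfun, unfold chal_M resp_M chal_Q resp_Q,
        (rule typed_intros typed_nil typed_cons typed_upt typed_sum typed_nu)+)
  \<comment> \<open>Being binary is an internal property, so its strategy is a filler; the real
    challenge is \<open>G\<close>.\<close>
  define c where "c = Pair (const_val (Num 0)) (Pair G (Num 0))"
  have c: "chal ?F c c"
    unfolding chal_F c_def using G by (simp add: punI const_val_pfun del: chal_simps resp_simps)
  define ms where "ms = vfst (vsnd (ap d c))"
  have ms: "plist (chal ?M) ms ms"
    using pfunE(3)[OF d(1) c] unfolding resp_F ms_def by (elim pprodE) auto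
  define hs where "hs = (\<lambda>m. map fn (elems (ap (vfst m) (Num 0))))"
  define N where "N = (\<lambda>m. sum_list (map (Suc \<circ> nu) (hs m)))"
  have ap_G: "ap G m = Pair (Pair (Num 0) (Num 0)) (Pair (Pair (Num 0) (Num 0))
      (Pair (vlist [Pair (Clo (EVar (Suc 0)) (Pair (vlist (map Num [0..<N m])) (Pair m (Num 0)))) (Num 0)]) (Num 0)))"
    and list_m: "plist ?P (ap (vfst m) (Num 0)) (ap (vfst m) (Num 0))"
    if m: "chal ?M m m" for m
  proof -
    have "pfun pun (plist ?P) (vfst m) (vfst m)"
      using m unfolding chal_M by (elim pprodE) auto
    from pfunE(3)[OF this punI] show l: "plist ?P (ap (vfst m) (Num 0)) (ap (vfst m) (Num 0))" .
    have "pfun ?P pnat (Clo (ENu (EVar 0)) (Pair m (Num 0))) (Clo (ENu (EVar 0)) (Pair m (Num 0)))"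
      by (rule clo_pfun[where \<Gamma> = pun, OF _ punI]) (rule typed_nu typed_vars)+
    from map_clo[OF this l] have "den (Pair m (Num 0)) ?sum = Num (N m)"
      by (simp add: N_def hs_def comp_def cong: map_cong)
    then show "ap G m = Pair (Pair (Num 0) (Num 0)) (Pair (Pair (Num 0) (Num 0))
      (Pair (vlist [Pair (Clo (EVar (Suc 0)) (Pair (vlist (map Num [0..<N m])) (Pair m (Num 0)))) (Num 0)]) (Num 0)))"
      using ap_clo[OF G[unfolded G_def] m] unfolding G_def
      by (simp add: ap_lam_Clo del: den.simps(8) prim_ap.simps(7))
  qed
  \<comment> \<open>All functions that the supposed realizer names when it is confronted with
    \<open>G\<close>.\<close>
  define B where "B = (\<Union>m\<in>set (elems ms). set (hs m))"
  have "finite B" by (simp add: B_def)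
  moreover have "inj_on nu B"
  proof (rule inj_onI)
    fix h h' assume "h \<in> B" "h' \<in> B" and eq: "nu h = nu h'"
    then obtain m e m' e' where *: "m \<in> set (elems ms)" "e \<in> set (elems (ap (vfst m) (Num 0)))" "h = fn e"
      "m' \<in> set (elems ms)" "e' \<in> set (elems (ap (vfst m') (Num 0)))" "h' = fn e'"
      unfolding B_def hs_def by auto
    have "?P e e" "?P e' e'"
      using plist_mem[OF list_m[OF plist_mem[OF ms *(1)]] *(2)]
        plist_mem[OF list_m[OF plist_mem[OF ms *(4)]] *(5)] .
    then show "h = h'"
      using nu_inj[OF pfun_pnatD(1) pfun_pnatD(1)] eq *(3,6) by blast
  qed
  ultimately obtain xs where xs: "\<forall>k. (if k < length xs then xs ! k else 0) \<le> (1 :: nat)"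
    "\<forall>h\<in>B. (if nu h < length xs then xs ! nu h else 0) \<noteq> h (nu h)"
    by (rule diagonal)
  \<comment> \<open>The diagonal sequence is a finite table, hence an object of the model on which
    the realizer must succeed.\<close>
  define a where "a = Clo (EPrim (PTab xs) (EVar 0)) (Num 0)"
  have a: "?P a a"
    unfolding a_def by (rule clo_nil_pfun) (rule typed_tab typed_vars)+
  have fn_a: "fn a k = (if k < length xs then xs ! k else 0)" for k
    using ap_clo[OF a[unfolded a_def], of "Num k" "Num k"] unfolding a_def fn_def by simp
  obtain \<rho>1 where "env_ok \<rho>1" using env_exists by blast
  define \<rho> where "\<rho> = \<rho>1(?a := a)"
  have \<rho>: "env_ok \<rho>" using \<open>env_ok \<rho>1\<close> a by (simp add: \<rho>_def)
  have \<rho>_a: "\<rho> ?a = a" by (simp add: \<rho>_def)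
  have holds_binary: "holds (binary x) \<rho>' q r \<longleftrightarrow> tr (binary x) \<rho>'" for x \<rho>' q r
    by (simp add: binary_def Leq_def)
  have "tr (binary ?a) \<rho>"
    by (rule tr_binary[OF \<rho>]) (use xs(1) in \<open>simp_all add: \<rho>_a fn_a\<close>)
  with d(2)[OF \<rho> c] have "holds (Neg ?M) \<rho> (vsnd c) (vsnd (ap d c))"
    unfolding holds.simps(4)[of "binary ?a"] holds_binary by blast
  then obtain m where m: "m \<in> set (elems ms)" "\<not> holds ?M \<rho> m (ap G m)"
    unfolding Neg_def[of ?M] holds.simps(4) ms_def c_def by (auto simp del: holds.simps(5))
  then obtain b where b: "?P b b"
    "\<not> holds (St (Var ?b) \<^bold>\<longrightarrow> binary ?b \<^bold>\<longrightarrow> Neg agree) (\<rho>(?b := b)) m (ap G m)"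
    unfolding holds.simps(5) by auto
  note mm = plist_mem[OF ms m(1)]
  let ?r = "Pair (Clo (EVar (Suc 0)) (Pair (vlist (map Num [0..<N m])) (Pair m (Num 0)))) (Num 0)"
  \<comment> \<open>If \<open>G\<close> fails the test \<open>m\<close>, then some candidate
    \<open>e\<close> equals \<open>b\<close> and the diagonal sequence agrees with \<open>b\<close>
    on all requested positions.\<close>
  from b(2) obtain e where e: "e \<in> set (elems (ap (vfst m) (Num 0)))" "?P e b"
    and agree: "\<And>Y. \<exists>Y'. holds agree (\<rho>(?b := b)) ?r Y'"
    unfolding ap_G[OF mm] by (auto simp: Neg_def)
  then obtain Y where Y: "holds agree (\<rho>(?b := b)) ?r Y" by blast
  have fn_b: "fn b = fn e" by (rule pfun_pnatD(3)[OF e(2)])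
  have "fn e \<in> set (hs m)" using e(1) by (simp add: hs_def)
  then have "fn e \<in> B" using m(1) by (auto simp: B_def)
  \<comment> \<open>The sum dominates each of its entries, so the position \<open>nu (fn e)\<close>
    is requested, where the diagonal sequence differs from \<open>fn e\<close>.\<close>
  have "Suc (nu (fn e)) \<le> N m"
    unfolding N_def using \<open>fn e \<in> set (hs m)\<close> by (intro member_le_sum_list) auto
  let ?k = "nu (fn e)"
  have "holds (St (Var (0, Base)) \<^bold>\<longrightarrow> Var ?a \<cdot> Var (0, Base) \<^bold>= Var ?b \<cdot> Var (0, Base))
      (\<rho>(?b := b, (0, Base) := Num ?k)) ?r Y"
    using Y unfolding agree_def AllSt_def holds.simps(5) by simp
  then have "pnat (ap a (Num ?k)) (ap b (Num ?k))"
    using \<open>Suc ?k \<le> N m\<close> by (auto simp: \<rho>_a)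
  then have "fn a ?k = fn b ?k"
    by (auto simp: pnat_def fn_def)
  with xs(2) \<open>fn e \<in> B\<close> fn_b fn_a show False by auto
qed

theorem corollary4p6:
  assumes "consistent (SysP \<union> {Pi11_TRANS})"
  shows "\<not> (SysP \<union> {Pi11_TRANS} \<^bold>\<turnstile> STP)"
proof
  assume "SysP \<union> {Pi11_TRANS} \<^bold>\<turnstile> STP"
  then have "valid STP"
    by (rule valid_derives) (auto intro: valid_SysP valid_Pi11_TRANS)
  with not_valid_STP show False by contradiction
qed

end
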